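(* With $z_1,z_2,z_3$, $T$ and $\boldsymbol\lambda=(\lambda_1,\lambda_2,\lambda_3,\lambda_4)$ the specific numbers, map and vector defined in the context, let $d_1,d_2,d_3>0$ be defined by $$d_1=\frac{1}{3z_1}-1\cong 0.213841,\quad d_2=\frac{2-3z_2}{3z_2-1}\cong 4.036935,\quad d_3=\frac{3-3z_3}{3z_3-2}\cong 1.428826.$$ Then for any switched server system with positive parameters $d_{ij}$ ($1\le i,j\le3$, $i\neq j$) satisfying $$\frac{d_{13}}{d_{12}}=d_1,\qquad \frac{d_{21}}{d_{23}}=d_2,\qquad \frac{d_{32}}{d_{31}}=d_3,$$ the following statements are true: (a) The switched server system has no periodic orbit. (b) The Poincaré map $F:\partial\Delta\to\partial\Delta$ of the system is topologically semiconjugate to $T$. (c) $\omega_F(\mathbf v)$ is a Cantor set for every $\mathbf v\in\partial\Delta$. (d) The frequency $\mathrm{freq}(i)$ with which the server is connected to the tank $i$ at the switching times is $$\mathrm{freq}(1)=\frac{\lambda_3}{|\boldsymbol\lambda|}\cong 34.44\%,\quad \mathrm{freq}(2)=\frac{\lambda_1+\lambda_4}{|\boldsymbol\lambda|}\cong 41.82\%,\quad \mathrm{freq}(3)=\frac{\lambda_2}{|\boldsymbol\lambda|}\cong 23.72\%.$$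
   Context: **The map $T$.** Let $$P=\begin{pmatrix}3&3&5&4\\1&2&3&3\\1&1&2&1\\2&3&5&5\end{pmatrix},\qquad Q=\begin{pmatrix}1&0&0&0\\0&1&1&0\\0&0&1&1\\0&1&0&0\end{pmatrix}.$$ Let $\eta$ be the Perron-Frobenius eigenvalue of $P$ and $\boldsymbol\nu$ the probability eigenvector with positive entries, $P\boldsymbol\nu=\eta\boldsymbol\nu$. Let $\boldsymbol\lambda=(\lambda_1,\lambda_2,\lambda_3,\lambda_4)=Q\boldsymbol\nu$ and $|\boldsymbol\lambda|=\lambda_1+\lambda_2+\lambda_3+\lambda_4$. Let $I_1=[0,\lambda_1)$, $I_2=[\lambda_1,\lambda_1+\lambda_2)$, $I_3=[\lambda_1+\lambda_2,\lambda_1+\lambda_2+\lambda_3)$, $I_4=[\lambda_1+\lambda_2+\lambda_3,|\boldsymbol\lambda|]$, and let $T:[0,|\boldsymbol\lambda|]\to[0,|\boldsymbol\lambda|]$ be $T(x)=-x+\lambda_1+\lambda_3$ on $I_1$, $T(x)=-x+\lambda_1+|\boldsymbol\lambda|$ on $I_2$, $T(x)=-x+\lambda_1+\lambda_2+\lambda_3$ on $I_3$, $T(x)=-x+\lambda_1+\lambda_3+|\boldsymbol\lambda|$ on $I_4$. **The numbers $z_1,z_2,z_3$.** Let $p_1=0$, $p_2=T(\lambda_1+\lambda_2)$, $p_3=T(\lambda_1+\lambda_2+\lambda_3)$, $p_4=|\boldsymbol\lambda|$. For $i,j\in\{1,2,3,4\}$ let $K_{ij}=\{k\ge0: T^k(p_j)\in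 I_i\}$ and $c_{ij}=\sum_{k\in K_{ij}}2^{-k}$. Let $M$ be the $3\times3$ matrix with entries $M_{ij}=c_{ij}-c_{i4}$, $1\le i,j\le3$. Let $u_4=1-u_1-u_2-u_3>0$, where $u_1,u_2,u_3>0$ is the unique solution of the linear system $$\begin{pmatrix} u_1 \\ u_2 \\ u_3 \end{pmatrix}=\frac12M\begin{pmatrix}-1&-1&-1\\0&1&0\\0&0&1\end{pmatrix}\begin{pmatrix} u_1 \\ u_2 \\ u_3 \end{pmatrix}+\frac12M\begin{pmatrix}1\\0\\0\end{pmatrix}+\frac12\begin{pmatrix} c_{14} \\ c_{24} \\ c_{34} \end{pmatrix}.$$ Let $z_1=u_1$, $z_2=u_1+u_2$, $z_3=u_1+u_2+u_3$. **Switched server system with parameters $d_{ij}>0$.** There are three tanks $1,2,3$ and one server. The volume of fluid in tank $i$ at time $t\ge0$ is $v_i(t)\ge 0$; $\sum_i v_i(0)=1$. Fluid is delivered to every tank at constant rate $\frac13$ and is removed, at constant rate $1$, from the tank $l(t)\in\{1,2,3\}$ to which the server is connected at time $t$. Thus while the server is at tank $j$, $v_j$ decreases at rate $\frac23$, the other two volumes increase at rate $\frac13$, and $\sum_i v_i(t)=1$ for all $t$. The state is $\mathbf v(t)=(v_1(t),v_2(t),v_3(t))\in\Delta=\{(v_1,v_2,v_3): v_i\ge0,\ v_1+v_2+v_3=1\}$, and $\partial\Delta$ is the set of points of $\Delta$ with at least one zero coordinate. The function $l$ is right-continuous. At $t=0$ the server is connected to a non-empty tank. The times $0\le t_1<t_2<\cdots$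 at which some tank is empty are the switching times. When tank $i$ is empty at a switching time $t$, the server moves to the tank $j\ne i$ with the largest scaled volume $d_{ij}v_j(t)$ (if two tanks are empty, it moves to the only non-empty tank). In case of a tie the server moves to tank $3$ if $i=1$, to tank $1$ if $i=2$, and to tank $2$ if $i=3$. The Poincaré map $F:\partial\Delta\to\partial\Delta$ sends the state at a switching time to the state at the next switching time. A periodic orbit of the system is a trajectory $t\mapsto\mathbf v(t)$ with $\mathbf v(t+\tau)=\mathbf v(t)$ for all $t\ge0$ and some $\tau>0$. $\omega_F(\mathbf v)$ is the $\omega$-limit set of $\mathbf v$ under $F$ (the set of limits of subsequences of $(F^n(\mathbf v))_n$). The frequency is $\mathrm{freq}(i)=\lim_{n\to\infty}\frac1n\#\{1\le k\le n: l(t_k)=i\}$. **Semiconjugacy.** A map $f:[0,1]\to[0,1]$ is topologically semiconjugate to $T$ if there is a continuous, surjective, nondecreasing $h:[0,1]\to[0,|\boldsymbol\lambda|]$ with $h\circ f=T\circ h$. The Poincaré map $F$ is identified with $f=\varphi^{-1}\circ F\circ\varphi:[0,1]\to[0,1]$, so that $F$ is semiconjugate to $T$ means that $f$ is. Here, with $\mathbf e_1,\mathbf e_2,\mathbf e_3$ the standard basis, $\varphi:[0,1]\to\partial\Delta$ is $\varphi(t)=(1-3t)\mathbf e_2+3t\,\mathbf e_3$ for $t\in[0,\frac13)$, $\varphi(t)=(2-3t)\mathbf e_3+(3t-1)\mathbf e_1$ for $t\in[\frac13,\frac23)$, $\varphi(t)=(3-3t)\mathbf e_1+(3t-2)\mathbf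 e_2$ for $t\in[\frac23,1]$; $\varphi$ is injective except for $\varphi(0)=\varphi(1)=\mathbf e_2$, and $\mathbf e_2$ is not in the image of $F$. The symbol $\cong$ denotes numerical approximation. *)

theory Defs
  imports "HOL-Analysis.Analysis"
begin

section \<open>The interval exchange with flips\<close>

definition P_mat :: "real^4^4" where
  "P_mat = vector [vector [3,3,5,4], vector [1,2,3,3], vector [1,1,2,1], vector [2,3,5,5]]"

definition Q_mat :: "real^4^4" where
  "Q_mat = vector [vector [1,0,0,0], vector [0,1,1,0], vector [0,0,1,1], vector [0,1,0,0]]"

definition complex_eigenvalue :: "real^'n^'n \<Rightarrow> complex \<Rightarrow> bool" where
  "complex_eigenvalue A \<mu> \<longleftrightarrow>
     (\<exists>w::complex^'n. w \<noteq> 0 \<and> (\<chi> i j. complex_of_real (A $ i $ j)) *v w = \<mu> *s w)"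

text \<open>The Perron-Frobenius eigenvalue: the real eigenvalue of maximal modulus among
  all complex eigenvalues.\<close>

definition perron_eigenvalue :: "real^'n^'n \<Rightarrow> real" where
  "perron_eigenvalue A =
     (THE r. complex_eigenvalue A (complex_of_real r) \<and>
             (\<forall>\<mu>. complex_eigenvalue A \<mu> \<longrightarrow> cmod \<mu> \<le> r))"

definition eta :: real where
  "eta = perron_eigenvalue P_mat"

definition nu :: "real^4" where
  "nu = (THE x. P_mat *v x = eta *\<^sub>R x \<and> (\<forall>i. 0 < x $ i) \<and> (\<Sum>i\<in>UNIV. x $ i) = 1)"

definition lam :: "real^4" where
  "lam = Q_mat *v nu"

definition lam_total :: real where
  "lam_total = lam $ 1 + lam $ 2 + lam $ 3 + lam $ 4"

definition I_set :: "nat \<Rightarrow> real set" where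
  "I_set i =
     (if i = 1 then {0 ..< lam $ 1}
      else if i = 2 then {lam $ 1 ..< lam $ 1 + lam $ 2}
      else if i = 3 then {lam $ 1 + lam $ 2 ..< lam $ 1 + lam $ 2 + lam $ 3}
      else if i = 4 then {lam $ 1 + lam $ 2 + lam $ 3 .. lam_total}
      else {})"

text \<open>Only the values on \<open>[0, |\<lambda>|]\<close>, the union of the four intervals, are meaningful.\<close>

definition T_map :: "real \<Rightarrow> real" where
  "T_map x =
     (if x \<in> I_set 1 then - x + lam $ 1 + lam $ 3
      else if x \<in> I_set 2 then - x + lam $ 1 + lam_total
      else if x \<in> I_set 3 then - x + lam $ 1 + lam $ 2 + lam $ 3
      else - x + lam $ 1 + lam $ 3 + lam_total)"


section \<open>The numbers \<open>z\<^sub>1, z\<^sub>2, z\<^sub>3\<close>\<close>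

definition p_pt :: "nat \<Rightarrow> real" where
  "p_pt j =
     (if j = 1 then 0
      else if j = 2 then T_map (lam $ 1 + lam $ 2)
      else if j = 3 then T_map (lam $ 1 + lam $ 2 + lam $ 3)
      else lam_total)"

definition K_set :: "nat \<Rightarrow> nat \<Rightarrow> nat set" where
  "K_set i j = {k. (T_map ^^ k) (p_pt j) \<in> I_set i}"

definition c_num :: "nat \<Rightarrow> nat \<Rightarrow> real" where
  "c_num i j = (\<Sum>\<^sub>\<infinity>k\<in>K_set i j. 1 / 2 ^ k)"

definition M_mat :: "real^3^3" where
  "M_mat = vector
     [vector [c_num 1 1 - c_num 1 4, c_num 1 2 - c_num 1 4, c_num 1 3 - c_num 1 4],
      vector [c_num 2 1 - c_num 2 4, c_num 2 2 - c_num 2 4, c_num 2 3 - c_num 2 4],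
      vector [c_num 3 1 - c_num 3 4, c_num 3 2 - c_num 3 4, c_num 3 3 - c_num 3 4]]"

definition N_mat :: "real^3^3" where
  "N_mat = vector [vector [-1,-1,-1], vector [0,1,0], vector [0,0,1]]"

definition u_vec :: "real^3" where
  "u_vec = (THE u. u = (1/2) *\<^sub>R (M_mat *v (N_mat *v u))
                     + (1/2) *\<^sub>R (M_mat *v vector [1,0,0])
                     + (1/2) *\<^sub>R vector [c_num 1 4, c_num 2 4, c_num 3 4])"

definition z1 :: real where "z1 = u_vec $ 1"
definition z2 :: real where "z2 = u_vec $ 1 + u_vec $ 2"
definition z3 :: real where "z3 = u_vec $ 1 + u_vec $ 2 + u_vec $ 3"


section \<open>The switched server system\<close>

text \<open>Tanks are the elements \<open>1, 2, 3\<close> of the three-element type \<open>3\<close> (in which \<open>3 = 0\<close>).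
  Parameters are given as \<open>d i j\<close>; the diagonal values \<open>d i i\<close> are never used.\<close>

definition Delta :: "(real^3) set" where
  "Delta = {x. (\<forall>i. 0 \<le> x $ i) \<and> (\<Sum>i\<in>UNIV. x $ i) = 1}"

definition bd_Delta :: "(real^3) set" where
  "bd_Delta = {x \<in> Delta. \<exists>i. x $ i = 0}"

definition tie_tank :: "3 \<Rightarrow> 3" where
  "tie_tank i = (if i = 1 then 3 else if i = 2 then 1 else 2)"

text \<open>\<open>moves_to d x i j\<close>: in state \<open>x\<close>, with tank \<open>i\<close> empty, the server moves to tank \<open>j\<close>.\<close>

definition moves_to :: "(3 \<Rightarrow> 3 \<Rightarrow> real) \<Rightarrow> real^3 \<Rightarrow> 3 \<Rightarrow> 3 \<Rightarrow> bool" where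
  "moves_to d x i j \<longleftrightarrow>
     (if \<exists>k. k \<noteq> i \<and> x $ k = 0
      then x $ j \<noteq> 0
      else j \<noteq> i \<and>
           (\<forall>k. k \<noteq> i \<and> k \<noteq> j \<longrightarrow>
              d i k * x $ k < d i j * x $ j \<or>
              d i k * x $ k = d i j * x $ j \<and> j = tie_tank i))"

definition switching_times :: "(real \<Rightarrow> real^3) \<Rightarrow> real set" where
  "switching_times v = {t. 0 \<le> t \<and> (\<exists>i. v t $ i = 0)}"

text \<open>Volumes \<open>v\<close> and server position \<open>l\<close>, both relevant for times \<open>t \<ge> 0\<close> only. The flow is
  stated in integrated form because \<open>v\<close> has corners at the switching times. By right-continuity,
  \<open>l t\<close> at a switching time \<open>t\<close> is the tank to which the server has just moved; this includes
  \<open>t = 0\<close> if the initial state has an empty tank. The last clause says that the server moves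
  at switching times only.\<close>

definition server_trajectory ::
  "(3 \<Rightarrow> 3 \<Rightarrow> real) \<Rightarrow> (real \<Rightarrow> real^3) \<Rightarrow> (real \<Rightarrow> 3) \<Rightarrow> bool" where
  "server_trajectory d v l \<longleftrightarrow>
     (\<forall>t\<ge>0. v t \<in> Delta) \<and>
     v 0 $ l 0 \<noteq> 0 \<and>
     (\<forall>t\<ge>0. \<forall>i. ((\<lambda>s. 1/3 - (if l s = i then 1 else 0)) has_integral (v t $ i - v 0 $ i)) {0..t}) \<and>
     (\<forall>t\<ge>0. \<forall>\<^sub>F s in at_right t. l s = l t) \<and>
     (\<forall>t\<ge>0. \<forall>i. v t $ i = 0 \<longrightarrow> moves_to d (v t) i (l t)) \<and>
     (\<forall>s t. 0 \<le> s \<and> s < t \<and> {s<..t} \<inter> switching_times v = {} \<longrightarrow> l t = l s)"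

definition has_periodic_orbit :: "(3 \<Rightarrow> 3 \<Rightarrow> real) \<Rightarrow> bool" where
  "has_periodic_orbit d \<longleftrightarrow>
     (\<exists>v l \<tau>. server_trajectory d v l \<and> 0 < \<tau> \<and> (\<forall>t\<ge>0. v (t + \<tau>) = v t))"

definition poincare_map :: "(3 \<Rightarrow> 3 \<Rightarrow> real) \<Rightarrow> real^3 \<Rightarrow> real^3" where
  "poincare_map d x =
     (THE y. \<exists>v l s t. server_trajectory d v l \<and>
        s \<in> switching_times v \<and> t \<in> switching_times v \<and> s < t \<and>
        {s<..<t} \<inter> switching_times v = {} \<and> v s = x \<and> v t = y)"

text \<open>The \<open>n\<close>-th switching time, counted from \<open>0\<close>: \<open>switch_time v n\<close> is \<open>t\<^sub>n\<^sub>+\<^sub>1\<close>.\<close>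

primrec switch_time :: "(real \<Rightarrow> real^3) \<Rightarrow> nat \<Rightarrow> real" where
  "switch_time v 0 = (LEAST t. t \<in> switching_times v)"
| "switch_time v (Suc n) = (LEAST t. t \<in> switching_times v \<and> switch_time v n < t)"

definition has_frequency :: "(real \<Rightarrow> real^3) \<Rightarrow> (real \<Rightarrow> 3) \<Rightarrow> 3 \<Rightarrow> real \<Rightarrow> bool" where
  "has_frequency v l i r \<longleftrightarrow>
     (\<lambda>n. real (card {k. k < n \<and> l (switch_time v k) = i}) / real n) \<longlonglongrightarrow> r"


section \<open>Dynamical notions\<close>

definition omega_limit :: "('a::topological_space \<Rightarrow> 'a) \<Rightarrow> 'a \<Rightarrow> 'a set" where
  "omega_limit F x = {y. \<exists>r. strict_mono (r :: nat \<Rightarrow> nat) \<and> (\<lambda>n. (F ^^ r n) x) \<longlonglongrightarrow> y}"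

definition cantor_set :: "'a::metric_space set \<Rightarrow> bool" where
  "cantor_set S \<longleftrightarrow>
     S \<noteq> {} \<and> compact S \<and> (\<forall>x\<in>S. x islimpt S) \<and>
     (\<forall>C. C \<subseteq> S \<and> connected C \<longrightarrow> (\<exists>a. C \<subseteq> {a}))"

definition semiconjugate_to_T :: "(real \<Rightarrow> real) \<Rightarrow> bool" where
  "semiconjugate_to_T f \<longleftrightarrow>
     f \<in> {0..1} \<rightarrow> {0..1} \<and>
     (\<exists>h. continuous_on {0..1} h \<and> h ` {0..1} = {0..lam_total} \<and> mono_on {0..1} h \<and>
          (\<forall>t\<in>{0..1}. h (f t) = T_map (h t)))"

definition phi :: "real \<Rightarrow> real^3" where
  "phi t =
     (if t < 1/3 then (1 - 3*t) *\<^sub>R axis 2 1 + (3*t) *\<^sub>R axis 3 1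
      else if t < 2/3 then (2 - 3*t) *\<^sub>R axis 3 1 + (3*t - 1) *\<^sub>R axis 1 1
      else (3 - 3*t) *\<^sub>R axis 1 1 + (3*t - 2) *\<^sub>R axis 2 1)"

text \<open>\<open>\<phi>\<^sup>-\<^sup>1 \<circ> F \<circ> \<phi>\<close>. The choice made by \<open>inv_into\<close> at \<open>e\<^sub>2 = \<phi> 0 = \<phi> 1\<close> is irrelevant, since
  \<open>e\<^sub>2\<close> is not in the image of the Poincare map.\<close>

definition poincare_interval_map :: "(3 \<Rightarrow> 3 \<Rightarrow> real) \<Rightarrow> real \<Rightarrow> real" where
  "poincare_interval_map d t = inv_into {0..1} phi (poincare_map d (phi t))"

end

theory Submission
  imports Defs
begin

text \<open>
  The first return map \<open>R\<close> of \<open>T\<close> to \<open>[0, 1]\<close> is again an exchange of four intervals, of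
  lengths \<open>\<nu>\<close>, and its first return map to \<open>[0, 1/\<eta>]\<close> is a rescaled copy of \<open>R\<close>; the matrix
  of the return words is \<open>P\<close>. The orbits of the images of the discontinuities are self-similar
  under this renormalization, so they never hit a discontinuity again. Hence the renormalization
  towers describe all orbits: every orbit of \<open>T\<close> is dense, and visit frequencies exist because
  \<open>P\<close> contracts the observables of mean zero.

  The Poincare map is, in the coordinate \<open>\<phi>\<close>, a contraction \<open>f\<close> of slope \<open>-1/2\<close> on each of four
  intervals. Put the mass \<open>w j / 2^(k+1)\<close> on the points \<open>T^k (p j)\<close>, where
  \<open>w = (u\<^sub>4, u\<^sub>2, u\<^sub>3, u\<^sub>1)\<close>. The linear system for \<open>u\<close> says that the resulting probability measure
  gives \<open>I\<^sub>i\<close> the mass \<open>u\<^sub>i\<close>. Its quantile function \<open>h\<close> satisfies \<open>h \<circ> f = T \<circ> h\<close>, and the set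
  where \<open>h\<close> is not locally constant is the omega-limit set of every orbit of \<open>f\<close>.
\<close>

section \<open>Renormalization of piecewise isometries\<close>

text \<open>The weights come from the picture of \<open>f_map\<close>. The images of its four
  branches leave four gaps in [0, 1], from left to right of lengths u_4/2, u_2/2, u_3/2, u_1/2, and
  these gaps sit where a semiconjugacy takes the values p_1, p_2, p_3, p_4. Each further step of
  slope -1/2 halves lengths, so after k steps the j-th gap should be collapsed to T^k(p_j) and have
  length w_j/2^(k+1). This suggests a measure with exactly these atoms; the system for u expresses
  that its masses agree with the branch lengths from which the gaps were computed.

  The obstacle on the side of T is the behaviour at breakpoints: itineraries are unambiguous only on
  open pieces, whereas the floors of a tower cover the interval only when they are closed. Words are
  therefore checked on closed intervals (\<open>chain\<close>) and transferred to points whose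
  orbits avoid the breakpoints (\<open>regular\<close>); the orbits of the breakpoints themselves
  are followed until they become regular.\<close>

definition follows :: "('a \<Rightarrow> 'a) \<Rightarrow> ('b \<Rightarrow> 'a set) \<Rightarrow> 'b list \<Rightarrow> 'a \<Rightarrow> 'a \<Rightarrow> bool" where
  "follows F P w x y \<longleftrightarrow> (\<forall>k<length w. (F ^^ k) x \<in> P (w ! k)) \<and> (F ^^ length w) x = y"

definition regular :: "('a \<Rightarrow> 'a) \<Rightarrow> ('b \<Rightarrow> 'a set) \<Rightarrow> 'a \<Rightarrow> bool" where
  "regular F P x \<longleftrightarrow> (\<forall>k. \<exists>a. (F ^^ k) x \<in> P a)"

text \<open>\<open>G\<close> at scale \<open>c\<close> is a map induced by \<open>F\<close>, and
  \<open>w\<close> is the substitution that turns \<open>G\<close>-itineraries into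
  \<open>F\<close>-itineraries.\<close>

definition renorm ::
  "(real \<Rightarrow> real) \<Rightarrow> (nat \<Rightarrow> real set) \<Rightarrow> real \<Rightarrow> (nat \<Rightarrow> nat list) \<Rightarrow> (real \<Rightarrow> real) \<Rightarrow> (nat \<Rightarrow> real set) \<Rightarrow> bool"
  where
  "renorm F P c w G Q \<longleftrightarrow> (\<forall>b. \<forall>y\<in>Q b. w b \<noteq> [] \<and> follows F P (w b) (c * y) (c * G y))"

lemma follows_Nil [simp]: "follows F P [] x y \<longleftrightarrow> x = y"
  by (simp add: follows_def)

lemma follows_Cons [simp]: "follows F P (a # w) x y \<longleftrightarrow> x \<in> P a \<and> follows F P w (F x) y"
proof -
  have "(\<forall>k<Suc (length w). (F ^^ k) x \<in> P ((a # w) ! k)) \<longleftrightarrow>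
      x \<in> P a \<and> (\<forall>k<length w. (F ^^ k) (F x) \<in> P (w ! k))"
    by (subst All_less_Suc2) (simp add: funpow_swap1)
  then show ?thesis
    by (simp add: follows_def funpow_swap1)
qed

lemma follows_append:
  "follows F P u x y \<Longrightarrow> follows F P v y z \<Longrightarrow> follows F P (u @ v) x z"
  by (induction u arbitrary: x) auto

lemma follows_appendD:
  "follows F P (u @ v) x z \<Longrightarrow> follows F P u x ((F ^^ length u) x) \<and> follows F P v ((F ^^ length u) x) z"
  by (induction u arbitrary: x) (auto simp: funpow_swap1)

lemma follows_end: "follows F P w x y \<Longrightarrow> (F ^^ length w) x = y"
  by (simp add: follows_def)

lemma follows_nth: "follows F P w x y \<Longrightarrow> k < length w \<Longrightarrow> (F ^^ k) x \<in> P (w ! k)"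
  by (simp add: follows_def)

lemma renorm_word:
  "renorm F P c w G Q \<Longrightarrow> follows G Q v y z \<Longrightarrow> follows F P (concat (map w v)) (c * y) (c * z)"
proof (induction v arbitrary: y)
  case (Cons b v)
  then have "follows F P (w b) (c * y) (c * G y)" "follows F P (concat (map w v)) (c * G y) (c * z)"
    by (auto simp: renorm_def)
  then show ?case
    by (simp add: follows_append)
qed auto

lemma renorm_comp:
  assumes "renorm F P c w G Q" "renorm G Q c' w' H S"
  shows "renorm F P (c * c') (\<lambda>b. concat (map w (w' b))) H S"
  unfolding renorm_def
proof (intro allI ballI conjI)
  fix b y assume y: "y \<in> S b"
  with assms(2) have f: "follows G Q (w' b) (c' * y) (c' * H y)" and ne: "w' b \<noteq> []"
    by (auto simp: renorm_def)
  from renorm_word[OF assms(1) f]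
  show "follows F P (concat (map w (w' b))) (c * c' * y) (c * c' * H y)"
    by (simp add: mult.assoc)
  from ne obtain a v where v: "w' b = a # v"
    by (cases "w' b") auto
  with f have "c' * y \<in> Q a"
    by simp
  with assms(1) have "w a \<noteq> []"
    by (auto simp: renorm_def)
  with v show "concat (map w (w' b)) \<noteq> []"
    by simp
qed

lemma regular_iterate: "regular F P x \<Longrightarrow> regular F P ((F ^^ k) x)"
  by (metis regular_def comp_apply funpow_add)

lemma regular_step: "regular F P x \<Longrightarrow> regular F P (F x)"
  using regular_iterate[of F P x 1] by simp

lemma regular_prefix:
  "\<forall>k<n. \<exists>a. (F ^^ k) x \<in> P a \<Longrightarrow> \<exists>v. length v = n \<and> follows F P v x ((F ^^ n) x)"
proof (induction n arbitrary: x)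
  case (Suc n)
  then obtain a where a: "x \<in> P a"
    by fastforce
  have "\<forall>k<n. \<exists>a. (F ^^ k) (F x) \<in> P a"
    using Suc.prems by (metis Suc_less_eq funpow_Suc_right comp_apply)
  from Suc.IH[OF this] obtain v where "length v = n" "follows F P v (F x) ((F ^^ n) (F x))"
    by auto
  with a show ?case
    by (intro exI[of _ "a # v"]) (auto simp: funpow_swap1)
qed auto

lemma length_concat_ge:
  "(\<And>a. a \<in> set v \<Longrightarrow> w a \<noteq> []) \<Longrightarrow> length v \<le> length (concat (map w v))"
proof (induction v)
  case (Cons a v)
  then have "length (w a) \<ge> 1" "length v \<le> length (concat (map w v))"
    by (auto simp: Suc_le_eq)
  then show ?case
    by simp
qed auto

lemma follows_set: "follows F P v x z \<Longrightarrow> a \<in> set v \<Longrightarrow> \<exists>y. y \<in> P a"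
  by (induction v arbitrary: x) auto

lemma renorm_regular_upto:
  assumes "renorm F P c w G Q" "\<forall>k<n. \<exists>a. (G ^^ k) y \<in> Q a" "k < n"
  shows "\<exists>a. (F ^^ k) (c * y) \<in> P a"
proof -
  obtain v where v: "length v = n" "follows G Q v y ((G ^^ n) y)"
    using regular_prefix[OF assms(2)] by blast
  have "length v \<le> length (concat (map w v))"
    using follows_set[OF v(2)] assms(1) by (intro length_concat_ge) (auto simp: renorm_def)
  with follows_nth[OF renorm_word[OF assms(1) v(2)], of k] assms(3) v(1) show ?thesis
    by auto
qed

lemma renorm_regular:
  assumes "renorm F P c w G Q" "regular G Q y"
  shows "regular F P (c * y)"
  unfolding regular_def
proof
  fix k
  show "\<exists>a. (F ^^ k) (c * y) \<in> P a"
    using renorm_regular_upto[OF assms(1), of "Suc k" y k] assms(2) by (auto simp: regular_def)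
qed

text \<open>The word \<open>v\<close> leads from \<open>q\<close> to \<open>c * q\<close>, whose
  orbit is spelled by the orbit of \<open>q\<close> itself. So step \<open>n\<close> of
  \<open>q\<close> is controlled by earlier steps of \<open>q\<close>, and the induction is well
  founded because \<open>v\<close> is nonempty.\<close>

lemma regular_self_similar:
  assumes ren: "renorm R P c w R P" and v: "follows R P v q (c * q)" "v \<noteq> []"
  shows "regular R P q"
  unfolding regular_def
proof
  fix n
  show "\<exists>a. (R ^^ n) q \<in> P a"
  proof (induction n rule: less_induct)
    case (less n)
    show ?case
    proof (cases "n < length v")
      case True
      then show ?thesis using follows_nth[OF v(1)] by blast
    next
      case False
      then have "(R ^^ n) q = (R ^^ (n - length v)) ((R ^^ length v) q)"
        by (metis comp_apply funpow_add le_add_diff_inverse2 not_less)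
      also have "\<dots> = (R ^^ (n - length v)) (c * q)"
        using follows_end[OF v(1)] by simp
      finally show ?thesis
        using renorm_regular_upto[OF ren, of n q "n - length v"] less.IH v(2) False
        by (cases v) auto
    qed
  qed
qed

subsection \<open>Density of orbits\<close>

definition isometric :: "(real \<Rightarrow> real) \<Rightarrow> (nat \<Rightarrow> real set) \<Rightarrow> bool" where
  "isometric F P \<longleftrightarrow> (\<forall>a. \<forall>x\<in>P a. \<forall>y\<in>P a. \<bar>F x - F y\<bar> = \<bar>x - y\<bar>)"

text \<open>Open sets are tested instead of points because the floors over the open pieces
  \<open>Q b\<close> miss their endpoints.\<close>

definition covering ::
  "(real \<Rightarrow> real) \<Rightarrow> real set \<Rightarrow> real \<Rightarrow> (nat \<Rightarrow> nat list) \<Rightarrow> (nat \<Rightarrow> real set) \<Rightarrow> bool" where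
  "covering F X c w Q \<longleftrightarrow> (\<forall>U. open U \<and> U \<noteq> {} \<and> U \<subseteq> X \<longrightarrow>
     (\<exists>b. \<exists>y\<in>Q b. \<exists>k<length (w b). (F ^^ k) (c * y) \<in> U))"

definition enters ::
  "(real \<Rightarrow> real) \<Rightarrow> (nat \<Rightarrow> real set) \<Rightarrow> real \<Rightarrow> (real \<Rightarrow> real) \<Rightarrow> (nat \<Rightarrow> real set) \<Rightarrow> bool" where
  "enters F P c G Q \<longleftrightarrow> (\<forall>x. regular F P x \<longrightarrow> (\<exists>k y. (F ^^ k) x = c * y \<and> regular G Q y))"

lemma isometric_follows:
  assumes "isometric F P" "follows F P v x z" "follows F P v x' z'" "k \<le> length v"
  shows "\<bar>(F ^^ k) x - (F ^^ k) x'\<bar> = \<bar>x - x'\<bar>"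
  using assms(2-)
proof (induction v arbitrary: x x' k)
  case (Cons a v)
  show ?case
  proof (cases k)
    case (Suc j)
    have "\<bar>F x - F x'\<bar> = \<bar>x - x'\<bar>"
      using Cons.prems assms(1) by (auto simp: isometric_def)
    with Cons.IH[of "F x" "F x'" j] Cons.prems Suc show ?thesis
      by (simp add: funpow_swap1)
  qed auto
qed auto

lemma enters_comp:
  assumes "enters F P c G Q" "enters G Q c' H S" "renorm F P c w G Q"
  shows "enters F P (c * c') H S"
  unfolding enters_def
proof (intro allI impI)
  fix x assume "regular F P x"
  then obtain k y where k: "(F ^^ k) x = c * y" "regular G Q y"
    using assms(1) by (auto simp: enters_def)
  then obtain j z where j: "(G ^^ j) y = c' * z" "regular H S z"
    using assms(2) by (auto simp: enters_def)
  obtain v where v: "follows G Q v y ((G ^^ j) y)"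
    using regular_prefix[of j G y Q] k(2) by (auto simp: regular_def)
  have "(F ^^ length (concat (map w v))) (c * y) = c * (c' * z)"
    using follows_end[OF renorm_word[OF assms(3) v]] j(1) by simp
  then have "(F ^^ (length (concat (map w v)) + k)) x = c * c' * z"
    using k(1) by (simp add: funpow_add mult.assoc)
  with j(2) show "\<exists>k y. (F ^^ k) x = c * c' * y \<and> regular H S y"
    by blast
qed

text \<open>A point of the \<open>F\<close>-tower in \<open>U\<close> can be moved a little within
  \<open>Q b\<close>, since climbing is isometric. The \<open>G\<close>-tower meets the resulting
  open set \<open>V\<close> on some floor \<open>j\<close>; in the composed tower this floor is
  reached after the words of the first \<open>j\<close> letters.\<close>

lemma covering_comp:
  assumes cov: "covering F X c w Q" "covering G Y c' w' S"
    and ren: "renorm F P c w G Q" "renorm G Q c' w' H S"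
    and iso: "isometric F P" and Q: "\<And>b. open (Q b)" "\<And>b. Q b \<subseteq> Y"
    and disj: "\<And>b b'. b \<noteq> b' \<Longrightarrow> Q b \<inter> Q b' = {}" and c: "0 < c"
  shows "covering F X (c * c') (\<lambda>b. concat (map w (w' b))) S"
  unfolding covering_def
proof (intro allI impI)
  fix U assume U: "open U \<and> U \<noteq> {} \<and> U \<subseteq> X"
  then obtain b y k where y: "y \<in> Q b" "k < length (w b)" "(F ^^ k) (c * y) \<in> U"
    using cov(1) unfolding covering_def by metis
  obtain e where e: "0 < e" "ball ((F ^^ k) (c * y)) e \<subseteq> U"
    using U y(3) open_contains_ball by metis
  define V where "V = Q b \<inter> ball y (e / c)"
  have VU: "(F ^^ k) (c * y') \<in> U" if "y' \<in> V" for y'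
  proof -
    have "\<bar>(F ^^ k) (c * y) - (F ^^ k) (c * y')\<bar> = \<bar>c * y - c * y'\<bar>"
      using ren(1) y that by (intro isometric_follows[OF iso]) (auto simp: renorm_def V_def)
    also have "\<dots> = c * \<bar>y - y'\<bar>"
      using c by (simp add: abs_mult flip: right_diff_distrib)
    also have "\<dots> < e"
      using that c by (simp add: V_def dist_real_def pos_less_divide_eq mult.commute)
    finally show ?thesis
      using e(2) by (auto simp: dist_real_def)
  qed
  have "y \<in> V" "open V" "V \<subseteq> Y"
    using y(1) Q e(1) c by (auto simp: V_def)
  then obtain b' z j where z: "z \<in> S b'" "j < length (w' b')" "(G ^^ j) (c' * z) \<in> V"
    using cov(2) unfolding covering_def by (metis empty_iff)
  have f: "follows G Q (w' b') (c' * z) (c' * H z)"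
    using ren(2) z(1) by (auto simp: renorm_def)
  define u where "u = take j (w' b')"
  have spl: "w' b' = u @ w' b' ! j # drop (Suc j) (w' b')" "length u = j"
    using z(2) by (auto simp: u_def id_take_nth_drop)
  have fu: "follows G Q u (c' * z) ((G ^^ j) (c' * z))"
    using f spl follows_appendD by metis
  have "w' b' ! j = b"
    using follows_nth[OF f z(2)] z(3) disj[of "w' b' ! j" b] by (auto simp: V_def)
  then have spl': "concat (map w (w' b')) = concat (map w u) @ w b @ concat (map w (drop (Suc j) (w' b')))"
    by (subst spl(1)) simp
  have "(F ^^ length (concat (map w u))) (c * (c' * z)) = c * (G ^^ j) (c' * z)"
    using follows_end[OF renorm_word[OF ren(1) fu]] .
  then have "(F ^^ (k + length (concat (map w u)))) (c * c' * z) \<in> U"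
    using VU[OF z(3)] by (simp add: funpow_add mult.assoc)
  moreover have "k + length (concat (map w u)) < length (concat (map w (w' b')))"
    using y(2) by (simp add: spl')
  ultimately show "\<exists>b. \<exists>y\<in>S b. \<exists>k<length (concat (map w (w' b))). (F ^^ k) (c * c' * y) \<in> U"
    using z(1) by blast
qed


text \<open>Two points of the same base interval are at most \<open>c n * K\<close> apart and stay
  so while they climb the tower. Hence the orbit of \<open>x\<close>, once in that interval, passes
  any chosen point of the floors above it, with an error that tends to 0.\<close>

lemma dense_orbits:
  assumes ent: "\<And>n. enters F P (c n) G Q" and ren: "\<And>n. renorm F P (c n) (w n) G Q"
    and cov: "\<And>n. covering F X (c n) (w n) Q" and iso: "isometric F P"
    and pos: "\<And>n. 0 < c n" and lim: "c \<longlonglongrightarrow> 0"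
    and bdd: "\<And>b y. y \<in> Q b \<Longrightarrow> 0 \<le> y \<and> y \<le> K"
    and vis: "\<And>y b. regular G Q y \<Longrightarrow> Q b \<noteq> {} \<Longrightarrow> \<exists>j. (G ^^ j) y \<in> Q b"
    and x: "regular F P x" and U: "open U" "U \<noteq> {}" "U \<subseteq> X"
  shows "\<exists>k. (F ^^ k) x \<in> U"
proof -
  obtain u e where e: "0 < e" "ball u e \<subseteq> U"
    using U open_contains_ball by blast
  have "(\<lambda>n. c n * K) \<longlonglongrightarrow> 0"
    using tendsto_mult_right[OF lim, of K] by simp
  then have "\<forall>\<^sub>F n in sequentially. c n * K < e / 2"
    using e(1) by (intro order_tendstoD(2)) auto
  then obtain n where n: "c n * K < e / 2"
    by (auto simp: eventually_sequentially)
  have "ball u (e / 2) \<subseteq> U" "ball u (e / 2) \<noteq> {}"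
    using e by (auto simp: subset_iff)
  then obtain b y k where y: "y \<in> Q b" "k < length (w n b)" "(F ^^ k) (c n * y) \<in> ball u (e / 2)"
    using cov[of n] U(3) unfolding covering_def by (metis open_ball subset_trans)
  obtain k1 y1 where y1: "(F ^^ k1) x = c n * y1" "regular G Q y1"
    using ent[of n] x by (auto simp: enters_def)
  obtain j where j: "(G ^^ j) y1 \<in> Q b"
    using vis y1(2) y(1) by blast
  obtain v where v: "follows G Q v y1 ((G ^^ j) y1)"
    using regular_prefix[of j G y1 Q] y1(2) by (auto simp: regular_def)
  define k2 where "k2 = length (concat (map (w n) v))"
  have k2: "(F ^^ k2) (c n * y1) = c n * (G ^^ j) y1"
    using follows_end[OF renorm_word[OF ren v]] by (simp add: k2_def)
  have "\<bar>(F ^^ k) (c n * (G ^^ j) y1) - (F ^^ k) (c n * y)\<bar> = \<bar>c n * (G ^^ j) y1 - c n * y\<bar>"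
    using ren[of n] y j by (intro isometric_follows[OF iso]) (auto simp: renorm_def)
  also have "\<dots> = c n * \<bar>(G ^^ j) y1 - y\<bar>"
    using pos[of n] by (simp add: abs_mult flip: right_diff_distrib)
  also have "\<dots> \<le> c n * K"
    using pos[of n] bdd[OF y(1)] bdd[OF j] by (intro mult_left_mono) auto
  finally have "dist u ((F ^^ k) (c n * (G ^^ j) y1)) < e"
    using n y(3) unfolding mem_ball dist_real_def by linarith
  then have "(F ^^ (k + (k2 + k1))) x \<in> U"
    using e(2) k2 y1(1) by (auto simp: funpow_add)
  then show ?thesis
    by blast
qed

subsection \<open>Birkhoff sums\<close>

definition letter :: "(nat \<Rightarrow> real set) \<Rightarrow> real \<Rightarrow> nat" where
  "letter P x = (SOME a. x \<in> P a)"

definition birkhoff :: "(real \<Rightarrow> real) \<Rightarrow> (nat \<Rightarrow> real set) \<Rightarrow> (nat \<Rightarrow> real) \<Rightarrow> real \<Rightarrow> nat \<Rightarrow> real" where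
  "birkhoff F P g x n = (\<Sum>k<n. g (letter P ((F ^^ k) x)))"

abbreviation disj_pieces :: "(nat \<Rightarrow> real set) \<Rightarrow> bool" where
  "disj_pieces P \<equiv> \<forall>a b. a \<noteq> b \<longrightarrow> P a \<inter> P b = {}"

lemma letter_eq: "disj_pieces P \<Longrightarrow> x \<in> P a \<Longrightarrow> letter P x = a"
  unfolding letter_def by (rule some_equality) blast+

lemma birkhoff_add: "birkhoff F P g x (m + n) = birkhoff F P g x m + birkhoff F P g ((F ^^ m) x) n"
proof -
  have "birkhoff F P g x (m + n) = birkhoff F P g x m + (\<Sum>k=m..<m+n. g (letter P ((F ^^ k) x)))"
    by (simp add: birkhoff_def lessThan_atLeast0 sum.atLeastLessThan_concat)
  also have "(\<Sum>k=m..<m+n. g (letter P ((F ^^ k) x))) = (\<Sum>k=0..<n. g (letter P ((F ^^ (k + m)) x)))"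
    using sum.shift_bounds_nat_ivl[of "\<lambda>k. g (letter P ((F ^^ k) x))" 0 m n] by (simp add: add.commute)
  also have "\<dots> = birkhoff F P g ((F ^^ m) x) n"
    by (simp add: birkhoff_def lessThan_atLeast0 funpow_add)
  finally show ?thesis .
qed

lemma birkhoff_follows:
  assumes "disj_pieces P" "follows F P v x z"
  shows "birkhoff F P g x (length v) = sum_list (map g v)"
  using assms(2)
proof (induction v arbitrary: x)
  case (Cons a v)
  then have "birkhoff F P g x (1 + length v) = g a + sum_list (map g v)"
    by (subst birkhoff_add) (auto simp: birkhoff_def letter_eq[OF assms(1)])
  then show ?case
    by simp
qed (simp add: birkhoff_def)

lemma birkhoff_bound:
  assumes "disj_pieces P" "regular F P x" "\<And>a. P a \<noteq> {} \<Longrightarrow> \<bar>g a\<bar> \<le> B"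
  shows "\<bar>birkhoff F P g x n\<bar> \<le> B * real n"
proof -
  have "\<bar>g (letter P ((F ^^ k) x))\<bar> \<le> B" for k
  proof -
    obtain a where "(F ^^ k) x \<in> P a"
      using assms(2) by (auto simp: regular_def)
    then show ?thesis
      using assms(3)[of a] letter_eq[OF assms(1)] by auto
  qed
  then have "\<bar>birkhoff F P g x n\<bar> \<le> (\<Sum>k<n. B)"
    unfolding birkhoff_def by (intro order_trans[OF sum_abs] sum_mono)
  then show ?thesis
    by (simp add: mult.commute)
qed

lemma birkhoff_nonneg:
  assumes "disj_pieces P" "regular F P x" "\<And>a. P a \<noteq> {} \<Longrightarrow> 0 \<le> g a"
  shows "0 \<le> birkhoff F P g x n"
  unfolding birkhoff_def
proof (rule sum_nonneg)
  fix k
  obtain a where "(F ^^ k) x \<in> P a"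
    using assms(2) by (auto simp: regular_def)
  then show "0 \<le> g (letter P ((F ^^ k) x))"
    using assms(3)[of a] letter_eq[OF assms(1)] by auto
qed

text \<open>The transposed letter-count matrix of \<open>w\<close>, acting on observables that are
  constant on the pieces.\<close>

abbreviation push :: "(nat \<Rightarrow> nat list) \<Rightarrow> (nat \<Rightarrow> real) \<Rightarrow> nat \<Rightarrow> real" where
  "push w g b \<equiv> sum_list (map g (w b))"

lemma sum_list_concat_map: "sum_list (map g (concat (map w v))) = sum_list (map (push w g) v)"
  for g :: "nat \<Rightarrow> real"
  by (induction v) auto

text \<open>Bundles a bounded observable \<open>g\<close> with a nonnegative one \<open>t\<close>,
  because both have to be estimated at the same renormalized time.\<close>

abbreviation tame :: "(nat \<Rightarrow> real set) \<Rightarrow> (nat \<Rightarrow> real) \<Rightarrow> real \<Rightarrow> (nat \<Rightarrow> real) \<Rightarrow> bool" where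
  "tame P g B t \<equiv> \<forall>a. P a \<noteq> {} \<longrightarrow> \<bar>g a\<bar> \<le> B \<and> 0 \<le> t a"

lemma renorm_time:
  assumes ren: "renorm F P c w G Q" and y: "regular G Q y"
  shows "\<exists>v z b r. follows G Q v y z \<and> z \<in> Q b \<and> r < length (w b) \<and> length (concat (map w v)) + r = n"
proof (induction n)
  case 0
  obtain b where b: "y \<in> Q b"
    using y by (metis regular_def funpow_0)
  with ren have "w b \<noteq> []"
    by (auto simp: renorm_def)
  with b show ?case
    by (intro exI[of _ "[]"] exI[of _ y] exI[of _ b] exI[of _ 0]) auto
next
  case (Suc n)
  then obtain v z b r where *: "follows G Q v y z" "z \<in> Q b" "r < length (w b)"
      "length (concat (map w v)) + r = n"
    by blast
  show ?case
  proof (cases "Suc r < length (w b)")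
    case True
    with * show ?thesis
      by (intro exI[of _ v] exI[of _ z] exI[of _ b] exI[of _ "Suc r"]) auto
  next
    case False
    have z: "follows G Q (v @ [b]) y (G z)"
      using * by (intro follows_append[of _ _ _ _ z]) auto
    obtain b' where b': "G z \<in> Q b'"
      using regular_iterate[OF y, of "length (v @ [b])"] follows_end[OF z] by (metis regular_def funpow_0)
    with ren have "w b' \<noteq> []"
      by (auto simp: renorm_def)
    with z b' False * show ?thesis
      by (intro exI[of _ "v @ [b]"] exI[of _ "G z"] exI[of _ b'] exI[of _ 0]) auto
  qed
qed

text \<open>\<open>m\<close> counts the complete words in the first \<open>n\<close> steps after the
  orbit has entered the base; the initial segment and the incomplete last word cost at most
  \<open>D\<close> letters. The order of the quantifiers matters: \<open>y\<close> and
  \<open>D\<close> are independent of \<open>n\<close>, and \<open>m\<close> is independent of the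
  observables.\<close>

lemma birkhoff_renorm:
  assumes disj: "disj_pieces P" "disj_pieces Q"
    and ren: "renorm F P c w G Q" and ent: "enters F P c G Q"
    and M: "\<And>b. Q b \<noteq> {} \<Longrightarrow> length (w b) \<le> M" and x: "regular F P x"
  shows "\<exists>y D. regular G Q y \<and> (\<forall>n. \<exists>m\<le>n. \<forall>g t B.
     tame P g B t \<longrightarrow>
     \<bar>birkhoff F P g x n\<bar> \<le> B * D + \<bar>birkhoff G Q (push w g) y m\<bar> \<and>
     birkhoff G Q (push w t) y m \<le> birkhoff F P t x n)"
proof -
  obtain k0 y where y: "(F ^^ k0) x = c * y" "regular G Q y"
    using ent x by (auto simp: enters_def)
  show ?thesis
  proof (rule exI[of _ y], rule exI[of _ "real (k0 + M)"], intro conjI allI)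
    show "regular G Q y" by fact
    fix n
    show "\<exists>m\<le>n. \<forall>g t B. tame P g B t \<longrightarrow>
       \<bar>birkhoff F P g x n\<bar> \<le> B * real (k0 + M) + \<bar>birkhoff G Q (push w g) y m\<bar> \<and>
       birkhoff G Q (push w t) y m \<le> birkhoff F P t x n"
    proof (cases "n < k0")
      case True
      have "\<bar>birkhoff F P g x n\<bar> \<le> B * real (k0 + M)" if "tame P g B t" for g t B
      proof -
        obtain a where "x \<in> P a"
          using x by (metis regular_def funpow_0)
        then have "0 \<le> B"
          using that by (metis abs_ge_zero empty_iff order_trans)
        have "\<bar>birkhoff F P g x n\<bar> \<le> B * real n"
          using that by (intro birkhoff_bound[OF disj(1) x]) auto
        also have "\<dots> \<le> B * real (k0 + M)"
          using True \<open>0 \<le> B\<close> by (intro mult_left_mono) auto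
        finally show ?thesis .
      qed
      moreover have "0 \<le> birkhoff F P t x n" if "tame P g B t" for g t B
        using that by (intro birkhoff_nonneg[OF disj(1) x]) auto
      ultimately show ?thesis
        by (intro exI[of _ 0]) (auto simp: birkhoff_def)
    next
      case False
      obtain v z b r where v: "follows G Q v y z" "z \<in> Q b" "r < length (w b)"
          "length (concat (map w v)) + r = n - k0"
        using renorm_time[OF ren y(2), of "n - k0"] by blast
      define N where "N = length (concat (map w v))"
      have fv: "follows F P (concat (map w v)) (c * y) (c * z)"
        using renorm_word[OF ren v(1)] .
      have n: "n = k0 + (N + r)"
        using v(4) False by (simp add: N_def)
      have split: "birkhoff F P g x n =
          birkhoff F P g x k0 + (birkhoff G Q (push w g) y (length v) + birkhoff F P g (c * z) r)" for g
        using follows_end[OF fv] birkhoff_follows[OF disj(1) fv] birkhoff_follows[OF disj(2) v(1)]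
        by (simp add: n birkhoff_add y(1) N_def sum_list_concat_map)
      have rz: "regular F P (c * z)"
        using regular_iterate[OF x, of "N + k0"] follows_end[OF fv] y(1) by (simp add: funpow_add N_def)
      have "length v \<le> N"
        unfolding N_def using follows_set[OF v(1)] ren by (intro length_concat_ge) (auto simp: renorm_def)
      moreover have "\<bar>birkhoff F P g x n\<bar> \<le> B * real (k0 + M) + \<bar>birkhoff G Q (push w g) y (length v)\<bar>"
        if "tame P g B t" for g t B
      proof -
        obtain a where "x \<in> P a"
          using x by (metis regular_def funpow_0)
        then have "0 \<le> B"
          using that by (metis abs_ge_zero empty_iff order_trans)
        have "\<bar>birkhoff F P g x k0\<bar> \<le> B * real k0"
          using that by (intro birkhoff_bound[OF disj(1) x]) auto
        moreover have "\<bar>birkhoff F P g (c * z) r\<bar> \<le> B * real r"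
          using that by (intro birkhoff_bound[OF disj(1) rz]) auto
        moreover have "r \<le> M"
          using v(2,3) M[of b] by fastforce
        then have "B * real r \<le> B * real M"
          using \<open>0 \<le> B\<close> by (intro mult_left_mono) auto
        ultimately show ?thesis
          by (simp add: split distrib_left)
      qed
      moreover have "birkhoff G Q (push w t) y (length v) \<le> birkhoff F P t x n"
        if "tame P g B t" for g t B
        using that birkhoff_nonneg[OF disj(1) x, of t k0] birkhoff_nonneg[OF disj(1) rz, of t r]
        by (simp add: split)
      ultimately show ?thesis
        using n by (intro exI[of _ "length v"]) auto
    qed
  qed
qed

text \<open>The cone condition \<open>good\<close> makes the renormalization operator on observables contract by
  \<open>\<theta>\<close> relative to its growth \<open>H\<close> on the positive observable \<open>wt\<close>.\<close>

lemma birkhoff_contraction: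
  assumes disj: "disj_pieces P" and ren: "renorm F P c w F P" and ent: "enters F P c F P"
    and M: "\<And>b. P b \<noteq> {} \<Longrightarrow> length (w b) \<le> M"
    and wt: "\<And>a. P a \<noteq> {} \<Longrightarrow> 0 \<le> wt a \<and> H * wt a \<le> push w wt a" "\<And>a. P a \<noteq> {} \<Longrightarrow> wt a \<le> L"
    and good: "\<And>g K. good g K \<Longrightarrow> good (push w g) (\<theta> * H * K)"
      "\<And>g K a. good g K \<Longrightarrow> P a \<noteq> {} \<Longrightarrow> \<bar>g a\<bar> \<le> K * wt a" "\<And>g K. good g K \<Longrightarrow> 0 \<le> K"
    and pos: "0 \<le> \<theta>" "0 < H" and x: "regular F P x"
  shows "\<exists>C. \<forall>n g K. good g K \<longrightarrow> \<bar>birkhoff F P g x n\<bar> \<le> K * (C + \<theta> ^ k * birkhoff F P wt x n)"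
  using x
proof (induction k arbitrary: x)
  case 0
  have "\<bar>birkhoff F P g x n\<bar> \<le> K * birkhoff F P wt x n" if "good g K" for g K n
  proof -
    have "\<bar>g (letter P ((F ^^ i) x))\<bar> \<le> K * wt (letter P ((F ^^ i) x))" for i
    proof -
      obtain a where "(F ^^ i) x \<in> P a"
        using 0 by (auto simp: regular_def)
      then show ?thesis
        using good(2)[OF that, of a] letter_eq[OF disj] by auto
    qed
    then show ?thesis
      unfolding birkhoff_def sum_distrib_left by (intro order_trans[OF sum_abs] sum_mono)
  qed
  then show ?case
    by (intro exI[of _ 0]) auto
next
  case (Suc k)
  obtain y D where y: "regular F P y" and D: "\<And>n. \<exists>m\<le>n. \<forall>g t B.
     tame P g B t \<longrightarrow>
     \<bar>birkhoff F P g x n\<bar> \<le> B * D + \<bar>birkhoff F P (push w g) y m\<bar> \<and>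
     birkhoff F P (push w t) y m \<le> birkhoff F P t x n"
    using birkhoff_renorm[OF disj disj ren ent M Suc.prems] by blast
  obtain C where C: "\<And>n g K. good g K \<Longrightarrow> \<bar>birkhoff F P g y n\<bar> \<le> K * (C + \<theta> ^ k * birkhoff F P wt y n)"
    using Suc.IH[OF y] by blast
  have "\<bar>birkhoff F P g x n\<bar> \<le> K * (L * D + \<theta> * H * C + \<theta> ^ Suc k * birkhoff F P wt x n)"
    if g: "good g K" for g K n
  proof -
    obtain m where m: "\<And>g t B. tame P g B t \<Longrightarrow>
        \<bar>birkhoff F P g x n\<bar> \<le> B * D + \<bar>birkhoff F P (push w g) y m\<bar> \<and>
        birkhoff F P (push w t) y m \<le> birkhoff F P t x n"
      using D[of n] by blast
    have K: "0 \<le> K" using good(3)[OF g] .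
    have "\<bar>g a\<bar> \<le> K * L \<and> 0 \<le> wt a" if "P a \<noteq> {}" for a
      using good(2)[OF g that] wt(1)[OF that] mult_left_mono[OF wt(2)[OF that] K] by linarith
    then have *: "\<bar>birkhoff F P g x n\<bar> \<le> K * L * D + \<bar>birkhoff F P (push w g) y m\<bar>"
        "birkhoff F P (push w wt) y m \<le> birkhoff F P wt x n"
      using m[of g "K * L" wt] by blast+
    \<comment> \<open>The factor \<open>H\<close> in the bound for \<open>push w g\<close> is paid
      for here: \<open>H\<close> times the sum of \<open>wt\<close> along \<open>y\<close> is at
      most the sum of \<open>wt\<close> along \<open>x\<close>.\<close>
    have "H * birkhoff F P wt y m \<le> birkhoff F P (push w wt) y m"
      unfolding birkhoff_def sum_distrib_left
    proof (rule sum_mono)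
      fix i
      obtain a where "(F ^^ i) y \<in> P a"
        using y by (auto simp: regular_def)
      then show "H * wt (letter P ((F ^^ i) y)) \<le> push w wt (letter P ((F ^^ i) y))"
        using wt(1)[of a] letter_eq[OF disj] by auto
    qed
    with *(2) have "\<theta> * \<theta> ^ k * (H * birkhoff F P wt y m) \<le> \<theta> * \<theta> ^ k * birkhoff F P wt x n"
      using pos(1) by (intro mult_left_mono) auto
    then have "K * (\<theta> * \<theta> ^ k * (H * birkhoff F P wt y m)) \<le> K * (\<theta> * \<theta> ^ k * birkhoff F P wt x n)"
      using K by (rule mult_left_mono)
    with *(1) C[OF good(1)[OF g], of m] show ?thesis
      by (simp add: algebra_simps)
  qed
  then show ?case
    by blast
qed

section \<open>Interval exchanges with flips\<close>

text \<open>Closed counterpart of \<open>follows\<close>: breakpoints are allowed and each letter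
  prescribes its own branch, so the condition consists of linear inequalities and makes sense at the
  ends of intervals.\<close>

primrec chain :: "(nat \<Rightarrow> real) \<Rightarrow> (nat \<Rightarrow> real \<Rightarrow> real) \<Rightarrow> nat list \<Rightarrow> real \<Rightarrow> real \<Rightarrow> bool" where
  "chain B f [] x z \<longleftrightarrow> x = z"
| "chain B f (a # w) x z \<longleftrightarrow> B (a - 1) \<le> x \<and> x \<le> B a \<and> chain B f w (f a x) z"

lemma chain_append: "chain B f (u @ v) x z \<longleftrightarrow> chain B f u x (fold f u x) \<and> chain B f v (fold f u x) z"
  by (induction u arbitrary: x) auto

lemma chain_fold: "chain B f u x z \<Longrightarrow> z = fold f u x"
  by (induction u arbitrary: x) auto

primrec tiles :: "(real \<times> real) list \<Rightarrow> real \<Rightarrow> real \<Rightarrow> bool" where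
  "tiles [] a b \<longleftrightarrow> b \<le> a"
| "tiles (p # ps) a b \<longleftrightarrow> fst p \<le> a \<and> tiles ps (snd p) b"

lemma tiles_cover: "tiles ps a b \<Longrightarrow> a \<le> x \<Longrightarrow> x < b \<Longrightarrow> \<exists>p\<in>set ps. fst p \<le> x \<and> x \<le> snd p"
proof (induction ps arbitrary: a)
  case (Cons p ps)
  then show ?case
    by (cases "x \<le> snd p") force+
qed auto

text \<open>Only the open pieces constrain \<open>F\<close>; its values at the breakpoints are left
  to each instance. As \<open>B\<close> is constant from index 4 on and \<open>0 - 1 = 0\<close> for
  naturals, \<open>piece a\<close> is empty unless \<open>a\<close> is 1, 2, 3 or 4.\<close>

locale iet =
  fixes B sg tr :: "nat \<Rightarrow> real" and F :: "real \<Rightarrow> real"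
  assumes strict_B: "\<And>a. a \<in> {1..4} \<Longrightarrow> B (a - 1) < B a" and B_last: "\<And>j. 4 \<le> j \<Longrightarrow> B j = B 4"
    and sg: "\<And>a. sg a = 1 \<or> sg a = -1"
    and F_eq: "\<And>a x. B (a - 1) < x \<Longrightarrow> x < B a \<Longrightarrow> F x = sg a * x + tr a"
    and inv: "\<And>a x. a \<in> {1..4} \<Longrightarrow> B (a - 1) \<le> x \<Longrightarrow> x \<le> B a \<Longrightarrow>
      B 0 \<le> sg a * x + tr a \<and> sg a * x + tr a \<le> B 4"
begin

lemma mono_B: "mono B"
  unfolding mono_iff_le_Suc
proof
  fix j
  show "B j \<le> B (Suc j)"
    using strict_B[of "Suc j"] B_last[of j] B_last[of "Suc j"] by (cases "j < 4") auto
qed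

definition piece :: "nat \<Rightarrow> real set" where
  "piece a = {B (a - 1) <..< B a}"

definition br :: "nat \<Rightarrow> real \<Rightarrow> real" where
  "br a x = sg a * x + tr a"

lemma F_br: "x \<in> piece a \<Longrightarrow> F x = br a x"
  by (simp add: piece_def br_def F_eq)

lemma closed_piece_unique: "x \<in> piece a \<Longrightarrow> B (b - 1) \<le> x \<Longrightarrow> x \<le> B b \<Longrightarrow> b = a"
proof (rule ccontr)
  assume x: "x \<in> piece a" "B (b - 1) \<le> x" "x \<le> B b" and "b \<noteq> a"
  then consider "b \<le> a - 1" | "a \<le> b - 1"
    by linarith
  then show False
    using x monoD[OF mono_B, of b "a - 1"] monoD[OF mono_B, of a "b - 1"]
    by cases (auto simp: piece_def)
qed

lemma disj: "disj_pieces piece"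
  using closed_piece_unique by (fastforce simp: piece_def)

lemma open_piece: "open (piece a)"
  by (simp add: piece_def)

lemma piece_range: "x \<in> piece a \<Longrightarrow> a \<in> {1..4}"
proof -
  assume x: "x \<in> piece a"
  have "a \<noteq> 0"
    using x by (intro notI) (auto simp: piece_def)
  moreover have "a \<le> 4"
  proof (rule ccontr)
    assume "\<not> a \<le> 4"
    then have "B a = B 4" "B (a - 1) = B 4"
      by (intro B_last; simp)+
    with x show False
      by (simp add: piece_def)
  qed
  ultimately show ?thesis
    by simp
qed

lemma piece_subset: "piece a \<subseteq> {B 0 <..< B 4}"
proof
  fix x assume x: "x \<in> piece a"
  then show "x \<in> {B 0 <..< B 4}"
    using piece_range[OF x] monoD[OF mono_B, of 0 "a - 1"] monoD[OF mono_B, of a 4]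
    by (auto simp: piece_def)
qed

lemma in_piece:
  assumes "B 0 \<le> x" "x \<le> B 4" "x \<notin> B ` {0..4}"
  shows "\<exists>a. x \<in> piece a"
proof -
  have "x \<noteq> B 0" "x \<noteq> B 1" "x \<noteq> B 2" "x \<noteq> B 3" "x \<noteq> B 4"
    using assms(3) by auto
  then have "x \<in> piece 1 \<or> x \<in> piece 2 \<or> x \<in> piece 3 \<or> x \<in> piece 4"
    using assms(1,2) by (auto simp: piece_def)
  then show ?thesis
    by blast
qed

lemma isometric: "isometric F piece"
  unfolding isometric_def
proof (intro allI ballI)
  fix a x y assume *: "x \<in> piece a" "y \<in> piece a"
  show "\<bar>F x - F y\<bar> = \<bar>x - y\<bar>"
    using F_br[OF *(1)] F_br[OF *(2)] sg[of a] by (auto simp: br_def)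
qed

lemma regular_in: "regular F piece x \<Longrightarrow> \<exists>a. x \<in> piece a"
  by (metis regular_def funpow_0)

lemma regular_range: "regular F piece x \<Longrightarrow> B 0 < x \<and> x < B 4"
  using regular_in piece_subset by fastforce

text \<open>A regular point lies in an open piece, and the weak inequalities of the chain are then
  compatible with only one letter.\<close>

lemma chain_follows: "regular F piece x \<Longrightarrow> chain B br w x z \<Longrightarrow> follows F piece w x z"
proof (induction w arbitrary: x)
  case (Cons a w)
  then have a: "x \<in> piece a"
    using closed_piece_unique regular_in by fastforce
  with Cons regular_step[OF Cons.prems(1)] show ?case
    by (auto simp: F_br)
qed auto

text \<open>The two endpoints satisfy the weak inequalities, so points strictly between them satisfy
  the strict ones; a branch of slope 1 or -1 carries the interval to an interval again, and the
  argument repeats.\<close>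

lemma chain_interior:
  assumes "\<And>x. \<alpha> \<le> x \<Longrightarrow> x \<le> \<beta> \<Longrightarrow> chain B br w x (fold br w x)" "\<alpha> < x" "x < \<beta>"
  shows "follows F piece w x (fold br w x)"
  using assms
proof (induction w arbitrary: x \<alpha> \<beta>)
  case (Cons a w)
  have x: "x \<in> piece a"
    using Cons.prems(1)[of \<alpha>] Cons.prems(1)[of \<beta>] Cons.prems(2,3) by (auto simp: piece_def)
  have "follows F piece w (br a x) (fold br w (br a x))"
  proof (cases "sg a = 1")
    case True
    have "chain B br w y (fold br w y)" if "\<alpha> + tr a \<le> y" "y \<le> \<beta> + tr a" for y
      using Cons.prems(1)[of "y - tr a"] that True by (auto simp: br_def[of a])
    from Cons.IH[of "\<alpha> + tr a" "\<beta> + tr a" "br a x", OF this] show ?thesis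
      using Cons.prems(2,3) True by (simp add: br_def[of a])
  next
    case False
    then have s: "sg a = -1" using sg by blast
    have "chain B br w y (fold br w y)" if "tr a - \<beta> \<le> y" "y \<le> tr a - \<alpha>" for y
      using Cons.prems(1)[of "tr a - y"] that s by (auto simp: br_def[of a])
    from Cons.IH[of "tr a - \<beta>" "tr a - \<alpha>" "br a x", OF this] show ?thesis
      using Cons.prems(2,3) s by (simp add: br_def[of a])
  qed
  with x show ?case
    by (simp add: F_br)
qed auto

lemma follows_br: "follows F piece (a # w) x z \<longleftrightarrow> x \<in> piece a \<and> follows F piece w (br a x) z"
  by (auto simp: F_br)

lemma follows_fold: "follows F piece w x z \<Longrightarrow> k \<le> length w \<Longrightarrow> (F ^^ k) x = fold br (take k w) x"
proof (induction w arbitrary: x k)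
  case (Cons a w)
  then show ?case
    by (cases k) (auto simp: funpow_swap1 F_br)
qed auto

lemma fold_affine: "\<exists>s t. (s = 1 \<or> s = -1) \<and> (\<forall>x. fold br u x = s * x + t)"
proof (induction u)
  case Nil
  show ?case
    by (intro exI[of _ 1] exI[of _ 0]) auto
next
  case (Cons a u)
  then obtain s t where st: "s = 1 \<or> s = -1" "\<forall>x. fold br u x = s * x + t"
    by blast
  show ?case
    using st sg[of a]
    by (intro exI[of _ "s * sg a"] exI[of _ "s * tr a + t"]) (auto simp: br_def[of a] algebra_simps)
qed

end

text \<open>All that has to be verified about a concrete renormalization: words on the closed base
  intervals, a tiling by the floors, and the fate of those endpoints of the base that happen to be
  regular. The flag in \<open>floors\<close> says that the floor is reversed, so that its left end
  comes from the right end of the base interval.\<close>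

locale tower = F: iet B sg tr F + G: iet B' sg' tr' G
  for B sg tr F B' sg' tr' G +
  fixes c :: real and w :: "nat \<Rightarrow> nat list" and floors :: "(nat \<times> nat \<times> bool) list"
  assumes c: "0 < c" and w_ne: "\<And>b. b \<in> {1..4} \<Longrightarrow> w b \<noteq> []"
    and climb: "\<And>b t. b \<in> {1..4} \<Longrightarrow> B' (b - 1) \<le> t \<Longrightarrow> t \<le> B' b \<Longrightarrow>
      chain B F.br (w b) (c * t) (c * G.br b t)"
    and floors_range: "\<And>b k r. (b, k, r) \<in> set floors \<Longrightarrow> b \<in> {1..4} \<and> k < length (w b)"
    and floors_tile: "tiles (map (\<lambda>(b, k, r).
        let l = fold F.br (take k (w b)) (c * B' (b - 1)); h = fold F.br (take k (w b)) (c * B' b)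
        in if r then (h, l) else (l, h)) floors) (B 0) (B 4)"
    and boundary: "\<And>j. j \<le> 4 \<Longrightarrow> regular F F.piece (c * B' j) \<Longrightarrow>
      \<exists>k y. (F ^^ k) (c * B' j) = c * y \<and> regular G G.piece y"
begin

lemma renorm: "renorm F F.piece c w G G.piece"
  unfolding renorm_def
proof (intro allI ballI conjI)
  fix b y assume y: "y \<in> G.piece b"
  have b: "b \<in> {1..4}"
    using G.piece_range[OF y] .
  show "w b \<noteq> []"
    using w_ne[OF b] .
  have ch: "chain B F.br (w b) (c * t) (c * G.br b t)" if "B' (b - 1) \<le> t" "t \<le> B' b" for t
    using climb[OF b that] .
  have "follows F F.piece (w b) (c * y) (fold F.br (w b) (c * y))"
  proof (rule F.chain_interior[of "c * B' (b - 1)" "c * B' b"])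
    show "chain B F.br (w b) x (fold F.br (w b) x)" if "c * B' (b - 1) \<le> x" "x \<le> c * B' b" for x
      using ch[of "x / c"] chain_fold[OF ch[of "x / c"]] that c by (simp add: field_simps)
    show "c * B' (b - 1) < c * y" "c * y < c * B' b"
      using y c by (simp_all add: G.piece_def)
  qed
  moreover have "c * G.br b y = fold F.br (w b) (c * y)"
    using y by (intro chain_fold[OF ch]) (auto simp: G.piece_def)
  ultimately show "follows F F.piece (w b) (c * y) (c * G y)"
    using G.F_br[OF y] by simp
qed

lemma floor_cover:
  assumes x: "B 0 < x" "x < B 4"
  shows "\<exists>b\<in>{1..4}. \<exists>k<length (w b). \<exists>t. B' (b - 1) \<le> t \<and> t \<le> B' b \<and> fold F.br (take k (w b)) (c * t) = x"
proof -
  obtain b k r where bkr: "(b, k, r) \<in> set floors" and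
    lh: "let l = fold F.br (take k (w b)) (c * B' (b - 1)); h = fold F.br (take k (w b)) (c * B' b)
        in if r then h \<le> x \<and> x \<le> l else l \<le> x \<and> x \<le> h"
    using tiles_cover[OF floors_tile, of x] x by (fastforce simp: Let_def split: if_splits)
  obtain s d where s: "s = 1 \<or> s = -1" and sd: "\<And>x. fold F.br (take k (w b)) x = s * x + d"
    using F.fold_affine[of "take k (w b)"] by blast
  have le: "c * B' (b - 1) \<le> c * B' b"
    using c monoD[OF G.mono_B, of "b - 1" b] by simp
  \<comment> \<open>Since \<open>s\<close> is 1 or -1, the floor map \<open>s * x + d\<close> is
    inverted by \<open>s * (x - d)\<close>.\<close>
  have "c * B' (b - 1) \<le> s * (x - d) \<and> s * (x - d) \<le> c * B' b"
    using s lh le by (auto simp: sd Let_def split: if_splits)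
  then have "B' (b - 1) \<le> s * (x - d) / c \<and> s * (x - d) / c \<le> B' b"
    using c by (simp add: field_simps)
  moreover have "fold F.br (take k (w b)) (c * (s * (x - d) / c)) = x"
    using c s by (auto simp: sd)
  ultimately show ?thesis
    using floors_range[OF bkr] by blast
qed

text \<open>The tiling only yields a point over a closed base interval; if it sits over an endpoint,
  it is moved into the open piece by less than \<open>e / c\<close>.\<close>

lemma covering: "covering F {B 0 <..< B 4} c w G.piece"
  unfolding covering_def
proof (intro allI impI)
  fix U assume U: "open U \<and> U \<noteq> {} \<and> U \<subseteq> {B 0 <..< B 4}"
  then obtain x where x: "x \<in> U" "B 0 < x" "x < B 4"
    by fastforce
  obtain b k t where b: "b \<in> {1..4}" "k < length (w b)" and t: "B' (b - 1) \<le> t" "t \<le> B' b"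
      and tx: "fold F.br (take k (w b)) (c * t) = x"
    using floor_cover[OF x(2,3)] by blast
  obtain e where e: "0 < e" "ball x e \<subseteq> U"
    using U x(1) open_contains_ball by blast
  define d where "d = e / c"
  have "0 < d"
    using c e by (simp add: d_def)
  then have "max (B' (b - 1)) (t - d) < min (B' b) (t + d)"
    using G.strict_B[OF b(1)] t by simp
  then obtain y where "max (B' (b - 1)) (t - d) < y" "y < min (B' b) (t + d)"
    using dense by blast
  then have y: "B' (b - 1) < y" "y < B' b" "\<bar>y - t\<bar> < e / c"
    unfolding d_def by auto
  have "follows F F.piece (w b) (c * y) (c * G y)"
    using renorm y by (auto simp: renorm_def G.piece_def)
  then have "(F ^^ k) (c * y) = fold F.br (take k (w b)) (c * y)"
    using b(2) by (intro F.follows_fold) auto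
  moreover have "\<bar>fold F.br (take k (w b)) (c * y) - x\<bar> = \<bar>c * y - c * t\<bar>"
    using F.fold_affine[of "take k (w b)"] tx by fastforce
  moreover have "\<bar>c * y - c * t\<bar> < e"
    using y(3) c by (simp add: abs_mult pos_less_divide_eq mult.commute flip: right_diff_distrib)
  ultimately have "(F ^^ k) (c * y) \<in> U"
    using e(2) by (auto simp: dist_real_def)
  then show "\<exists>b. \<exists>y\<in>G.piece b. \<exists>k<length (w b). (F ^^ k) (c * y) \<in> U"
    using y b(2) by (intro exI[of _ b] bexI[of _ y] exI[of _ k]) (auto simp: G.piece_def)
qed

text \<open>A point of the closed base that is not \<open>G\<close>-regular has a
  \<open>G\<close>-orbit that meets an endpoint \<open>B' j\<close>. Up to that moment the orbit
  runs through open pieces and is realized by \<open>F\<close>; from there on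
  \<open>boundary\<close> applies.\<close>

lemma enters_closed:
  assumes x: "regular F F.piece (c * y)" and y: "B' 0 \<le> y" "y \<le> B' 4"
  shows "\<exists>k z. (F ^^ k) (c * y) = c * z \<and> regular G G.piece z"
proof (cases "regular G G.piece y")
  case True
  then show ?thesis
    by (intro exI[of _ 0] exI[of _ y]) auto
next
  case False
  define n where "n = (LEAST n. \<forall>a. (G ^^ n) y \<notin> G.piece a)"
  have n: "(G ^^ n) y \<notin> G.piece a" for a
    using LeastI_ex[of "\<lambda>n. \<forall>a. (G ^^ n) y \<notin> G.piece a"] False by (auto simp: regular_def n_def)
  have n': "\<exists>a. (G ^^ k) y \<in> G.piece a" if "k < n" for k
    using not_less_Least[of k "\<lambda>n. \<forall>a. (G ^^ n) y \<notin> G.piece a"] that by (auto simp: n_def)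
  have "B' 0 \<le> (G ^^ n) y \<and> (G ^^ n) y \<le> B' 4"
  proof (cases n)
    case (Suc m)
    then obtain a where a: "(G ^^ m) y \<in> G.piece a"
      using n' by blast
    then show ?thesis
      using Suc G.inv[of a "(G ^^ m) y"] G.piece_range[OF a] G.F_br[OF a]
      by (auto simp: G.piece_def G.br_def)
  qed (use y in auto)
  then obtain j where j: "j \<le> 4" "(G ^^ n) y = B' j"
    using G.in_piece n by fastforce
  obtain v where v: "follows G G.piece v y (B' j)"
    using regular_prefix[of n G y G.piece] n' j(2) by auto
  define l where "l = length (concat (map w v))"
  have l: "(F ^^ l) (c * y) = c * B' j"
    using follows_end[OF renorm_word[OF renorm v]] by (simp add: l_def)
  then obtain k z where "(F ^^ k) (c * B' j) = c * z" "regular G G.piece z"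
    using boundary[OF j(1)] regular_iterate[OF x, of l] by auto
  with l show ?thesis
    by (intro exI[of _ "k + l"] exI[of _ z]) (simp add: funpow_add)
qed

lemma enters: "enters F F.piece c G G.piece"
  unfolding enters_def
proof (intro allI impI)
  fix x assume x: "regular F F.piece x"
  then have "B 0 < x" "x < B 4"
    using F.regular_range by blast+
  then obtain b k t where b: "b \<in> {1..4}" "k < length (w b)" and t: "B' (b - 1) \<le> t" "t \<le> B' b"
      and tx: "fold F.br (take k (w b)) (c * t) = x"
    using floor_cover by blast
  define v where "v = drop k (w b)"
  have "chain B F.br (take k (w b) @ v) (c * t) (c * G.br b t)"
    unfolding v_def append_take_drop_id using climb[OF b(1) t] .
  then have "chain B F.br v x (c * G.br b t)"
    unfolding chain_append tx by simp
  from follows_end[OF F.chain_follows[OF x this]]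
  have k: "(F ^^ length v) x = c * G.br b t" .
  have "\<exists>k z. (F ^^ k) (c * G.br b t) = c * z \<and> regular G G.piece z"
    using regular_iterate[OF x, of "length v"] k G.inv[OF b(1) t]
    by (intro enters_closed) (auto simp: G.br_def)
  then obtain j z where "(F ^^ j) (c * G.br b t) = c * z" "regular G G.piece z"
    by blast
  with k show "\<exists>k y. (F ^^ k) x = c * y \<and> regular G G.piece y"
    by (intro exI[of _ "j + length v"] exI[of _ z]) (simp add: funpow_add)
qed

end

section \<open>The Perron-Frobenius data of \<open>P\<close>\<close>

text \<open>Collatz-Wielandt comparison: for a complex eigenvector \<open>w\<close> the largest
  ratio of |w_i| to v_i is attained at some k, and row k of the eigenvalue equation bounds the
  modulus of \<mu> by \<open>r\<close>.\<close>

lemma perron_eigenvalueI: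
  fixes A :: "real^'n^'n" and v :: "real^'n"
  assumes A: "\<And>i j. 0 \<le> A $ i $ j" and v: "\<And>i. 0 < v $ i" and eig: "A *v v = r *\<^sub>R v"
  shows "perron_eigenvalue A = r"
proof -
  have row: "(\<Sum>j\<in>UNIV. A $ i $ j * v $ j) = r * v $ i" for i
    using arg_cong[OF eig, of "\<lambda>x. x $ i"] by (simp add: matrix_vector_mult_def)
  have "complex_eigenvalue A (complex_of_real r)"
    unfolding complex_eigenvalue_def
  proof (intro exI[of _ "\<chi> i. complex_of_real (v $ i)"] conjI)
    show "(\<chi> i. complex_of_real (v $ i)) \<noteq> 0"
      using v by (auto simp: vec_eq_iff less_le)
    have "(\<Sum>j\<in>UNIV. complex_of_real (A $ i $ j) * complex_of_real (v $ j)) = complex_of_real r * complex_of_real (v $ i)" for i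
    proof -
      have "complex_of_real (\<Sum>j\<in>UNIV. A $ i $ j * v $ j) = complex_of_real (r * v $ i)"
        using row by simp
      then show ?thesis
        by simp
    qed
    then show "(\<chi> i j. complex_of_real (A $ i $ j)) *v (\<chi> i. complex_of_real (v $ i)) =
        complex_of_real r *s (\<chi> i. complex_of_real (v $ i))"
      by (simp add: vec_eq_iff matrix_vector_mult_def)
  qed
  moreover have "cmod \<mu> \<le> r" if \<mu>: "complex_eigenvalue A \<mu>" for \<mu>
  proof -
    obtain w :: "complex^'n" where w: "w \<noteq> 0" "(\<chi> i j. complex_of_real (A $ i $ j)) *v w = \<mu> *s w"
      using \<mu> unfolding complex_eigenvalue_def by blast
    define c where "c = Max (range (\<lambda>i. cmod (w $ i) / v $ i))"
    have "cmod (w $ i) / v $ i \<le> c" for i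
      unfolding c_def by (rule Max_ge) auto
    then have c: "cmod (w $ i) \<le> c * v $ i" for i
      by (simp add: pos_divide_le_eq v)
    have "c \<in> range (\<lambda>i. cmod (w $ i) / v $ i)"
      unfolding c_def by (rule Max_in) auto
    then obtain k where k: "cmod (w $ k) = c * v $ k"
      using less_imp_neq[OF v, symmetric] by (auto simp: nonzero_eq_divide_eq)
    obtain i where "w $ i \<noteq> 0"
      using w(1) by (auto simp: vec_eq_iff)
    then have "0 < c * v $ i"
      using c[of i] zero_less_norm_iff[of "w $ i"] by linarith
    then have "0 < c"
      using v[of i] by (simp add: zero_less_mult_iff)
    have "\<mu> * w $ k = (\<Sum>j\<in>UNIV. complex_of_real (A $ k $ j) * w $ j)"
      using arg_cong[OF w(2), of "\<lambda>x. x $ k"] by (simp add: matrix_vector_mult_def)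
    from arg_cong[OF this, of cmod]
    have "cmod \<mu> * (c * v $ k) = cmod (\<Sum>j\<in>UNIV. complex_of_real (A $ k $ j) * w $ j)"
      by (simp add: norm_mult k)
    also have "\<dots> \<le> (\<Sum>j\<in>UNIV. A $ k $ j * (c * v $ j))"
      using A c by (intro order_trans[OF norm_sum] sum_mono) (auto simp: norm_mult intro: mult_left_mono)
    also have "\<dots> = c * (\<Sum>j\<in>UNIV. A $ k $ j * v $ j)"
      by (simp add: sum_distrib_left mult_ac)
    also have "\<dots> = c * (r * v $ k)"
      using row by simp
    finally show ?thesis
      using \<open>0 < c\<close> v[of k] by simp
  qed
  ultimately have *: "complex_eigenvalue A (complex_of_real r)" "\<And>\<mu>. complex_eigenvalue A \<mu> \<Longrightarrow> cmod \<mu> \<le> r"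
    by blast+
  then show ?thesis
    unfolding perron_eigenvalue_def
  proof (intro the_equality conjI allI impI)
    fix r' assume r': "complex_eigenvalue A (complex_of_real r') \<and> (\<forall>\<mu>. complex_eigenvalue A \<mu> \<longrightarrow> cmod \<mu> \<le> r')"
    have "cmod (complex_of_real r') \<le> r" "cmod (complex_of_real r) \<le> r'"
      using * r' by blast+
    then show "r' = r"
      unfolding norm_of_real by linarith
  qed (use * in blast)+
qed

section \<open>The concrete matrix: eigenvalue, eigenvector and decimal bounds\<close>

lemma vector_4:
  "(vector [x,y,z,w] :: 'a::zero^4) $ 1 = x" "(vector [x,y,z,w] :: 'a^4) $ 2 = y"
  "(vector [x,y,z,w] :: 'a^4) $ 3 = z" "(vector [x,y,z,w] :: 'a^4) $ 4 = w"
  unfolding vector_def by simp_all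

lemma P_mat_mult:
  "P_mat *v x = r *\<^sub>R x \<longleftrightarrow>
     3 * x $ 1 + 3 * x $ 2 + 5 * x $ 3 + 4 * x $ 4 = r * x $ 1 \<and>
     x $ 1 + 2 * x $ 2 + 3 * x $ 3 + 3 * x $ 4 = r * x $ 2 \<and>
     x $ 1 + x $ 2 + 2 * x $ 3 + x $ 4 = r * x $ 3 \<and>
     2 * x $ 1 + 3 * x $ 2 + 5 * x $ 3 + 5 * x $ 4 = r * x $ 4"
  by (simp add: vec_eq_iff forall_4 matrix_vector_mult_def sum_4 P_mat_def vector_4)

text \<open>Eigenvector for a root \<open>r\<close> of the cubic that remains when the factor x - 1
  is split off from the characteristic polynomial of \<open>P_mat\<close>, scaled to third entry
  1.\<close>

definition P_vec :: "real \<Rightarrow> real^4" where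
  "P_vec r = vector [(r - 4 + 1 / r) / 2, 2 - 1 / r, 1, (r - 4 + 1 / r) / 2]"

lemma P_vec:
  assumes r: "10 < r" "r ^ 3 - 11 * r ^ 2 + 7 * r - 1 = 0"
  shows "P_mat *v P_vec r = r *\<^sub>R P_vec r" "0 < P_vec r $ i" "(\<Sum>i\<in>UNIV. P_vec r $ i) = r - 1"
proof -
  define q where "q = 1 / r"
  have q: "r * q = 1" "0 < q" "q < 1"
    using r by (simp_all add: q_def)
  have v: "P_vec r = vector [(r - 4 + q) / 2, 2 - q, 1, (r - 4 + q) / 2]"
    by (simp add: P_vec_def q_def)
  have "q * (r ^ 3 - 11 * r ^ 2 + 7 * r - 1) = (r * q) * (r * r - 11 * r + 7) - q"
    by (simp add: algebra_simps power2_eq_square power3_eq_cube)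
  then have "r * r = 11 * r - 7 + q"
    unfolding q(1) r(2) by simp
  with q show "P_mat *v P_vec r = r *\<^sub>R P_vec r"
    unfolding P_mat_mult v by (simp add: vector_4 algebra_simps add_divide_distrib diff_divide_distrib)
  show "0 < P_vec r $ i"
    unfolding v using exhaust_4[of i] r q by (auto simp: vector_4)
  show "(\<Sum>i\<in>UNIV. P_vec r $ i) = r - 1"
    by (simp add: v sum_4 vector_4 field_simps)
qed

text \<open>The intermediate value theorem supplies a root of the cubic in the stated interval;
  positivity of its eigenvector identifies the root with \<open>eta\<close>.\<close>

lemma eta_props: "10.33185 < eta" "eta < 10.33186" "eta ^ 3 - 11 * eta ^ 2 + 7 * eta - 1 = 0"
proof -
  define f where "f x = x ^ 3 - 11 * x ^ 2 + 7 * x - 1" for x :: real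
  have f: "f 10.33185 < 0" "0 < f 10.33186"
    by (simp_all add: f_def power2_eq_square power3_eq_cube)
  have "\<exists>r\<ge>10.33185. r \<le> 10.33186 \<and> f r = 0"
    by (rule IVT') (use f in \<open>auto simp: f_def intro!: continuous_intros\<close>)
  then obtain r where r: "10.33185 \<le> r" "r \<le> 10.33186" "f r = 0"
    by blast
  have "r \<noteq> 10.33185" "r \<noteq> 10.33186"
    using f r(3) by (metis less_irrefl)+
  with r have r': "10.33185 < r" "r < 10.33186"
    by linarith+
  have "0 \<le> P_mat $ i $ j" for i j
    using exhaust_4[of i] exhaust_4[of j] by (auto simp: P_mat_def vector_4)
  then have "eta = r"
    unfolding eta_def using r r' P_vec[of r] by (intro perron_eigenvalueI) (auto simp: f_def)
  with r r' show "10.33185 < eta" "eta < 10.33186" "eta ^ 3 - 11 * eta ^ 2 + 7 * eta - 1 = 0"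
    by (auto simp: f_def)
qed

lemma nu_eq: "nu = (1 / (eta - 1)) *\<^sub>R P_vec eta"
  unfolding nu_def
proof (rule the_equality)
  note e = eta_props
  have v: "P_mat *v P_vec eta = eta *\<^sub>R P_vec eta" "\<And>i. 0 < P_vec eta $ i"
    "(\<Sum>i\<in>UNIV. P_vec eta $ i) = eta - 1"
    using e by (intro P_vec; simp)+
  show "P_mat *v ((1 / (eta - 1)) *\<^sub>R P_vec eta) = eta *\<^sub>R (1 / (eta - 1)) *\<^sub>R P_vec eta \<and>
    (\<forall>i. 0 < ((1 / (eta - 1)) *\<^sub>R P_vec eta) $ i) \<and>
    (\<Sum>i\<in>UNIV. ((1 / (eta - 1)) *\<^sub>R P_vec eta) $ i) = 1"
    using e v by (simp add: matrix_vector_mult_scaleR flip: sum_divide_distrib)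
next
  note e = eta_props
  fix x assume x: "P_mat *v x = eta *\<^sub>R x \<and> (\<forall>i. 0 < x $ i) \<and> (\<Sum>i\<in>UNIV. x $ i) = 1"
  then have eqs: "3 * x $ 1 + 3 * x $ 2 + 5 * x $ 3 + 4 * x $ 4 = eta * x $ 1"
    "x $ 1 + 2 * x $ 2 + 3 * x $ 3 + 3 * x $ 4 = eta * x $ 2"
    "x $ 1 + x $ 2 + 2 * x $ 3 + x $ 4 = eta * x $ 3"
    "2 * x $ 1 + 3 * x $ 2 + 5 * x $ 3 + 5 * x $ 4 = eta * x $ 4"
    "x $ 1 + x $ 2 + x $ 3 + x $ 4 = 1"
    unfolding P_mat_mult by (auto simp: sum_4)
  \<comment> \<open>Row 1 minus row 4: the functional x_1 - x_4 is a left eigenvector of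
    \<open>P_mat\<close> with eigenvalue 1, so it vanishes on \<open>x\<close>.\<close>
  have "(eta - 1) * (x $ 1 - x $ 4) = 0"
    using eqs by (simp add: algebra_simps)
  then have x4: "x $ 4 = x $ 1"
    using e by simp
  have "(eta - 1) * x $ 3 = 1"
    using eqs by (simp add: algebra_simps)
  then have x3: "x $ 3 = 1 / (eta - 1)"
    using e by (simp add: eq_divide_eq mult.commute)
  \<comment> \<open>Twice row 3 minus row 2, with x_4 = x_1.\<close>
  have "eta * (2 * x $ 3 - x $ 2) = x $ 3"
    using eqs x4 by (simp add: algebra_simps)
  then have "2 * x $ 3 - x $ 2 = x $ 3 / eta"
    using e by (simp add: eq_divide_eq mult.commute)
  then have x2: "x $ 2 = (2 - 1 / eta) * x $ 3"
    by (simp add: algebra_simps)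
  have "x $ 1 = ((eta - 2) * x $ 3 - x $ 2) / 2"
    using eqs x4 by (simp add: algebra_simps)
  then have "x $ 1 = (eta - 4 + 1 / eta) / 2 * x $ 3"
    unfolding x2 by (simp add: algebra_simps)
  with x2 x3 x4 show "x = (1 / (eta - 1)) *\<^sub>R P_vec eta"
    by (simp add: vec_eq_iff forall_4 P_vec_def vector_4)
qed

lemma nu_entries:
  "nu $ 3 = 1 / (eta - 1)" "nu $ 2 = (2 - 1 / eta) * nu $ 3" "nu $ 4 = nu $ 1"
  by (simp_all add: nu_eq P_vec_def vector_4)

lemma nu_eigen: "P_mat *v nu = eta *\<^sub>R nu"
  using P_vec(1)[of eta] eta_props by (simp add: nu_eq matrix_vector_mult_scaleR)

lemma nu_sum: "nu $ 1 + nu $ 2 + nu $ 3 + nu $ 4 = 1"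
  using P_vec(3)[of eta] eta_props by (simp add: nu_eq sum_4 flip: add_divide_distrib)

lemma nu_bounds:
  "0.344445 < nu $ 1" "nu $ 1 < 0.344447" "0.203947 < nu $ 2" "nu $ 2 < 0.203949"
  "0.107159 < nu $ 3" "nu $ 3 < 0.107161" "0.344445 < nu $ 4" "nu $ 4 < 0.344447"
proof -
  note e = eta_props(1,2)
  have b3: "0.1071597 < nu $ 3" "nu $ 3 < 0.1071600"
    unfolding nu_entries(1) using e by (simp_all add: pos_less_divide_eq pos_divide_less_eq)
  have i: "1.903211 < 2 - 1 / eta" "2 - 1 / eta < 1.903213"
  proof -
    have "0.096787 < 1 / eta" "1 / eta < 0.096789"
      using e by (simp_all add: pos_less_divide_eq pos_divide_less_eq)
    then show "1.903211 < 2 - 1 / eta" "2 - 1 / eta < 1.903213"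
      by auto
  qed
  have "1.903211 * nu $ 3 < nu $ 2" "nu $ 2 < 1.903213 * nu $ 3"
    unfolding nu_entries(2) using b3 by (intro mult_strict_right_mono i; simp)+
  with b3 show b2: "0.203947 < nu $ 2" "nu $ 2 < 0.203949" "0.107159 < nu $ 3" "nu $ 3 < 0.107161"
    by simp_all
  show "0.344445 < nu $ 1" "nu $ 1 < 0.344447" "0.344445 < nu $ 4" "nu $ 4 < 0.344447"
    using nu_sum nu_entries(3) b2 b3 by simp_all
qed

lemma nu_scaled:
  "nu $ 1 = 3 * (nu $ 1 / eta) + 3 * (nu $ 2 / eta) + 5 * (nu $ 3 / eta) + 4 * (nu $ 4 / eta)"
  "nu $ 2 = nu $ 1 / eta + 2 * (nu $ 2 / eta) + 3 * (nu $ 3 / eta) + 3 * (nu $ 4 / eta)"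
  "nu $ 3 = nu $ 1 / eta + nu $ 2 / eta + 2 * (nu $ 3 / eta) + nu $ 4 / eta"
  "nu $ 4 = 2 * (nu $ 1 / eta) + 3 * (nu $ 2 / eta) + 5 * (nu $ 3 / eta) + 5 * (nu $ 4 / eta)"
proof -
  have "x = y / eta" if "y = eta * x" for x y
    using that eta_props(1) by simp
  from this[OF nu_eigen[unfolded P_mat_mult, THEN conjunct1]]
    this[OF nu_eigen[unfolded P_mat_mult, THEN conjunct2, THEN conjunct1]]
    this[OF nu_eigen[unfolded P_mat_mult, THEN conjunct2, THEN conjunct2, THEN conjunct1]]
    this[OF nu_eigen[unfolded P_mat_mult, THEN conjunct2, THEN conjunct2, THEN conjunct2]]
  show "nu $ 1 = 3 * (nu $ 1 / eta) + 3 * (nu $ 2 / eta) + 5 * (nu $ 3 / eta) + 4 * (nu $ 4 / eta)"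
    "nu $ 2 = nu $ 1 / eta + 2 * (nu $ 2 / eta) + 3 * (nu $ 3 / eta) + 3 * (nu $ 4 / eta)"
    "nu $ 3 = nu $ 1 / eta + nu $ 2 / eta + 2 * (nu $ 3 / eta) + nu $ 4 / eta"
    "nu $ 4 = 2 * (nu $ 1 / eta) + 3 * (nu $ 2 / eta) + 5 * (nu $ 3 / eta) + 5 * (nu $ 4 / eta)"
    by (simp_all add: add_divide_distrib)
qed

lemma lam_entries:
  "lam $ 1 = nu $ 1" "lam $ 2 = nu $ 2 + nu $ 3" "lam $ 3 = nu $ 3 + nu $ 4" "lam $ 4 = nu $ 2"
  by (simp_all add: lam_def Q_mat_def matrix_vector_mult_def sum_4 vector_4)

section \<open>The towers of \<open>T\<close>\<close>

definition T_brk :: "nat \<Rightarrow> real" where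
  "T_brk j = (if j = 0 then 0 else if j = 1 then lam $ 1 else if j = 2 then lam $ 1 + lam $ 2
     else if j = 3 then lam $ 1 + lam $ 2 + lam $ 3 else lam_total)"

definition T_tr :: "nat \<Rightarrow> real" where
  "T_tr a = (if a = 1 then lam $ 1 + lam $ 3 else if a = 2 then lam $ 1 + lam_total
     else if a = 3 then lam $ 1 + lam $ 2 + lam $ 3 else lam $ 1 + lam $ 3 + lam_total)"

definition R_brk :: "nat \<Rightarrow> real" where
  "R_brk j = (if j = 0 then 0 else if j = 1 then nu $ 1 else if j = 2 then nu $ 1 + nu $ 2
     else if j = 3 then nu $ 1 + nu $ 2 + nu $ 3 else nu $ 1 + nu $ 2 + nu $ 3 + nu $ 4)"

text \<open>Every branch of \<open>T_map\<close> reverses orientation. The pieces 1 and 4 return to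
  [0, 1] after one step and are flipped; the pieces 2 and 3 need two steps and are
  translated.\<close>

definition R_sg :: "nat \<Rightarrow> real" where
  "R_sg a = (if a = 1 \<or> a = 4 then -1 else 1)"

definition R_tr :: "nat \<Rightarrow> real" where
  "R_tr a = (if a = 1 then nu $ 1 + nu $ 3 + nu $ 4 else if a = 2 then nu $ 3 + nu $ 4
     else if a = 3 then - nu $ 1 - nu $ 2 else nu $ 1 + nu $ 2 + 2 * nu $ 3 + nu $ 4)"

definition R_map :: "real \<Rightarrow> real" where
  "R_map x = (let a = if x < R_brk 1 then 1 else if x < R_brk 2 then 2 else if x < R_brk 3 then 3 else 4
     in R_sg a * x + R_tr a)"

text \<open>Return words of \<open>T_map\<close> to [0, 1]. Their letter counts are the columns of
  \<open>Q_mat\<close>, in accordance with \<open>lam = Q_mat *v nu\<close>.\<close>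

definition tau :: "nat \<Rightarrow> nat list" where
  "tau b = (if b = 1 then [1] else if b = 2 then [2, 4] else if b = 3 then [2, 3] else [3])"

definition sig :: "nat \<Rightarrow> nat list" where
  "sig b = (if b = 1 then [1,4,1,2,4,1,3] else if b = 2 then [1,4,2,4,1,2,4,1,3]
     else if b = 3 then [1,4,2,4,1,2,4,1,3,1,4,2,4,1,3] else [1,4,2,4,1,2,4,1,4,2,4,1,3])"

lemma atLeastAtMost_1_4: "{1..4} = {1, 2, 3, 4::nat}"
  by auto

lemma lam_total_nu: "lam_total = nu $ 1 + 2 * nu $ 2 + 2 * nu $ 3 + nu $ 4"
  by (simp add: lam_total_def lam_entries)

interpretation T: iet T_brk "\<lambda>_. -1" T_tr T_map
proof
  show "T_brk j = T_brk 4" if "4 \<le> j" for j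
    using that by (simp add: T_brk_def)
  fix a :: nat and x
  show "T_brk (a - 1) < T_brk a" if "a \<in> {1..4}"
    using that nu_bounds by (auto simp: atLeastAtMost_1_4 T_brk_def lam_total_nu lam_entries)
  show "T_map x = -1 * x + T_tr a" if "T_brk (a - 1) < x" "x < T_brk a"
  proof -
    have "a = 1 \<or> a = 2 \<or> a = 3 \<or> a = 4"
    proof (rule ccontr)
      assume "\<not> ?thesis"
      then have "T_brk (a - 1) = T_brk a"
        by (auto simp: T_brk_def)
      with that show False by simp
    qed
    then show ?thesis
      using that nu_bounds
      by (auto simp: T_brk_def T_map_def I_set_def T_tr_def lam_total_nu lam_entries)
  qed
  show "T_brk 0 \<le> -1 * x + T_tr a \<and> -1 * x + T_tr a \<le> T_brk 4"
    if "a \<in> {1..4}" "T_brk (a - 1) \<le> x" "x \<le> T_brk a"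
    using that nu_bounds unfolding atLeastAtMost_1_4
    by (elim insertE) (auto simp: T_brk_def T_tr_def lam_total_nu lam_entries)
qed auto

interpretation R: iet R_brk R_sg R_tr R_map
proof
  show "R_brk j = R_brk 4" if "4 \<le> j" for j
    using that by (simp add: R_brk_def)
  fix a :: nat and x
  show "R_sg a = 1 \<or> R_sg a = -1"
    by (simp add: R_sg_def)
  show "R_brk (a - 1) < R_brk a" if "a \<in> {1..4}"
    using that nu_bounds by (auto simp: atLeastAtMost_1_4 R_brk_def)
  show "R_map x = R_sg a * x + R_tr a" if "R_brk (a - 1) < x" "x < R_brk a"
  proof -
    have "a = 1 \<or> a = 2 \<or> a = 3 \<or> a = 4"
    proof (rule ccontr)
      assume "\<not> ?thesis"
      then have "R_brk (a - 1) = R_brk a"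
        by (auto simp: R_brk_def)
      with that show False by simp
    qed
    then show ?thesis
      using that nu_bounds by (auto simp: R_brk_def R_map_def)
  qed
  show "R_brk 0 \<le> R_sg a * x + R_tr a \<and> R_sg a * x + R_tr a \<le> R_brk 4"
    if "a \<in> {1..4}" "R_brk (a - 1) \<le> x" "x \<le> R_brk a"
    using that nu_bounds unfolding atLeastAtMost_1_4
    by (elim insertE) (auto simp: R_brk_def R_sg_def R_tr_def)
qed

definition T_floors :: "(nat \<times> nat \<times> bool) list" where
  "T_floors = [(1, 0, False), (2, 0, False), (3, 0, False), (4, 0, False), (3, 1, True), (2, 1, True)]"

text \<open>Sorted from left to right; the flag records whether the floor is flipped.\<close>

definition R_floors :: "(nat \<times> nat \<times> bool) list" where
  "R_floors =
  [(1, 0, False), (2, 0, False), (3, 0, False), (4, 0, False), (3, 9, False), (4, 7, True),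
   (3, 7, True), (2, 7, True), (1, 5, False), (4, 11, False), (3, 13, True), (4, 4, True),
   (3, 4, True), (2, 4, True), (1, 2, False), (2, 2, False), (3, 2, False), (4, 2, False),
   (3, 11, False), (4, 9, True), (1, 3, True), (2, 5, False), (3, 5, False), (4, 5, False),
   (3, 14, False), (4, 12, True), (1, 6, True), (2, 8, False), (3, 8, False), (4, 8, False),
   (3, 10, True), (4, 1, True), (3, 1, True), (2, 1, True), (1, 1, True), (2, 3, False),
   (3, 3, False), (4, 3, False), (3, 12, False), (4, 10, True), (1, 4, True), (2, 6, False),
   (3, 6, False), (4, 6, False)]"

lemma eta_pos: "0 < eta"
  using eta_props(1) by simp

context
  fixes m1 m2 m3 m4 :: real
  defines m1: "m1 \<equiv> nu $ 1 / eta" and m2: "m2 \<equiv> nu $ 2 / eta"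
    and m3: "m3 \<equiv> nu $ 3 / eta" and m4: "m4 \<equiv> nu $ 4 / eta"
begin

lemmas m_def = m1 m2 m3 m4

lemma m_pos: "0 < m1" "0 < m2" "0 < m3" "0 < m4"
  using nu_bounds eta_pos by (auto simp: m_def)

lemma R_brk_eta: "1 / eta * R_brk j = (if j = 0 then 0 else if j = 1 then m1 else if j = 2 then m1 + m2
     else if j = 3 then m1 + m2 + m3 else m1 + m2 + m3 + m4)"
  by (simp add: R_brk_def m_def add_divide_distrib)

lemma R_tr_eta: "1 / eta * R_tr a = (if a = 1 then m1 + m3 + m4 else if a = 2 then m3 + m4
     else if a = 3 then - m1 - m2 else m1 + m2 + 2 * m3 + m4)"
  by (simp add: R_tr_def m_def add_divide_distrib diff_divide_distrib)

text \<open>The eigenvector equation in the units \<open>m1\<close>, \<open>m2\<close>,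
  \<open>m3\<close>, \<open>m4\<close>: all lengths of \<open>R_map\<close> become integer
  combinations of the lengths of the base intervals. Comparing points along the return words then
  only uses that these four units are positive, and no decimals.\<close>

lemma nu_m:
  "nu $ 1 = 3 * m1 + 3 * m2 + 5 * m3 + 4 * m4" "nu $ 2 = m1 + 2 * m2 + 3 * m3 + 3 * m4"
  "nu $ 3 = m1 + m2 + 2 * m3 + m4" "nu $ 4 = 2 * m1 + 3 * m2 + 5 * m3 + 5 * m4"
  using nu_scaled by (simp_all add: m_def)

lemmas R_m = R_brk_def[unfolded nu_m] R_tr_def[unfolded nu_m] R_sg_def R.br_def

lemma R_R_climb:
  assumes "b \<in> {1..4}" "R_brk (b - 1) \<le> t" "t \<le> R_brk b"
  shows "chain R_brk R.br (sig b) (1 / eta * t) (1 / eta * R.br b t)"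
proof -
  define s where "s = 1 / eta * t"
  have s1: "1 / eta * R_brk (b - 1) \<le> s" and s2: "s \<le> 1 / eta * R_brk b"
    using assms(2,3) eta_pos by (auto simp: s_def divide_right_mono)
  have z: "1 / eta * R.br b t = R_sg b * s + 1 / eta * R_tr b"
    by (simp add: R.br_def s_def add_divide_distrib)
  have "chain R_brk R.br (sig b) s (R_sg b * s + 1 / eta * R_tr b)"
    using assms(1) s1 s2 m_pos unfolding atLeastAtMost_1_4 R_brk_eta R_tr_eta
    by (elim insertE; simp add: sig_def R_m)
  then show ?thesis
    unfolding z s_def .
qed

lemma R_R_tiles: "tiles (map (\<lambda>(b, k, r).
        let l = fold R.br (take k (sig b)) (1 / eta * R_brk (b - 1)); h = fold R.br (take k (sig b)) (1 / eta * R_brk b)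
        in if r then (h, l) else (l, h)) R_floors) (R_brk 0) (R_brk 4)"
  unfolding R_brk_eta by (simp add: R_floors_def sig_def R_m Let_def)

text \<open>A regular endpoint would follow the word of an adjacent base interval through open
  pieces, but the closed chain runs into a breakpoint of \<open>R_map\<close>. The assumption
  \<open>boundary\<close> of the tower over \<open>R_map\<close> thus holds vacuously.\<close>

lemma R_boundary: "j \<le> 4 \<Longrightarrow> \<not> regular R_map R.piece (1 / eta * R_brk j)"
proof
  assume j: "j \<le> 4" and reg: "regular R_map R.piece (1 / eta * R_brk j)"
  show False
  proof (cases "j = 0")
    case True
    then show False
      using R.regular_range[OF reg] by (simp add: R_brk_def)
  next
    case False
    then have j: "j \<in> {1..4}"
      using j by simp
    \<comment> \<open>Along \<open>sig 2\<close>, which is a prefix of \<open>sig 3\<close>, the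
      endpoint common to the bases 2 and 3 stays inside the pieces; only the longer word shows the
      breakpoint.\<close>
    define b where "b = (if j = 2 then 3 else j)"
    have b: "b \<in> {1..4}" "R_brk (b - 1) \<le> R_brk j" "R_brk j \<le> R_brk b"
      using j monoD[OF R.mono_B, of "j - 1" j] monoD[OF R.mono_B, of 2 3] by (auto simp: b_def)
    from R.chain_follows[OF reg R_R_climb[OF b]]
    have "follows R_map R.piece (sig b) (1 / eta * R_brk j) (1 / eta * R.br b (R_brk j))" .
    then show False
      using j m_pos unfolding atLeastAtMost_1_4 R_brk_eta
      by (elim insertE; simp add: b_def sig_def R.follows_br R.piece_def R_m del: follows_Cons)
  qed
qed

text \<open>The three points on which the orbits of the breakpoints of \<open>T_map\<close> settle:
  \<open>lam $ 1 + lam $ 2 + lam $ 3\<close> reaches the first in two steps,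
  \<open>lam $ 1 + lam $ 2\<close> the second in one, the ends 0 and \<open>lam_total\<close> the
  third in one, and \<open>lam $ 1\<close> goes to \<open>lam_total\<close>.\<close>

lemma R_self_similar:
  "follows R_map R.piece [1,4,2,4,1,3] (nu $ 3) (1 / eta * nu $ 3)"
  "follows R_map R.piece [2,4,1,3] (nu $ 3 + nu $ 4) (1 / eta * (nu $ 3 + nu $ 4))"
  "follows R_map R.piece [4,1,2,4,1,3] (nu $ 1 + nu $ 3 + nu $ 4) (1 / eta * (nu $ 1 + nu $ 3 + nu $ 4))"
proof -
  have z: "1 / eta * nu $ 3 = m3" "1 / eta * (nu $ 3 + nu $ 4) = m3 + m4"
    "1 / eta * (nu $ 1 + nu $ 3 + nu $ 4) = m1 + m3 + m4"
    by (simp_all add: m_def add_divide_distrib)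
  show "follows R_map R.piece [1,4,2,4,1,3] (nu $ 3) (1 / eta * nu $ 3)"
    unfolding z using m_pos by (simp add: R.follows_br R.piece_def R_m nu_m del: follows_Cons)
  show "follows R_map R.piece [2,4,1,3] (nu $ 3 + nu $ 4) (1 / eta * (nu $ 3 + nu $ 4))"
    unfolding z using m_pos by (simp add: R.follows_br R.piece_def R_m nu_m del: follows_Cons)
  show "follows R_map R.piece [4,1,2,4,1,3] (nu $ 1 + nu $ 3 + nu $ 4) (1 / eta * (nu $ 1 + nu $ 3 + nu $ 4))"
    unfolding z using m_pos by (simp add: R.follows_br R.piece_def R_m nu_m del: follows_Cons)
qed

end

interpretation RR: tower R_brk R_sg R_tr R_map R_brk R_sg R_tr R_map "1 / eta" sig R_floors
proof
  show "0 < 1 / eta"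
    using eta_pos by simp
  show "sig b \<noteq> []" if "b \<in> {1..4}" for b
    by (simp add: sig_def)
  show "chain R_brk R.br (sig b) (1 / eta * t) (1 / eta * R.br b t)"
    if "b \<in> {1..4}" "R_brk (b - 1) \<le> t" "t \<le> R_brk b" for b t
    using R_R_climb[OF that] .
  show "b \<in> {1..4} \<and> k < length (sig b)" if "(b, k, r) \<in> set R_floors" for b k r
    using that by (auto simp: R_floors_def sig_def)
qed (use R_R_tiles R_boundary in blast)+

lemma regular_R:
  "regular R_map R.piece (nu $ 3)" "regular R_map R.piece (nu $ 3 + nu $ 4)"
  "regular R_map R.piece (nu $ 1 + nu $ 3 + nu $ 4)"
  by (rule regular_self_similar[OF RR.renorm R_self_similar(1)]
      regular_self_similar[OF RR.renorm R_self_similar(2)]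
      regular_self_similar[OF RR.renorm R_self_similar(3)]; simp)+

lemmas T_n = T_brk_def[unfolded lam_total_nu lam_entries] T_tr_def[unfolded lam_total_nu lam_entries] T.br_def
lemmas R_n = R_brk_def R_tr_def R_sg_def R.br_def

lemma T_R_climb:
  "b \<in> {1..4} \<Longrightarrow> R_brk (b - 1) \<le> t \<Longrightarrow> t \<le> R_brk b \<Longrightarrow> chain T_brk T.br (tau b) (1 * t) (1 * R.br b t)"
  using nu_bounds unfolding atLeastAtMost_1_4
  by (elim insertE; simp add: tau_def T_n R_n)

text \<open>The right end 1 of the base is the exceptional endpoint: it lies inside the third piece
  of \<open>T_map\<close> and is sent to \<open>nu $ 3\<close>, which is regular for
  \<open>R_map\<close>. The other endpoints are not regular.\<close>

lemma T_R_boundary: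
  assumes j: "j \<le> 4" and reg: "regular T_map T.piece (1 * R_brk j)"
  shows "\<exists>k y. (T_map ^^ k) (1 * R_brk j) = 1 * y \<and> regular R_map R.piece y"
proof (cases "j = 0 \<or> j = 4")
  case True
  then show ?thesis
  proof
    assume "j = 0"
    then show ?thesis
      using T.regular_range[OF reg] by (simp add: R_brk_def T_brk_def)
  next
    assume "j = 4"
    moreover have "R_brk 4 \<in> T.piece 3"
      using nu_bounds by (auto simp: T.piece_def R_n T_n)
    ultimately have "T_map (R_brk j) = nu $ 3"
      by (simp add: T.F_br T_n R_n)
    then show ?thesis
      using regular_R(1) by (intro exI[of _ 1] exI[of _ "nu $ 3"]) simp
  qed
next
  case False
  then have j: "j \<in> {1..4}" "j \<noteq> 4"
    using j by auto
  have "R_brk (j - 1) \<le> R_brk j"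
    using monoD[OF R.mono_B, of "j - 1" j] by simp
  from T.chain_follows[OF reg T_R_climb[OF j(1) this order_refl]]
  have "follows T_map T.piece (tau j) (1 * R_brk j) (1 * R.br j (R_brk j))" .
  then have False
    using j nu_bounds unfolding atLeastAtMost_1_4
    by (elim insertE; simp add: tau_def T.follows_br T.piece_def T_n R_n del: follows_Cons)
  then show ?thesis ..
qed

interpretation TR: tower T_brk "\<lambda>_. -1" T_tr T_map R_brk R_sg R_tr R_map 1 tau T_floors
proof
  show "tau b \<noteq> []" if "b \<in> {1..4}" for b
    by (simp add: tau_def)
  show "b \<in> {1..4} \<and> k < length (tau b)" if "(b, k, r) \<in> set T_floors" for b k r
    using that by (auto simp: T_floors_def tau_def)
  show "tiles (map (\<lambda>(b, k, r).
        let l = fold T.br (take k (tau b)) (1 * R_brk (b - 1)); h = fold T.br (take k (tau b)) (1 * R_brk b)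
        in if r then (h, l) else (l, h)) T_floors) (T_brk 0) (T_brk 4)"
    by (simp add: T_floors_def tau_def T_n R_n Let_def)
qed (use T_R_climb T_R_boundary in simp_all)

section \<open>Minimality and unique ergodicity of \<open>T\<close>\<close>

text \<open>Itineraries under \<open>T_map\<close> over the base of length
  \<open>(1 / eta) ^ n\<close>: \<open>n\<close> substitutions by \<open>sig\<close>, then one by
  \<open>tau\<close>.\<close>

primrec tower_word :: "nat \<Rightarrow> nat \<Rightarrow> nat list" where
  "tower_word 0 = tau"
| "tower_word (Suc n) = (\<lambda>b. concat (map (tower_word n) (sig b)))"

lemma R_brk_0_4: "R_brk 0 = 0" "R_brk 4 = 1"
  using nu_sum by (simp_all add: R_brk_def)

lemma T_brk_0_4: "T_brk 0 = 0" "T_brk 4 = lam_total"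
  by (simp_all add: T_brk_def)

lemma T_renorm: "renorm T_map T.piece ((1 / eta) ^ n) (tower_word n) R_map R.piece"
proof (induction n)
  case 0
  show ?case using TR.renorm by simp
next
  case (Suc n)
  from renorm_comp[OF Suc RR.renorm] show ?case
    by (simp add: mult.commute)
qed

lemma T_enters: "enters T_map T.piece ((1 / eta) ^ n) R_map R.piece"
proof (induction n)
  case 0
  show ?case using TR.enters by simp
next
  case (Suc n)
  from enters_comp[OF Suc RR.enters T_renorm] show ?case
    by (simp add: mult.commute)
qed

lemma T_covering: "covering T_map {0<..<lam_total} ((1 / eta) ^ n) (tower_word n) R.piece"
proof (induction n)
  case 0
  show ?case using TR.covering by (simp add: T_brk_0_4)
next
  case (Suc n)
  from covering_comp[OF Suc RR.covering T_renorm RR.renorm T.isometric R.open_piece R.piece_subset]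
  show ?case
    using R.disj eta_pos by (simp add: mult.commute)
qed

text \<open>Every word \<open>sig b'\<close> contains all four letters, which is the positivity of
  \<open>P_mat\<close>; so a single passage through any tower visits every piece.\<close>

lemma R_visits:
  assumes y: "regular R_map R.piece y" and b: "R.piece b \<noteq> {}"
  shows "\<exists>j. (R_map ^^ j) y \<in> R.piece b"
proof -
  obtain k z where k: "(R_map ^^ k) y = 1 / eta * z" and z: "regular R_map R.piece z"
    using RR.enters y by (auto simp: enters_def)
  obtain b' where b': "z \<in> R.piece b'"
    using R.regular_in[OF z] by blast
  have bb: "b \<in> {1..4}" "b' \<in> {1..4}"
    using b b' R.piece_range by blast+
  then have "b \<in> set (sig b')"
    unfolding atLeastAtMost_1_4 by (elim insertE) (auto simp: sig_def)
  then obtain i where i: "i < length (sig b')" "sig b' ! i = b"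
    by (auto simp: in_set_conv_nth)
  have "follows R_map R.piece (sig b') (1 / eta * z) (1 / eta * R_map z)"
    using RR.renorm b' by (auto simp: renorm_def)
  from follows_nth[OF this i(1)] show ?thesis
    using i(2) k by (intro exI[of _ "i + k"]) (simp add: funpow_add)
qed

lemma regular_dense:
  assumes x: "regular T_map T.piece x" and U: "open U" "U \<noteq> {}" "U \<subseteq> {0<..<lam_total}"
  shows "\<exists>k. (T_map ^^ k) x \<in> U"
proof (rule dense_orbits[OF T_enters T_renorm T_covering T.isometric _ _ _ R_visits x U])
  show "0 < (1 / eta) ^ n" for n
    using eta_pos by simp
  show "(\<lambda>n. (1 / eta) ^ n) \<longlonglongrightarrow> 0"
    using eta_props(1) by (intro LIMSEQ_power_zero) (simp add: field_simps)
  show "0 \<le> y \<and> y \<le> 1" if "y \<in> R.piece b" for b y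
    using that R.piece_subset[of b] by (auto simp: R_brk_0_4)
qed

section \<open>Half-open pieces, orbits of breakpoints, minimality and aperiodicity\<close>

lemma I_set_range: "x \<in> I_set i \<Longrightarrow> i \<in> {1..4}"
  unfolding I_set_def atLeastAtMost_1_4 by (metis empty_iff insert_iff)

lemma I_set_closed: "x \<in> I_set i \<Longrightarrow> T_brk (i - 1) \<le> x \<and> x \<le> T_brk i"
proof -
  assume x: "x \<in> I_set i"
  show ?thesis
    using I_set_range[OF x] x unfolding atLeastAtMost_1_4
    by (elim insertE) (simp_all add: I_set_def T_brk_def)
qed

lemma in_I_set: "x \<in> {0..lam_total} \<Longrightarrow> \<exists>i. x \<in> I_set i"
proof -
  assume "x \<in> {0..lam_total}"
  then have "x \<in> I_set 1 \<or> x \<in> I_set 2 \<or> x \<in> I_set 3 \<or> x \<in> I_set 4"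
    by (simp add: I_set_def) linarith
  then show ?thesis
    by blast
qed

lemma lam_pos: "0 < lam $ 1" "0 < lam $ 2" "0 < lam $ 3" "0 < lam $ 4"
  using nu_bounds by (simp_all add: lam_entries)

lemma I_set_disj: "x \<in> I_set i \<Longrightarrow> x \<in> I_set j \<Longrightarrow> i = j"
proof -
  assume i: "x \<in> I_set i" and j: "x \<in> I_set j"
  show ?thesis
    using I_set_range[OF i] I_set_range[OF j] i j lam_pos unfolding atLeastAtMost_1_4
    by (elim insertE) (simp_all add: I_set_def lam_total_def)
qed

lemma T_map_I_set: "x \<in> I_set i \<Longrightarrow> T_map x = - x + T_tr i"
proof -
  assume i: "x \<in> I_set i"
  then have "x \<in> I_set j \<longleftrightarrow> j = i" for j
    using I_set_disj by blast
  then show ?thesis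
    using I_set_range[OF i] unfolding atLeastAtMost_1_4 T_map_def
    by (elim insertE) (simp_all add: T_tr_def)
qed

lemma T_range: "x \<in> {0..lam_total} \<Longrightarrow> T_map x \<in> {0..lam_total}"
proof -
  assume "x \<in> {0..lam_total}"
  then obtain i where i: "x \<in> I_set i"
    using in_I_set by blast
  show ?thesis
    using T.inv[OF I_set_range[OF i]] I_set_closed[OF i] T_map_I_set[OF i] by (simp add: T_brk_0_4)
qed

lemma T_iter_range: "x \<in> {0..lam_total} \<Longrightarrow> (T_map ^^ n) x \<in> {0..lam_total}"
  by (induction n) (simp_all only: funpow.simps comp_apply id_apply T_range)

lemma T_specials:
  "T_map 0 = lam $ 1 + lam $ 3" "T_map (lam $ 1) = lam_total" "T_map (lam $ 1 + lam $ 2) = lam $ 3"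
  "T_map (lam $ 1 + lam $ 2 + lam $ 3) = lam $ 1 + lam $ 3 + lam $ 4"
  "T_map lam_total = lam $ 1 + lam $ 3" "T_map (lam $ 1 + lam $ 3 + lam $ 4) = nu $ 3"
  using nu_bounds by (simp_all add: T_map_def I_set_def lam_total_nu lam_entries)

lemma regular_specials:
  "regular T_map T.piece (nu $ 3)" "regular T_map T.piece (lam $ 3)" "regular T_map T.piece (lam $ 1 + lam $ 3)"
  using renorm_regular[OF TR.renorm regular_R(1)] renorm_regular[OF TR.renorm regular_R(2)]
    renorm_regular[OF TR.renorm regular_R(3)] by (simp_all add: lam_entries add.assoc)

text \<open>An orbit that is not regular meets a breakpoint, and from each breakpoint one of the
  three self-similar points is reached within two steps.\<close>

lemma eventually_regular:
  assumes "x \<in> {0..lam_total}"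
  shows "\<exists>m. regular T_map T.piece ((T_map ^^ m) x)"
proof (cases "regular T_map T.piece x")
  case True
  then show ?thesis
    by (intro exI[of _ 0]) simp
next
  case False
  then obtain k where k: "\<And>a. (T_map ^^ k) x \<notin> T.piece a"
    by (auto simp: regular_def)
  define d where "d = (T_map ^^ k) x"
  have "d \<in> T_brk ` {0..4}"
    using T.in_piece[of d] k T_iter_range[OF assms, of k] by (auto simp: d_def T_brk_0_4)
  then have "d \<in> T_brk ` {0, 1, 2, 3, 4}"
    by (simp add: atLeastAtMost_1_4 flip: insert_is_Un) (auto simp: le_Suc_eq numeral_eq_Suc)
  then have "d = 0 \<or> d = lam $ 1 \<or> d = lam $ 1 + lam $ 2 \<or> d = lam $ 1 + lam $ 2 + lam $ 3 \<or> d = lam_total"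
    by (auto simp: T_brk_def)
  then have "\<exists>j. regular T_map T.piece ((T_map ^^ j) d)"
  proof (elim disjE)
    assume "d = 0" then show ?thesis
      using regular_specials T_specials by (intro exI[of _ 1]) simp
  next
    assume "d = lam $ 1" then show ?thesis
      using regular_specials T_specials by (intro exI[of _ 2]) (simp add: numeral_2_eq_2)
  next
    assume "d = lam $ 1 + lam $ 2" then show ?thesis
      using regular_specials T_specials by (intro exI[of _ 1]) simp
  next
    assume "d = lam $ 1 + lam $ 2 + lam $ 3" then show ?thesis
      using regular_specials T_specials by (intro exI[of _ 2]) (simp add: numeral_2_eq_2)
  next
    assume "d = lam_total" then show ?thesis
      using regular_specials T_specials by (intro exI[of _ 1]) simp
  qed
  then obtain j where "regular T_map T.piece ((T_map ^^ j) d)"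
    by blast
  then show ?thesis
    by (intro exI[of _ "j + k"]) (simp add: d_def funpow_add)
qed

lemma T_dense:
  assumes x: "x \<in> {0..lam_total}" and U: "open U" "U \<noteq> {}" "U \<subseteq> {0<..<lam_total}"
  shows "\<exists>k\<ge>N. (T_map ^^ k) x \<in> U"
proof -
  obtain m where m: "regular T_map T.piece ((T_map ^^ m) ((T_map ^^ N) x))"
    using eventually_regular[OF T_iter_range[OF x]] by blast
  obtain k where "(T_map ^^ k) ((T_map ^^ m) ((T_map ^^ N) x)) \<in> U"
    using regular_dense[OF m U] by blast
  then show ?thesis
    by (intro exI[of _ "k + (m + N)"]) (simp add: funpow_add)
qed

lemma lam_total_pos: "0 < lam_total"
  using nu_bounds by (simp add: lam_total_nu)

text \<open>A periodic orbit is finite, and its complement in the open interval is an open set which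
  it would have to meet by density.\<close>

lemma T_aperiodic:
  assumes x: "x \<in> {0..lam_total}" and n: "0 < n"
  shows "(T_map ^^ n) x \<noteq> x"
proof
  assume per: "(T_map ^^ n) x = x"
  have "(T_map ^^ (k mod n)) x = (T_map ^^ k) x" for k
    by (rule funpow_mod_eq[OF per])
  then have orb: "(T_map ^^ k) x \<in> (\<lambda>k. (T_map ^^ k) x) ` {..<n}" for k
    using n by (metis imageI lessThan_iff mod_less_divisor)
  have fin: "finite ((\<lambda>k. (T_map ^^ k) x) ` {..<n})" (is "finite ?O")
    by simp
  have "open ({0<..<lam_total} - ?O)"
    using fin by (intro open_Diff finite_imp_closed) auto
  moreover have "{0<..<lam_total} - ?O \<noteq> {}"
    using infinite_Ioo[OF lam_total_pos] finite_subset[OF _ fin] by blast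
  ultimately show False
    using T_dense[OF x, of "{0<..<lam_total} - ?O" 0] orb by blast
qed

lemma T_orbit_inj:
  assumes x: "x \<in> {0..lam_total}" and eq: "(T_map ^^ i) x = (T_map ^^ j) x"
  shows "i = j"
proof (rule ccontr)
  have aux: False if "i < j" "(T_map ^^ i) x = (T_map ^^ j) x" for i j
  proof -
    have "(T_map ^^ (j - i)) ((T_map ^^ i) x) = (T_map ^^ i) x"
      using that by (subst comp_apply[of "T_map ^^ (j - i)", symmetric], subst funpow_add[symmetric]) simp
    then show False
      using T_aperiodic[OF T_iter_range[OF x], of "j - i"] that(1) by auto
  qed
  assume "i \<noteq> j"
  then show False
    using aux[of i j] aux[of j i] eq by (metis linorder_neqE_nat)
qed

section \<open>Contraction of mean-zero observables and visit frequencies\<close>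

definition centered :: "(nat \<Rightarrow> real) \<Rightarrow> real \<Rightarrow> bool" where
  "centered g K \<longleftrightarrow> 0 \<le> K \<and> (\<forall>a\<in>{1..4}. \<bar>g a\<bar> \<le> K) \<and>
     g 1 * nu $ 1 + g 2 * nu $ 2 + g 3 * nu $ 3 + g 4 * nu $ 4 = 0"

text \<open>Because \<open>g\<close> has mean zero, a multiple of \<open>nu\<close> may be
  subtracted from each coefficient vector of \<open>push sig g\<close>, and what is left is bounded
  by 7/2 times \<open>K\<close>. Since 7 is the length of the shortest word \<open>sig b\<close>,
  mean-zero observables shrink by 1/2 relative to the growth of time.\<close>

lemma centered_push:
  assumes "centered g K"
  shows "centered (push sig g) (1 / 2 * 7 * K)"
proof -
  have K: "0 \<le> K" and b: "\<bar>g 1\<bar> \<le> K" "\<bar>g 2\<bar> \<le> K" "\<bar>g 3\<bar> \<le> K" "\<bar>g 4\<bar> \<le> K"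
    and c: "g 1 * nu $ 1 + g 2 * nu $ 2 + g 3 * nu $ 3 + g 4 * nu $ 4 = 0"
    using assms by (auto simp: centered_def)
  have p: "push sig g 1 = 3 * g 1 + g 2 + g 3 + 2 * g 4" "push sig g 2 = 3 * g 1 + 2 * g 2 + g 3 + 3 * g 4"
    "push sig g 3 = 5 * g 1 + 3 * g 2 + 2 * g 3 + 5 * g 4" "push sig g 4 = 4 * g 1 + 3 * g 2 + g 3 + 5 * g 4"
    by (simp_all add: sig_def)
  have err: "\<bar>g a * r - g a * y\<bar> \<le> K / 10000" if "\<bar>g a\<bar> \<le> K" "\<bar>r - y\<bar> \<le> 1 / 10000" for a r y
    using mult_mono[OF that K abs_ge_zero] by (simp add: abs_mult flip: right_diff_distrib)
  have nb: "\<bar>34 / 100 + 44 / 10000 - nu $ 1\<bar> \<le> 1 / 10000" "\<bar>2039 / 10000 - nu $ 2\<bar> \<le> 1 / 10000"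
    "\<bar>1072 / 10000 - nu $ 3\<bar> \<le> 1 / 10000" "\<bar>34 / 100 + 44 / 10000 - nu $ 4\<bar> \<le> 1 / 10000"
    unfolding abs_diff_le_iff using nu_bounds by simp_all
  \<comment> \<open>The mean-zero condition with \<open>nu\<close> rounded to four digits and
    multiplied by 10000; each of the four roundings costs at most \<open>K / 10000\<close> before
    scaling.\<close>
  have s: "\<bar>3444 * g 1 + 2039 * g 2 + 1072 * g 3 + 3444 * g 4\<bar> \<le> 4 * K"
    using err[OF b(1) nb(1)] err[OF b(2) nb(2)] err[OF b(3) nb(3)] err[OF b(4) nb(4)] c
    unfolding abs_le_iff by (simp add: algebra_simps)
  have "push sig g 1 * nu $ 1 + push sig g 2 * nu $ 2 + push sig g 3 * nu $ 3 + push sig g 4 * nu $ 4 =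
      g 1 * (3 * nu $ 1 + 3 * nu $ 2 + 5 * nu $ 3 + 4 * nu $ 4) +
      g 2 * (nu $ 1 + 2 * nu $ 2 + 3 * nu $ 3 + 3 * nu $ 4) +
      g 3 * (nu $ 1 + nu $ 2 + 2 * nu $ 3 + nu $ 4) +
      g 4 * (2 * nu $ 1 + 3 * nu $ 2 + 5 * nu $ 3 + 5 * nu $ 4)"
    unfolding p by (simp add: algebra_simps)
  also have "\<dots> = eta * (g 1 * nu $ 1 + g 2 * nu $ 2 + g 3 * nu $ 3 + g 4 * nu $ 4)"
    using nu_eigen[unfolded P_mat_mult] by (simp add: algebra_simps)
  finally have "push sig g 1 * nu $ 1 + push sig g 2 * nu $ 2 + push sig g 3 * nu $ 3 + push sig g 4 * nu $ 4 = 0"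
    using c by simp
  moreover have "\<forall>a\<in>{1..4}. \<bar>push sig g a\<bar> \<le> 1 / 2 * 7 * K"
    using b s K unfolding atLeastAtMost_1_4 ball_simps p abs_le_iff by (intro conjI TrueI) linarith+
  ultimately show ?thesis
    using K unfolding centered_def by simp
qed


lemma R_birkhoff_small:
  assumes g: "centered g K" and y: "regular R_map R.piece y" and e: "0 < e"
  shows "\<exists>C. \<forall>n. \<bar>birkhoff R_map R.piece g y n\<bar> \<le> C + e * real n"
proof -
  have K: "0 \<le> K" using g by (simp add: centered_def)
  have len: "real (length (sig b)) = push sig (\<lambda>_. 1) b" for b
    by (simp add: sum_list_triv)
  obtain k where k: "(1 / 2) ^ k < e / (K + 1)"
    using real_arch_pow_inv[of "e / (K + 1)" "1 / 2"] e K by auto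
  have "\<exists>C. \<forall>n g K. centered g K \<longrightarrow> \<bar>birkhoff R_map R.piece g y n\<bar> \<le>
      K * (C + (1 / 2) ^ k * birkhoff R_map R.piece (\<lambda>_. 1) y n)"
  proof (rule birkhoff_contraction[where w = sig and c = "1 / eta" and M = 15 and L = 1 and H = 7,
        OF R.disj RR.renorm RR.enters _ _ _ _ _ _ _ _ y])
    show "centered (push sig g) (1 / 2 * 7 * K)" if "centered g K" for g K
      using centered_push[OF that] .
    fix b assume "R.piece b \<noteq> {}"
    then have b: "b \<in> {1..4}"
      using R.piece_range by blast
    show "length (sig b) \<le> 15"
      by (simp add: sig_def)
    show "(0 :: real) \<le> 1 \<and> 7 * 1 \<le> push sig (\<lambda>_. 1) b"
      by (simp add: sig_def)
    show "\<bar>g b\<bar> \<le> K * 1" if "centered g K" for g K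
      using that b by (auto simp: centered_def)
  qed (auto simp: centered_def)
  then obtain C where C: "\<bar>birkhoff R_map R.piece g y n\<bar> \<le> K * (C + (1 / 2) ^ k * real n)" for n
    using g by (auto simp: birkhoff_def)
  have "K * (1 / 2) ^ k \<le> K * (e / (K + 1))"
    using k K by (intro mult_left_mono) auto
  also have "\<dots> \<le> e"
    using K e by (simp add: field_simps)
  finally have "K * (1 / 2) ^ k * real n \<le> e * real n" for n
    by (intro mult_right_mono) auto
  then have "\<bar>birkhoff R_map R.piece g y n\<bar> \<le> K * C + e * real n" for n
    using C[of n] by (smt (verit) distrib_left mult.assoc)
  then show ?thesis
    by blast
qed

lemma T_birkhoff_small:
  assumes g: "g 1 * lam $ 1 + g 2 * lam $ 2 + g 3 * lam $ 3 + g 4 * lam $ 4 = 0"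
    and x: "regular T_map T.piece x"
  shows "(\<lambda>n. birkhoff T_map T.piece g x n / real n) \<longlonglongrightarrow> 0"
proof -
  define B where "B = \<bar>g 1\<bar> + \<bar>g 2\<bar> + \<bar>g 3\<bar> + \<bar>g 4\<bar>"
  have B: "\<bar>g a\<bar> \<le> B \<and> 0 \<le> (1 :: real)" if "T.piece a \<noteq> {}" for a
  proof -
    from that have "a \<in> {1..4}"
      using T.piece_range by blast
    then show ?thesis
      unfolding atLeastAtMost_1_4 B_def by auto
  qed
  have M: "length (tau b) \<le> 2" for b
    by (simp add: tau_def)
  obtain y D where y: "regular R_map R.piece y" and D: "\<And>n. \<exists>m\<le>n. \<forall>g t B.
     tame T.piece g B t \<longrightarrow>
     \<bar>birkhoff T_map T.piece g x n\<bar> \<le> B * D + \<bar>birkhoff R_map R.piece (push tau g) y m\<bar> \<and>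
     birkhoff R_map R.piece (push tau t) y m \<le> birkhoff T_map T.piece t x n"
    using birkhoff_renorm[OF T.disj R.disj TR.renorm TR.enters M x] by blast
  \<comment> \<open>Mean zero with respect to \<open>lam\<close> becomes mean zero with respect to
    \<open>nu\<close> because the letter counts of \<open>tau\<close> form \<open>Q_mat\<close>; the
    factor 2 is the maximal length of these words.\<close>
  have c: "centered (push tau g) (2 * B)"
    unfolding centered_def atLeastAtMost_1_4 using g
    by (auto simp: tau_def lam_entries B_def algebra_simps)
  show ?thesis
  proof (rule LIMSEQ_I)
    fix e :: real assume e: "0 < e"
    obtain C where C: "\<And>n. \<bar>birkhoff R_map R.piece (push tau g) y n\<bar> \<le> C + e / 2 * real n"
      using R_birkhoff_small[OF c y, of "e / 2"] e by auto
    have bd: "\<bar>birkhoff T_map T.piece g x n\<bar> \<le> (B * D + C) + e / 2 * real n" for n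
    proof -
      obtain m where "m \<le> n" and m: "\<And>g t B. tame T.piece g B t \<Longrightarrow>
         \<bar>birkhoff T_map T.piece g x n\<bar> \<le> B * D + \<bar>birkhoff R_map R.piece (push tau g) y m\<bar> \<and>
         birkhoff R_map R.piece (push tau t) y m \<le> birkhoff T_map T.piece t x n"
        using D[of n] by blast
      have "\<bar>birkhoff T_map T.piece g x n\<bar> \<le> B * D + \<bar>birkhoff R_map R.piece (push tau g) y m\<bar>"
        using m[of g B "\<lambda>_. 1"] B by blast
      moreover have "e / 2 * real m \<le> e / 2 * real n"
        using \<open>m \<le> n\<close> e by (intro mult_left_mono) auto
      ultimately show ?thesis
        using C[of m] by linarith
    qed
    obtain N where N: "2 * \<bar>B * D + C\<bar> / e < real N"
      using reals_Archimedean2 by blast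
    have "norm (birkhoff T_map T.piece g x n / real n - 0) < e" if n: "n \<ge> Suc N" for n
    proof -
      have "2 * \<bar>B * D + C\<bar> / e < real n"
        using N n by linarith
      then have "2 * \<bar>B * D + C\<bar> < real n * e"
        using e by (simp add: pos_divide_less_eq)
      then have "\<bar>birkhoff T_map T.piece g x n\<bar> < e * real n"
        using order_trans[OF bd[of n] add_right_mono[OF abs_ge_self]] by (simp add: mult.commute)
      then show ?thesis
        using n by (simp add: pos_divide_less_eq)
    qed
    then show "\<exists>no. \<forall>n\<ge>no. norm (birkhoff T_map T.piece g x n / real n - 0) < e"
      by blast
  qed
qed

lemma T_piece_subset_I_set: "T.piece a \<subseteq> I_set a"
proof
  fix x assume x: "x \<in> T.piece a"
  have "a \<in> {1..4}"
    using T.piece_range[OF x] .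
  then show "x \<in> I_set a"
    using x unfolding atLeastAtMost_1_4
    by (elim insertE) (simp_all add: T.piece_def T_brk_def I_set_def)
qed

lemma T_piece_I_set: "x \<in> T.piece a \<Longrightarrow> x \<in> I_set i \<longleftrightarrow> i = a"
  using T.closed_piece_unique[of x a i] I_set_closed[of x i] subsetD[OF T_piece_subset_I_set, of x a] by blast

definition visits :: "nat set \<Rightarrow> real \<Rightarrow> nat \<Rightarrow> nat" where
  "visits S x n = card {k. k < n \<and> (\<exists>i\<in>S. (T_map ^^ k) x \<in> I_set i)}"

lemma visits_sum: "real (visits S x n) = (\<Sum>k<n. if \<exists>i\<in>S. (T_map ^^ k) x \<in> I_set i then 1 else 0)"
proof -
  have "{k. k < n \<and> (\<exists>i\<in>S. (T_map ^^ k) x \<in> I_set i)} = {..<n} \<inter> {k. \<exists>i\<in>S. (T_map ^^ k) x \<in> I_set i}"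
    by auto
  then show ?thesis
    unfolding visits_def by (simp add: sum.If_cases)
qed

text \<open>A set \<open>S\<close> of letters is needed since tank 2 will belong to two of the four
  intervals. The indicator of \<open>S\<close> minus its mean has sublinear sums along regular
  orbits, and dropping the \<open>m\<close> steps before the orbit becomes regular does not change
  the limit.\<close>

lemma T_frequency:
  assumes x: "x \<in> {0..lam_total}"
  shows "(\<lambda>n. real (visits S x n) / real n) \<longlonglongrightarrow> (\<Sum>i\<in>S \<inter> {1..4}. T_brk i - T_brk (i - 1)) / lam_total"
proof -
  define p where "p = (\<Sum>i\<in>S \<inter> {1..4}. T_brk i - T_brk (i - 1)) / lam_total"
  define g where "g a = (if a \<in> S then 1 else 0) - p" for a
  have "p * lam_total = (\<Sum>i\<in>S \<inter> {1..4}. T_brk i - T_brk (i - 1))"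
    using lam_total_pos by (simp add: p_def)
  also have "\<dots> = (\<Sum>i\<in>{1..4}. if i \<in> S then T_brk i - T_brk (i - 1) else 0)"
    by (subst Int_commute) (simp only: sum.inter_restrict finite_atLeastAtMost)
  finally have pl: "p * lam_total = (if 1 \<in> S then lam $ 1 else 0) + (if 2 \<in> S then lam $ 2 else 0) +
      (if 3 \<in> S then lam $ 3 else 0) + (if 4 \<in> S then lam $ 4 else 0)"
    unfolding atLeastAtMost_1_4 by (simp add: T_brk_def lam_total_def)
  have g: "g 1 * lam $ 1 + g 2 * lam $ 2 + g 3 * lam $ 3 + g 4 * lam $ 4 = 0"
    using pl by (simp add: g_def lam_total_def algebra_simps)
  obtain m where m: "regular T_map T.piece ((T_map ^^ m) x)"
    using eventually_regular[OF x] by blast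
  define z where "z = (T_map ^^ m) x"
  have reg: "birkhoff T_map T.piece g z n = real (visits S z n) - p * real n" for n
  proof -
    have "g (letter T.piece ((T_map ^^ k) z)) = (if \<exists>i\<in>S. (T_map ^^ k) z \<in> I_set i then 1 else 0) - p" for k
    proof -
      obtain a where a: "(T_map ^^ k) z \<in> T.piece a"
        using m by (auto simp: regular_def z_def)
      then show ?thesis
        using T_piece_I_set[OF a] letter_eq[OF T.disj a] by (auto simp: g_def)
    qed
    then show ?thesis
      by (simp add: birkhoff_def visits_sum sum_subtractf mult.commute)
  qed
  have "(\<lambda>n. (real (visits S z n) - p * real n) / real n) \<longlonglongrightarrow> 0"
    using T_birkhoff_small[OF g m] unfolding z_def[symmetric] reg .
  then have "(\<lambda>n. (real (visits S z n) - p * real n) / real n + p) \<longlonglongrightarrow> 0 + p"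
    by (rule tendsto_add[OF _ tendsto_const])
  moreover have "\<forall>\<^sub>F n in sequentially.
      (real (visits S z n) - p * real n) / real n + p = real (visits S z n) / real n"
    using eventually_gt_at_top[of 0] by eventually_elim (simp add: diff_divide_distrib)
  ultimately have lim: "(\<lambda>n. real (visits S z n) / real n) \<longlonglongrightarrow> p"
    by (simp add: Lim_transform_eventually)
  have split: "real (visits S x (n + m)) = real (visits S x m) + real (visits S z n)" for n
  proof -
    have "real (visits S x (m + n)) = real (visits S x m) +
        (\<Sum>k=m..<m+n. if \<exists>i\<in>S. (T_map ^^ k) x \<in> I_set i then 1 else 0)"
      unfolding visits_sum lessThan_atLeast0 by (simp add: sum.atLeastLessThan_concat)
    also have "(\<Sum>k=m..<m+n. if \<exists>i\<in>S. (T_map ^^ k) x \<in> I_set i then 1 else 0) =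
        (\<Sum>k=0..<n. if \<exists>i\<in>S. (T_map ^^ (k + m)) x \<in> I_set i then 1 else (0::real))"
      using sum.shift_bounds_nat_ivl[of "\<lambda>k. if \<exists>i\<in>S. (T_map ^^ k) x \<in> I_set i then 1 else (0::real)" 0 m n]
      by (simp add: add.commute)
    finally show ?thesis
      by (simp add: visits_sum[of S "(T_map ^^ m) x"] z_def funpow_add lessThan_atLeast0 add.commute)
  qed
  have "(\<lambda>n. 1 / real (n + m)) \<longlonglongrightarrow> 0"
    using LIMSEQ_ignore_initial_segment[OF lim_1_over_n] by simp
  then have "(\<lambda>n. real (visits S x m) * (1 / real (n + m)) +
      real (visits S z n) / real n * (1 - real m * (1 / real (n + m)))) \<longlonglongrightarrow>
      real (visits S x m) * 0 + p * (1 - real m * 0)"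
    by (intro tendsto_intros lim)
  then have "(\<lambda>n. real (visits S x m) * (1 / real (n + m)) +
      real (visits S z n) / real n * (1 - real m * (1 / real (n + m)))) \<longlonglongrightarrow> p"
    by simp
  moreover have "\<forall>\<^sub>F n in sequentially. real (visits S x m) * (1 / real (n + m)) +
      real (visits S z n) / real n * (1 - real m * (1 / real (n + m))) = real (visits S x (n + m)) / real (n + m)"
    using eventually_gt_at_top[of 0]
  proof eventually_elim
    case (elim n)
    then have "1 - real m * (1 / real (n + m)) = real n * (1 / real (n + m))"
      by (simp add: field_simps)
    with elim show ?case
      by (simp add: split add_divide_distrib)
  qed
  ultimately have "(\<lambda>n. real (visits S x (n + m)) / real (n + m)) \<longlonglongrightarrow> p"
    by (rule Lim_transform_eventually)
  then show ?thesis
    unfolding p_def[symmetric] by (rule LIMSEQ_offset)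
qed

section \<open>Geometric weights along orbits\<close>

definition mass :: "real \<Rightarrow> real set \<Rightarrow> real" where
  "mass p A = (\<Sum>\<^sub>\<infinity>k\<in>{k. (T_map ^^ k) p \<in> A}. 1 / 2 ^ k)"

lemma c_num_mass: "c_num i j = mass (p_pt j) (I_set i)"
  by (simp add: c_num_def K_set_def mass_def)

lemma half_powers_has_sum: "((\<lambda>k. 1 / 2 ^ k :: real) has_sum 2) UNIV"
proof -
  have "(\<lambda>k. (1 / 2) ^ k :: real) sums 2"
    using geometric_sums[of "1 / 2 :: real"] by simp
  then have "((\<lambda>k. (1 / 2) ^ k :: real) has_sum 2) UNIV"
    by (intro sums_nonneg_imp_has_sum) auto
  then show ?thesis
    by (simp add: power_one_over)
qed

lemma half_powers_summable: "(\<lambda>k. 1 / 2 ^ k :: real) summable_on A"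
  using half_powers_has_sum has_sum_imp_summable summable_on_subset_banach by blast

lemma mass_nonneg: "0 \<le> mass p A"
  unfolding mass_def by (intro infsum_nonneg) auto

lemma mass_mono: "A \<subseteq> B \<Longrightarrow> mass p A \<le> mass p B"
  unfolding mass_def by (intro infsum_mono_neutral half_powers_summable) auto

lemma mass_UNIV: "mass p UNIV = 2"
  unfolding mass_def using infsumI[OF half_powers_has_sum] by simp

lemma mass_le_2: "mass p A \<le> 2"
  using mass_mono[of A UNIV p] mass_UNIV by simp

lemma mass_Un: "A \<inter> B = {} \<Longrightarrow> mass p (A \<union> B) = mass p A + mass p B"
proof -
  assume "A \<inter> B = {}"
  then have "(\<Sum>\<^sub>\<infinity>k\<in>{k. (T_map ^^ k) p \<in> A} \<union> {k. (T_map ^^ k) p \<in> B}. 1 / 2 ^ k :: real) = mass p A + mass p B"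
    unfolding mass_def by (intro infsum_Un_disjoint half_powers_summable) auto
  moreover have "{k. (T_map ^^ k) p \<in> A} \<union> {k. (T_map ^^ k) p \<in> B} = {k. (T_map ^^ k) p \<in> A \<union> B}"
    by auto
  ultimately show ?thesis
    by (simp add: mass_def)
qed

lemma mass_step: "mass p A = (if p \<in> A then 1 else 0) + mass (T_map p) A / 2"
proof -
  define S where "S = {k. (T_map ^^ k) (T_map p) \<in> A}"
  have split: "{k. (T_map ^^ k) p \<in> A} = (if p \<in> A then {0} else {}) \<union> Suc ` S"
  proof (rule set_eqI)
    fix k
    show "k \<in> {k. (T_map ^^ k) p \<in> A} \<longleftrightarrow> k \<in> (if p \<in> A then {0} else {}) \<union> Suc ` S"
      by (cases k) (auto simp: S_def funpow_swap1)
  qed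
  have "mass p A = (\<Sum>\<^sub>\<infinity>k\<in>(if p \<in> A then {0} else {}). 1 / 2 ^ k) + (\<Sum>\<^sub>\<infinity>k\<in>Suc ` S. 1 / 2 ^ k)"
    unfolding mass_def split by (intro infsum_Un_disjoint half_powers_summable) auto
  also have "(\<Sum>\<^sub>\<infinity>k\<in>Suc ` S. 1 / 2 ^ k) = (\<Sum>\<^sub>\<infinity>k\<in>S. 1 / 2 ^ k * (1 / 2) :: real)"
    by (subst infsum_reindex) (auto simp: o_def mult.commute)
  also have "\<dots> = mass (T_map p) A / 2"
    unfolding mass_def S_def by (subst infsum_cmult_left') simp
  also have "(\<Sum>\<^sub>\<infinity>k\<in>(if p \<in> A then {0} else {}). 1 / 2 ^ k) = (if p \<in> A then 1 else (0 :: real))"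
    by simp
  finally show ?thesis .
qed

lemma mass_T: "mass (T_map p) A = mass p (T_map -` A)"
  by (simp add: mass_def funpow_swap1)

lemma mass_tail: "(\<And>k. k < N \<Longrightarrow> (T_map ^^ k) p \<notin> A) \<Longrightarrow> mass p A \<le> 2 / 2 ^ N"
proof (induction N arbitrary: p)
  case 0
  then show ?case using mass_le_2 by simp
next
  case (Suc N)
  have "(T_map ^^ k) (T_map p) \<notin> A" if "k < N" for k
    using Suc.prems[of "Suc k"] that by (simp add: funpow_swap1)
  from Suc.IH[OF this] Suc.prems[of 0] show ?case
    by (subst mass_step) simp
qed

lemma mass_atom: "(T_map ^^ k) p \<in> A \<Longrightarrow> 1 / 2 ^ k \<le> mass p A"
proof (induction k arbitrary: p)
  case 0
  then show ?case
    using mass_nonneg[of "T_map p" A] by (subst mass_step) simp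
next
  case (Suc k)
  then have "1 / 2 ^ k \<le> mass (T_map p) A"
    by (simp add: funpow_swap1)
  then show ?case
    by (subst mass_step) simp
qed

section \<open>Rigorous decimals for the weights c_ij from finite itineraries\<close>

primrec word_mass :: "nat \<Rightarrow> nat list \<Rightarrow> real" where
  "word_mass i [] = 0"
| "word_mass i (a # w) = (if i = a then 1 else 0) + word_mass i w / 2"

lemma mass_word:
  "follows T_map I_set w p z \<Longrightarrow> mass p (I_set i) = word_mass i w + mass z (I_set i) / 2 ^ length w"
proof (induction w arbitrary: p)
  case (Cons a w)
  then have "p \<in> I_set i \<longleftrightarrow> i = a"
    using I_set_disj by auto
  with Cons show ?case
    by (subst mass_step) (auto simp: add_divide_distrib)
qed auto

lemma follows_mono: "(\<And>a. P a \<subseteq> P' a) \<Longrightarrow> follows F P w x y \<Longrightarrow> follows F P' w x y"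
  by (auto simp: follows_def)

lemma follows_prefix: "follows F P (u @ v) x z \<Longrightarrow> \<exists>y. follows F P u x y"
  using follows_appendD by metis

text \<open>After \<open>u @ v\<close> the point \<open>q\<close> has become
  \<open>1 / eta * q\<close>, whose orbit is spelled by applying \<open>sig\<close> to the itinerary
  of \<open>q\<close>. So the prefix \<open>u\<close> prolongs the known itinerary by
  \<open>concat (map sig u)\<close>, and \<open>tau\<close> translates the result for
  \<open>T_map\<close>.\<close>

lemma self_similar_prefix:
  assumes "follows R_map R.piece (u @ v) q (1 / eta * q)"
  shows "\<exists>z. follows T_map I_set (concat (map tau (u @ v @ concat (map sig u)))) q z"
proof -
  obtain y where y: "follows R_map R.piece u q y"
    using follows_prefix[OF assms] by blast
  from renorm_word[OF RR.renorm y] follows_append[OF assms]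
  have "follows R_map R.piece (u @ v @ concat (map sig u)) q (1 / eta * y)"
    by simp
  from renorm_word[OF TR.renorm this, unfolded mult_1] show ?thesis
    using follows_mono[of T.piece I_set, OF T_piece_subset_I_set] by blast
qed

text \<open>A prefix \<open>u\<close> of three letters suffices: each of the three words has at
  least 44 letters, so the undetermined tail weighs at most 2 / 2^44, well below one unit of the
  twelfth decimal used in \<open>c_num_bounds\<close>.\<close>

definition w1 :: "nat list" where "w1 = concat (map tau ([1,4,2] @ [4,1,3] @ concat (map sig [1,4,2])))"
definition w2 :: "nat list" where "w2 = concat (map tau ([2,4,1] @ [3] @ concat (map sig [2,4,1])))"
definition w3 :: "nat list" where "w3 = concat (map tau ([4,1,2] @ [4,1,3] @ concat (map sig [4,1,2])))"

lemma p_pt_eq: "p_pt 1 = 0" "p_pt 2 = nu $ 3 + nu $ 4" "p_pt 3 = lam $ 1 + lam $ 3 + lam $ 4" "p_pt 4 = lam_total"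
  by (simp_all add: p_pt_def T_specials) (simp add: lam_entries)

lemma I_set_ends: "0 \<in> I_set 1" "lam_total \<in> I_set 4"
  using nu_bounds by (simp_all add: I_set_def lam_total_nu lam_entries)

lemma p_pt_words:
  "\<exists>z. follows T_map I_set (1 # w3) (p_pt 1) z" "\<exists>z. follows T_map I_set w2 (p_pt 2) z"
  "\<exists>z. follows T_map I_set (3 # w1) (p_pt 3) z" "\<exists>z. follows T_map I_set (4 # w3) (p_pt 4) z"
proof -
  have w: "\<exists>z. follows T_map I_set w1 (nu $ 3) z" "\<exists>z. follows T_map I_set w2 (nu $ 3 + nu $ 4) z"
    "\<exists>z. follows T_map I_set w3 (nu $ 1 + nu $ 3 + nu $ 4) z"
    unfolding w1_def w2_def w3_def
    by (rule self_similar_prefix; use R_self_similar in \<open>simp del: follows_Cons\<close>)+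
  have "lam $ 1 + lam $ 3 + lam $ 4 \<in> I_set 3"
    using nu_bounds by (simp add: I_set_def lam_entries)
  moreover have "lam $ 1 + lam $ 3 = nu $ 1 + nu $ 3 + nu $ 4"
    by (simp add: lam_entries)
  moreover note I_set_ends
  ultimately show "\<exists>z. follows T_map I_set (1 # w3) (p_pt 1) z" "\<exists>z. follows T_map I_set w2 (p_pt 2) z"
    "\<exists>z. follows T_map I_set (3 # w1) (p_pt 3) z" "\<exists>z. follows T_map I_set (4 # w3) (p_pt 4) z"
    using w unfolding p_pt_eq follows_Cons T_specials by simp_all
qed

text \<open>The unknown rest of the itinerary contributes at least 0 and at most the total 2 of all
  weights, divided by \<open>2 ^ length w\<close>.\<close>

lemma c_num_word:
  assumes "\<exists>z. follows T_map I_set w (p_pt j) z"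
  shows "word_mass i w \<le> c_num i j" "c_num i j \<le> word_mass i w + 2 / 2 ^ length w"
proof -
  obtain z where "follows T_map I_set w (p_pt j) z"
    using assms by blast
  from mass_word[OF this] show "word_mass i w \<le> c_num i j" "c_num i j \<le> word_mass i w + 2 / 2 ^ length w"
    using mass_nonneg[of z "I_set i"] mass_le_2[of z "I_set i"]
    by (auto simp: c_num_mass divide_right_mono)
qed

lemma c_num_bounds:
  "\<bar>c_num 1 1 - 1267643112952 / 1000000000000\<bar> \<le> 1 / 1000000000000" "\<bar>c_num 1 2 - 141147740455 / 1000000000000\<bar> \<le> 1 / 1000000000000"
  "\<bar>c_num 1 3 - 518100865448 / 1000000000000\<bar> \<le> 1 / 1000000000000"
  "\<bar>c_num 2 1 - 133332314094 / 1000000000000\<bar> \<le> 1 / 1000000000000" "\<bar>c_num 2 2 - 1066666664676 / 1000000000000\<bar> \<le> 1 / 1000000000000"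
  "\<bar>c_num 2 3 - 133072914680 / 1000000000000\<bar> \<le> 1 / 1000000000000"
  "\<bar>c_num 3 1 - 536264695768 / 1000000000000\<bar> \<le> 1 / 1000000000000" "\<bar>c_num 3 2 - 290109891984 / 1000000000000\<bar> \<le> 1 / 1000000000000"
  "\<bar>c_num 3 3 - 1286203641985 / 1000000000000\<bar> \<le> 1 / 1000000000000"
  using c_num_word[OF p_pt_words(1), of 1] c_num_word[OF p_pt_words(2), of 1] c_num_word[OF p_pt_words(3), of 1]
    c_num_word[OF p_pt_words(1), of 2] c_num_word[OF p_pt_words(2), of 2] c_num_word[OF p_pt_words(3), of 2]
    c_num_word[OF p_pt_words(1), of 3] c_num_word[OF p_pt_words(2), of 3] c_num_word[OF p_pt_words(3), of 3]
  unfolding abs_le_iff by (simp_all add: w1_def w2_def w3_def tau_def sig_def)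

lemmas c_num_bds =
  c_num_bounds[unfolded abs_le_iff, THEN conjunct1] c_num_bounds[unfolded abs_le_iff, THEN conjunct2]

text \<open>The points 0 and \<open>lam_total\<close> have the same image under
  \<open>T_map\<close>, so their series differ in the term k = 0 only.\<close>

lemma c_num_4: "c_num 1 4 = c_num 1 1 - 1" "c_num 2 4 = c_num 2 1" "c_num 3 4 = c_num 3 1" "c_num 4 4 = c_num 4 1 + 1"
proof -
  have "0 \<in> I_set i \<longleftrightarrow> i = 1" "lam_total \<in> I_set i \<longleftrightarrow> i = 4" for i
    using I_set_ends I_set_disj by blast+
  then have "mass 0 (I_set i) = (if i = 1 then 1 else 0) + mass (lam $ 1 + lam $ 3) (I_set i) / 2"
    "mass lam_total (I_set i) = (if i = 4 then 1 else 0) + mass (lam $ 1 + lam $ 3) (I_set i) / 2" for i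
    by (subst mass_step, simp add: T_specials)+
  then show "c_num 1 4 = c_num 1 1 - 1" "c_num 2 4 = c_num 2 1" "c_num 3 4 = c_num 3 1" "c_num 4 4 = c_num 4 1 + 1"
    unfolding c_num_mass p_pt_eq by simp_all
qed

section \<open>The numbers \<open>u\<close>\<close>

text \<open>The defining system of \<open>u_vec\<close> after \<open>c_num_4\<close>, which makes
  (1, 0, 0) the first column of \<open>M_mat\<close>; the entry 1 turns the factor 2 of the first
  equation into 3.\<close>

definition u_fixed :: "real \<Rightarrow> real \<Rightarrow> real \<Rightarrow> bool" where
  "u_fixed x y z \<longleftrightarrow>
     3 * x = c_num 1 1 * (1 - y - z) + c_num 1 2 * y + c_num 1 3 * z \<and>
     2 * y = c_num 2 1 * (1 - y - z) + c_num 2 2 * y + c_num 2 3 * z \<and>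
     2 * z = c_num 3 1 * (1 - y - z) + c_num 3 2 * y + c_num 3 3 * z"

lemma u_system:
  "u = (1/2) *\<^sub>R (M_mat *v (N_mat *v u)) + (1/2) *\<^sub>R (M_mat *v vector [1,0,0])
      + (1/2) *\<^sub>R vector [c_num 1 4, c_num 2 4, c_num 3 4]
   \<longleftrightarrow> u_fixed (u $ 1) (u $ 2) (u $ 3)"
  by (simp add: vec_eq_iff forall_3 matrix_vector_mult_def sum_3 M_mat_def N_mat_def c_num_4 u_fixed_def
      field_simps del: One_nat_def)

lemma linear_system_2:
  fixes a b c d :: real
  assumes "a * d - b * c \<noteq> 0"
  shows "a * y + b * z = p \<and> c * y + d * z = q \<longleftrightarrow>
    y = (p * d - b * q) / (a * d - b * c) \<and> z = (a * q - c * p) / (a * d - b * c)" (is "?L \<longleftrightarrow> ?R")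
proof
  assume ?L
  then have "(a * d - b * c) * y = p * d - b * q" "(a * d - b * c) * z = a * q - c * p"
    by (auto simp: algebra_simps)
  with assms show ?R
    by (auto simp: nonzero_eq_divide_eq mult.commute)
next
  assume R: ?R
  have "a * (p * d - b * q) + b * (a * q - c * p) = (a * d - b * c) * p"
    "c * (p * d - b * q) + d * (a * q - c * p) = (a * d - b * c) * q"
    by (auto simp: algebra_simps)
  with assms R show ?L
    by (simp add: add_divide_distrib[symmetric])
qed

context
  fixes a b c d :: real
  defines a: "a \<equiv> 2 + c_num 2 1 - c_num 2 2" and b: "b \<equiv> c_num 2 1 - c_num 2 3"
    and c: "c \<equiv> c_num 3 1 - c_num 3 2" and d: "d \<equiv> 2 + c_num 3 1 - c_num 3 3"
begin

lemma u_fixed_linear: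
  "u_fixed x y z \<longleftrightarrow> 3 * x = c_num 1 1 * (1 - y - z) + c_num 1 2 * y + c_num 1 3 * z \<and>
     a * y + b * z = c_num 2 1 \<and> c * y + d * z = c_num 3 1"
  by (auto simp: u_fixed_def a b c d algebra_simps)

lemma abcd: "1 \<le> a" "a \<le> 2" "\<bar>b\<bar> \<le> 1 / 1000" "\<bar>c\<bar> \<le> 1" "1 \<le> d" "d \<le> 2" "9 / 10 \<le> a * d - b * c"
proof -
  show 1: "1 \<le> a" "a \<le> 2" "\<bar>b\<bar> \<le> 1 / 1000" "\<bar>c\<bar> \<le> 1" "1 \<le> d" "d \<le> 2"
    using c_num_bds unfolding abs_le_iff a b c d by auto
  have "1 * 1 \<le> a * d"
    using 1 by (intro mult_mono) auto
  moreover have "\<bar>b * c\<bar> \<le> 1 / 1000 * 1"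
    unfolding abs_mult using 1 by (intro mult_mono) auto
  ultimately show "9 / 10 \<le> a * d - b * c"
    by (simp add: abs_le_iff)
qed

lemma u_fixed_ex1: "\<exists>x y z. u_fixed x y z"
  "u_fixed x y z \<Longrightarrow> u_fixed x' y' z' \<Longrightarrow> x = x' \<and> y = y' \<and> z = z'"
proof -
  have D: "a * d - b * c \<noteq> 0"
    using abcd(7) by auto
  define y0 z0 where "y0 = (c_num 2 1 * d - b * c_num 3 1) / (a * d - b * c)"
    and "z0 = (a * c_num 3 1 - c * c_num 2 1) / (a * d - b * c)"
  show "\<exists>x y z. u_fixed x y z"
    unfolding u_fixed_linear linear_system_2[OF D] y0_def[symmetric] z0_def[symmetric]
    by (rule exI[of _ "(c_num 1 1 * (1 - y0 - z0) + c_num 1 2 * y0 + c_num 1 3 * z0) / 3"],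
        rule exI[of _ y0], rule exI[of _ z0]) simp
  show "x = x' \<and> y = y' \<and> z = z'" if "u_fixed x y z" "u_fixed x' y' z'"
    using that unfolding u_fixed_linear linear_system_2[OF D] by auto
qed

text \<open>Residual estimate: the decimals solve the equations for y and z up to 10^(-11), and
  Cramer's rule with determinant at least 9/10 turns this into a bound for the error. The first
  equation then bounds the error of x.\<close>

lemma u_fixed_bounds:
  assumes "u_fixed x y z"
  shows "\<bar>x - 27461032978 / 100000000000\<bar> \<le> 1 / 10000000000" "\<bar>y - 12490081973 / 100000000000\<bar> \<le> 1 / 10000000000"
    "\<bar>z - 40439605527 / 100000000000\<bar> \<le> 1 / 10000000000"
proof -
  define y0 z0 :: real where "y0 = 12490081973 / 100000000000" and "z0 = 40439605527 / 100000000000"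
  define e f where "e = y - y0" and "f = z - z0"
  define r s where "r = c_num 2 1 - a * y0 - b * z0" and "s = c_num 3 1 - c * y0 - d * z0"
  have rs: "\<bar>r\<bar> \<le> 1 / 100000000000" "\<bar>s\<bar> \<le> 1 / 100000000000"
    using c_num_bds unfolding abs_le_iff r_def s_def y0_def z0_def a b c d left_diff_distrib distrib_right
    by (intro conjI; linarith)+
  have "a * e + b * f = r" "c * e + d * f = s"
    using assms unfolding u_fixed_linear by (auto simp: e_def f_def r_def s_def algebra_simps)
  then have De: "(a * d - b * c) * e = d * r - b * s" and Df: "(a * d - b * c) * f = a * s - c * r"
    by (auto simp: algebra_simps)
  have small: "\<bar>t\<bar> \<le> 4 / 100000000000" if t: "(a * d - b * c) * t = p * u - q * v"
      and p: "\<bar>p\<bar> \<le> 2" "\<bar>q\<bar> \<le> 1" "\<bar>u\<bar> \<le> 1 / 100000000000" "\<bar>v\<bar> \<le> 1 / 100000000000" for t p q u v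
  proof -
    have "9 / 10 * \<bar>t\<bar> \<le> (a * d - b * c) * \<bar>t\<bar>"
      using abcd(7) by (intro mult_right_mono) auto
    also have "\<dots> = \<bar>p * u - q * v\<bar>"
      unfolding t[symmetric] abs_mult using abcd(7) by simp
    also have "\<dots> \<le> \<bar>p\<bar> * \<bar>u\<bar> + \<bar>q\<bar> * \<bar>v\<bar>"
      unfolding abs_mult[symmetric] by (rule abs_triangle_ineq4)
    also have "\<dots> \<le> 2 * (1 / 100000000000) + 1 * (1 / 100000000000)"
      using p by (intro add_mono mult_mono) auto
    finally show ?thesis
      by simp
  qed
  have ef: "\<bar>e\<bar> \<le> 4 / 100000000000" "\<bar>f\<bar> \<le> 4 / 100000000000"
    by (rule small[OF De]; use abcd rs in simp) (rule small[OF Df]; use abcd rs in simp)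
  then show "\<bar>y - 12490081973 / 100000000000\<bar> \<le> 1 / 10000000000" "\<bar>z - 40439605527 / 100000000000\<bar> \<le> 1 / 10000000000"
    by (simp_all add: e_def f_def y0_def z0_def)
  define t where "t = 3 * (27461032978 / 100000000000) - (c_num 1 1 * (1 - y0 - z0) + c_num 1 2 * y0 + c_num 1 3 * z0)"
  have t: "\<bar>t\<bar> \<le> 3 / 100000000000"
    using c_num_bds unfolding abs_le_iff t_def y0_def z0_def right_diff_distrib distrib_left
    by (intro conjI; linarith)
  have x: "3 * (x - 27461032978 / 100000000000) = (c_num 1 2 - c_num 1 1) * e + (c_num 1 3 - c_num 1 1) * f - t"
    using assms unfolding u_fixed_linear t_def e_def f_def by (simp add: algebra_simps)
  have "\<bar>(c_num 1 2 - c_num 1 1) * e\<bar> \<le> 2 * (4 / 100000000000)" "\<bar>(c_num 1 3 - c_num 1 1) * f\<bar> \<le> 1 * (4 / 100000000000)"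
    unfolding abs_mult using c_num_bds ef by (intro mult_mono; auto simp: abs_le_iff)+
  with t have "\<bar>3 * (x - 27461032978 / 100000000000)\<bar> \<le> 3 / 10000000000"
    unfolding x abs_le_iff by auto
  then show "\<bar>x - 27461032978 / 100000000000\<bar> \<le> 1 / 10000000000"
    unfolding abs_le_iff by auto
qed

end

lemma u_vec_fixed: "u_fixed (u_vec $ 1) (u_vec $ 2) (u_vec $ 3)"
proof -
  obtain x y z where u: "u_fixed x y z"
    using u_fixed_ex1(1) by blast
  have "u_vec = vector [x, y, z]"
    unfolding u_vec_def u_system
    by (rule the_equality) (use u u_fixed_ex1(2) in \<open>auto simp: vec_eq_iff forall_3\<close>)
  from arg_cong[OF this, of "\<lambda>v. u_fixed (v $ 1) (v $ 2) (v $ 3)"] u show ?thesis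
    by simp
qed

lemma u_bounds:
  "\<bar>u_vec $ 1 - 27461032978 / 100000000000\<bar> \<le> 1 / 10000000000" "\<bar>u_vec $ 2 - 12490081973 / 100000000000\<bar> \<le> 1 / 10000000000"
  "\<bar>u_vec $ 3 - 40439605527 / 100000000000\<bar> \<le> 1 / 10000000000"
  using u_fixed_bounds[OF u_vec_fixed] by auto

lemma z_bounds:
  "\<bar>z1 - 27461032978 / 100000000000\<bar> \<le> 1 / 1000000000" "\<bar>z2 - 39951114951 / 100000000000\<bar> \<le> 1 / 1000000000" "\<bar>z3 - 80390720478 / 100000000000\<bar> \<le> 1 / 1000000000"
  using u_bounds unfolding z1_def z2_def z3_def abs_le_iff by simp_all

lemma d_bounds:
  "\<bar>1 / (3 * z1) - 1 - 0.213841\<bar> \<le> 0.0000005" "\<bar>(2 - 3 * z2) / (3 * z2 - 1) - 4.036935\<bar> \<le> 0.0000005"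
  "\<bar>(3 - 3 * z3) / (3 * z3 - 2) - 1.428826\<bar> \<le> 0.0000005"
proof -
  have z: "0.274610328 \<le> z1" "z1 \<le> 0.274610331" "0.399511148 \<le> z2" "z2 \<le> 0.399511151"
    "0.803907203 \<le> z3" "z3 \<le> 0.803907206"
    using z_bounds unfolding abs_le_iff by simp_all
  show "\<bar>1 / (3 * z1) - 1 - 0.213841\<bar> \<le> 0.0000005"
  proof -
    have "1 / (3 * z1) \<le> 1.2138415" "1.2138405 \<le> 1 / (3 * z1)"
      using z by (simp_all add: pos_divide_le_eq pos_le_divide_eq)
    then show ?thesis
      unfolding abs_le_iff by simp
  qed
  show "\<bar>(2 - 3 * z2) / (3 * z2 - 1) - 4.036935\<bar> \<le> 0.0000005"
  proof -
    have "(2 - 3 * z2) / (3 * z2 - 1) \<le> 4.0369355" "4.0369345 \<le> (2 - 3 * z2) / (3 * z2 - 1)"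
      using z z_bounds by (simp_all add: pos_divide_le_eq pos_le_divide_eq abs_le_iff)
    then show ?thesis
      unfolding abs_le_iff by simp
  qed
  show "\<bar>(3 - 3 * z3) / (3 * z3 - 2) - 1.428826\<bar> \<le> 0.0000005"
  proof -
    have "(3 - 3 * z3) / (3 * z3 - 2) \<le> 1.4288265" "1.4288255 \<le> (3 - 3 * z3) / (3 * z3 - 2)"
      using z by (simp_all add: pos_divide_le_eq pos_le_divide_eq)
    then show ?thesis
      unfolding abs_le_iff by simp
  qed
qed

section \<open>The semiconjugacy\<close>

abbreviation brk2 :: real where "brk2 \<equiv> lam $ 1 + lam $ 2"
abbreviation brk3 :: real where "brk3 \<equiv> lam $ 1 + lam $ 2 + lam $ 3"
abbreviation top4 :: real where "top4 \<equiv> lam $ 1 + lam $ 3 + lam $ 4"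

definition mu :: "real set \<Rightarrow> real" where
  "mu A = ((1 - z3) * mass (p_pt 1) A + (z2 - z1) * mass (p_pt 2) A + (z3 - z2) * mass (p_pt 3) A
     + z1 * mass (p_pt 4) A) / 2"

lemma z_order: "0 < z1" "z1 < 1 / 3" "1 / 3 < z2" "z2 < 2 / 3" "2 / 3 < z3" "z3 < 1"
  using z_bounds unfolding abs_le_iff by simp_all

lemma weights_pos: "0 < z1" "0 < z2 - z1" "0 < z3 - z2" "0 < 1 - z3"
  using z_order by auto

lemma p_pt_range: "j \<in> {1..4} \<Longrightarrow> p_pt j \<in> {0..lam_total}"
  using nu_bounds unfolding atLeastAtMost_1_4
  by (elim insertE) (simp_all add: p_pt_eq lam_total_nu lam_entries del: One_nat_def)

lemma mass_range: "p \<in> {0..lam_total} \<Longrightarrow> mass p (A \<inter> {0..lam_total}) = mass p A"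
  unfolding mass_def using T_iter_range[of p] by (intro arg_cong2[where f = infsum] refl) auto

lemma mu_nonneg: "0 \<le> mu A"
  unfolding mu_def using weights_pos by (intro divide_nonneg_pos add_nonneg_nonneg mult_nonneg_nonneg mass_nonneg) auto

lemma mu_mono: "A \<subseteq> B \<Longrightarrow> mu A \<le> mu B"
  unfolding mu_def using weights_pos
  by (intro divide_right_mono add_mono mult_left_mono mass_mono) auto

lemma mu_Un: "A \<inter> B = {} \<Longrightarrow> mu (A \<union> B) = mu A + mu B"
  unfolding mu_def by (simp add: mass_Un algebra_simps add_divide_distrib diff_divide_distrib)

lemma mu_UNIV: "mu UNIV = 1"
  by (simp add: mu_def mass_UNIV)

lemma mu_range: "mu (A \<inter> {0..lam_total}) = mu A"
  unfolding mu_def using p_pt_range by (simp add: mass_range)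

lemma mu_subset: "A \<inter> {0..lam_total} \<subseteq> B \<Longrightarrow> mu A \<le> mu B"
  using mu_mono mu_range by metis

text \<open>The fixed-point equation of \<open>mu\<close>: half of it consists of the point masses
  at the p_j, the other half is its image under \<open>T_map\<close>. This mirrors
  \<open>f_map\<close>, whose branches halve lengths.\<close>

lemma mu_step:
  "mu A = ((if p_pt 1 \<in> A then 1 - z3 else 0) + (if p_pt 2 \<in> A then z2 - z1 else 0)
     + (if p_pt 3 \<in> A then z3 - z2 else 0) + (if p_pt 4 \<in> A then z1 else 0)) / 2 + mu (T_map -` A) / 2"
proof -
  have "mass p A = (if p \<in> A then 1 else 0) + mass p (T_map -` A) / 2" for p
    by (subst mass_step) (simp add: mass_T)
  then show ?thesis
    unfolding mu_def by (simp add: algebra_simps add_divide_distrib diff_divide_distrib)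
qed

lemma mu_pos: "p_pt j \<in> A \<Longrightarrow> j \<in> {1..4} \<Longrightarrow> 0 < mu A"
  using weights_pos mu_nonneg[of "T_map -` A"] unfolding atLeastAtMost_1_4
  by (subst mu_step, elim insertE) (auto intro!: add_pos_nonneg)

lemma mu_Icc: "mu {0..lam_total} = 1"
  using mu_range[of UNIV] mu_UNIV by simp

text \<open>The first three values are the equations \<open>u_fixed\<close>, row by row; the fourth
  follows because the total mass is 1.\<close>

lemma mu_I_set: "mu (I_set 1) = z1" "mu (I_set 2) = z2 - z1" "mu (I_set 3) = z3 - z2" "mu (I_set 4) = 1 - z3"
proof -
  note u = u_vec_fixed[unfolded u_fixed_def]
  have z: "u_vec $ 1 = z1" "u_vec $ 2 = z2 - z1" "u_vec $ 3 = z3 - z2"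
    by (simp_all add: z1_def z2_def z3_def)
  have e: "3 * z1 = c_num 1 1 * (1 - (z2 - z1) - (z3 - z2)) + c_num 1 2 * (z2 - z1) + c_num 1 3 * (z3 - z2)"
    "2 * (z2 - z1) = c_num 2 1 * (1 - (z2 - z1) - (z3 - z2)) + c_num 2 2 * (z2 - z1) + c_num 2 3 * (z3 - z2)"
    "2 * (z3 - z2) = c_num 3 1 * (1 - (z2 - z1) - (z3 - z2)) + c_num 3 2 * (z2 - z1) + c_num 3 3 * (z3 - z2)"
    using u unfolding z by blast+
  have "(1 - z3) * c_num 1 1 + (z2 - z1) * c_num 1 2 + (z3 - z2) * c_num 1 3 + z1 * (c_num 1 1 - 1) = 3 * z1 - z1"
    by (subst e(1)) (simp add: algebra_simps)
  moreover have "(1 - z3) * c_num 2 1 + (z2 - z1) * c_num 2 2 + (z3 - z2) * c_num 2 3 + z1 * c_num 2 1 = 2 * (z2 - z1)"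
    by (subst e(2)) (simp add: algebra_simps)
  moreover have "(1 - z3) * c_num 3 1 + (z2 - z1) * c_num 3 2 + (z3 - z2) * c_num 3 3 + z1 * c_num 3 1 = 2 * (z3 - z2)"
    by (subst e(3)) (simp add: algebra_simps)
  ultimately show 1: "mu (I_set 1) = z1" "mu (I_set 2) = z2 - z1" "mu (I_set 3) = z3 - z2"
    unfolding mu_def c_num_mass[symmetric] c_num_4 by simp_all
  have "I_set 1 \<inter> I_set 2 = {}" "(I_set 1 \<union> I_set 2) \<inter> I_set 3 = {}" "(I_set 1 \<union> I_set 2 \<union> I_set 3) \<inter> I_set 4 = {}"
    using I_set_disj[of _ 1 2] I_set_disj[of _ 1 3] I_set_disj[of _ 2 3] I_set_disj[of _ 1 4]
      I_set_disj[of _ 2 4] I_set_disj[of _ 3 4] by auto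
  then have "mu (I_set 1 \<union> I_set 2 \<union> I_set 3 \<union> I_set 4) = mu (I_set 1) + mu (I_set 2) + mu (I_set 3) + mu (I_set 4)"
    by (simp add: mu_Un)
  moreover have "I_set 1 \<union> I_set 2 \<union> I_set 3 \<union> I_set 4 = {0..lam_total}"
    using lam_pos by (auto simp: I_set_def lam_total_def)
  ultimately show "mu (I_set 4) = 1 - z3"
    using 1 mu_Icc by simp
qed

section \<open>Distribution functions of the measure and their quantile function\<close>

definition Gm :: "real \<Rightarrow> real" where "Gm x = mu {..<x}"
definition Gp :: "real \<Rightarrow> real" where "Gp x = mu {..x}"

lemma Gm_le_Gp: "Gm x \<le> Gp x"
  unfolding Gm_def Gp_def by (intro mu_mono) auto

lemma mu_open: "x < y \<Longrightarrow> mu {x<..<y} = Gm y - Gp x"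
proof -
  assume "x < y"
  then have "{..<y} = {..x} \<union> {x<..<y}" "{..x} \<inter> {x<..<y} = {}"
    by auto
  then show ?thesis
    unfolding Gm_def Gp_def by (simp add: mu_Un)
qed

lemma mu_Ico: "x \<le> y \<Longrightarrow> mu {x..<y} = Gm y - Gm x"
proof -
  assume "x \<le> y"
  then have "{..<y} = {..<x} \<union> {x..<y}" "{..<x} \<inter> {x..<y} = {}"
    by auto
  then show ?thesis
    unfolding Gm_def by (simp add: mu_Un)
qed

lemma mu_Ioi: "mu {x<..} = 1 - Gp x" and mu_Ici: "mu {x..} = 1 - Gm x"
proof -
  have "{..x} \<union> {x<..} = UNIV" "{..x} \<inter> {x<..} = {}" "{..<x} \<union> {x..} = UNIV" "{..<x} \<inter> {x..} = {}"
    by auto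
  then show "mu {x<..} = 1 - Gp x" "mu {x..} = 1 - Gm x"
    using mu_Un[of "{..x}" "{x<..}"] mu_Un[of "{..<x}" "{x..}"] mu_UNIV by (simp_all add: Gm_def Gp_def)
qed

lemma Gm_range: "0 \<le> Gm x" "Gm x \<le> 1"
  unfolding Gm_def using mu_nonneg mu_mono[of "{..<x}" UNIV] mu_UNIV by auto

lemma Gp_range: "0 \<le> Gp x" "Gp x \<le> 1"
  unfolding Gp_def using mu_nonneg mu_mono[of "{..x}" UNIV] mu_UNIV by auto

lemma Gm_mono: "x \<le> y \<Longrightarrow> Gm x \<le> Gm y"
  unfolding Gm_def by (intro mu_mono) auto

lemma Gm_0: "Gm 0 = 0"
proof -
  have "{..<0} \<inter> {0..lam_total} = {}"
    by auto
  moreover have "mu {} = 0"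
    by (simp add: mu_def mass_def)
  ultimately show ?thesis
    using mu_range[of "{..<0}"] by (simp add: Gm_def)
qed

lemma Gp_lam_total: "Gp lam_total = 1"
proof -
  have "{..lam_total} \<inter> {0..lam_total} = {0..lam_total}"
    by auto
  then show ?thesis
    using mu_range[of "{..lam_total}"] mu_Icc by (simp add: Gp_def)
qed

text \<open>The orbit of p_1 is dense and each of its points carries positive mass.\<close>

lemma mu_interval_pos:
  assumes "0 \<le> x" "x < y" "y \<le> lam_total"
  shows "0 < mu {x<..<y}"
proof -
  have "\<exists>k\<ge>0. (T_map ^^ k) (p_pt 1) \<in> {x<..<y}"
    using assms p_pt_range[of 1] by (intro T_dense) auto
  then obtain k where "(T_map ^^ k) (p_pt 1) \<in> {x<..<y}"
    by blast
  then have "0 < mass (p_pt 1) {x<..<y}"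
    using mass_atom by (metis less_le_trans zero_less_divide_1_iff zero_less_numeral zero_less_power)
  then show ?thesis
    unfolding mu_def using weights_pos mass_nonneg
    by (intro divide_pos_pos add_pos_nonneg mult_pos_pos mult_nonneg_nonneg) auto
qed

lemma Gp_less_Gm: "0 \<le> x \<Longrightarrow> x < y \<Longrightarrow> y \<le> lam_total \<Longrightarrow> Gp x < Gm y"
  using mu_interval_pos[of x y] mu_open[of x y] by auto

text \<open>From step \<open>N\<close> on, the weights add up to at most \<open>2 / 2 ^ N\<close>,
  and a small punctured neighbourhood of \<open>x\<close> avoids the first \<open>N\<close> orbit
  points. The centre is removed since it may be an atom.\<close>

lemma mass_small:
  assumes "0 < e"
  shows "\<exists>d>0. mass p ({x - d<..<x + d} - {x}) < e"
proof -
  obtain N where "(1 / 2) ^ N < e / 2"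
    using real_arch_pow_inv[of "e / 2" "1 / 2"] assms by auto
  then have N: "2 / 2 ^ N < e"
    by (simp add: power_one_over field_simps)
  have "finite ((\<lambda>k. (T_map ^^ k) p) ` {..<N})"
    by simp
  from finite_set_avoid[OF this, of x] obtain d where d: "0 < d"
    "\<forall>y\<in>(\<lambda>k. (T_map ^^ k) p) ` {..<N}. y \<noteq> x \<longrightarrow> d \<le> dist x y"
    by blast
  have "mass p ({x - d<..<x + d} - {x}) \<le> 2 / 2 ^ N"
  proof (rule mass_tail)
    fix k assume "k < N"
    then show "(T_map ^^ k) p \<notin> {x - d<..<x + d} - {x}"
      using d(2) by (force simp: dist_real_def)
  qed
  with N d(1) show ?thesis
    by (intro exI[of _ d]) auto
qed

lemma mu_small:
  assumes "0 < e"
  shows "\<exists>d>0. mu ({x - d<..<x + d} - {x}) < e"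
proof -
  have "\<forall>j. \<exists>d. 0 < d \<and> mass (p_pt j) ({x - d<..<x + d} - {x}) < e"
    using mass_small[OF assms] by blast
  then obtain d where d: "\<And>j. 0 < d j \<and> mass (p_pt j) ({x - d j<..<x + d j} - {x}) < e"
    by metis
  define D where "D = Min (d ` {1..4})"
  have D: "0 < D" "j \<in> {1..4} \<Longrightarrow> D \<le> d j" for j
    using d by (auto simp: D_def)
  have "mass (p_pt j) ({x - D<..<x + D} - {x}) \<le> e" if "j \<in> {1..4}" for j
  proof -
    have "mass (p_pt j) ({x - D<..<x + D} - {x}) \<le> mass (p_pt j) ({x - d j<..<x + d j} - {x})"
      using D(2)[OF that] by (intro mass_mono) auto
    then show ?thesis
      using d[of j] by linarith
  qed
  then have "mu ({x - D<..<x + D} - {x}) \<le> ((1 - z3) * e + (z2 - z1) * e + (z3 - z2) * e + z1 * e) / 2"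
    unfolding mu_def using weights_pos
    by (intro divide_right_mono add_mono mult_left_mono) auto
  also have "\<dots> < e"
    using assms by (simp add: algebra_simps)
  finally show ?thesis
    using D(1) by blast
qed

text \<open>The supremum of the points with \<open>Gm x \<le> t\<close> works: left continuity of
  \<open>Gm\<close> gives one inequality, right continuity of \<open>Gp\<close> the other. Both
  continuities are instances of \<open>mu_small\<close>.\<close>

lemma quantile_ex:
  assumes t: "0 \<le> t" "t \<le> 1"
  shows "\<exists>x\<in>{0..lam_total}. Gm x \<le> t \<and> t \<le> Gp x"
proof -
  define S where "S = {x \<in> {0..lam_total}. Gm x \<le> t}"
  define s where "s = Sup S"
  have S0: "0 \<in> S"
    using t lam_total_pos by (simp add: S_def Gm_0)
  have bdd: "bdd_above S"
    by (rule bdd_aboveI[of _ lam_total]) (simp add: S_def)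
  have s: "0 \<le> s" "s \<le> lam_total"
    unfolding s_def using S0 by (intro cSup_upper[OF S0 bdd] cSup_least; auto simp: S_def)+
  have "Gm s \<le> t"
  proof (rule ccontr)
    assume "\<not> Gm s \<le> t"
    then have "0 < Gm s - t"
      by simp
    from mu_small[OF this, of s] obtain d where d: "0 < d" "mu ({s - d<..<s + d} - {s}) < Gm s - t"
      by blast
    have "s - d < Sup S"
      using d(1) by (simp add: s_def)
    then obtain x where x: "x \<in> S" "s - d < x"
      using less_cSup_iff[OF _ bdd] S0 by blast
    have "x \<le> s"
      using cSup_upper[OF x(1) bdd] by (simp add: s_def)
    moreover have "x \<noteq> s"
      using x(1) \<open>\<not> Gm s \<le> t\<close> by (auto simp: S_def)
    ultimately have "mu {x..<s} \<le> mu ({s - d<..<s + d} - {s})"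
      using x(2) d(1) by (intro mu_mono) auto
    then show False
      using d(2) mu_Ico[OF \<open>x \<le> s\<close>] x(1) by (auto simp: S_def)
  qed
  moreover have "t \<le> Gp s"
  proof (rule ccontr)
    assume n: "\<not> t \<le> Gp s"
    then have "0 < t - Gp s"
      by simp
    from mu_small[OF this, of s] obtain d where d: "0 < d" "mu ({s - d<..<s + d} - {s}) < t - Gp s"
      by blast
    have "s \<noteq> lam_total"
      using n t Gp_lam_total by auto
    define x where "x = min lam_total (s + d)"
    have x: "s < x" "x \<le> lam_total" "x \<le> s + d"
      using s \<open>s \<noteq> lam_total\<close> d(1) by (auto simp: x_def)
    have "mu {s<..<x} \<le> mu ({s - d<..<s + d} - {s})"
      using x d(1) by (intro mu_mono) auto
    then have "x \<in> S"
      using d(2) mu_open[OF x(1)] x s by (auto simp: S_def)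
    then show False
      using cSup_upper[OF _ bdd, of x] x(1) by (auto simp: s_def)
  qed
  ultimately show ?thesis
    using s by auto
qed

text \<open>Generalized inverse of the distribution function. Atoms of \<open>mu\<close> become
  plateaus of \<open>hh\<close>, and \<open>hh\<close> has no jumps because \<open>mu\<close>
  charges every open interval.\<close>

definition hh :: "real \<Rightarrow> real" where
  "hh t = (THE x. x \<in> {0..lam_total} \<and> Gm x \<le> t \<and> t \<le> Gp x)"

lemma hh_unique:
  assumes "x \<in> {0..lam_total}" "Gm x \<le> t" "t \<le> Gp x" "y \<in> {0..lam_total}" "Gm y \<le> t" "t \<le> Gp y"
  shows "x = y"
  using Gp_less_Gm[of x y] Gp_less_Gm[of y x] assms by (cases x y rule: linorder_cases) auto

lemma hh_eq: "x \<in> {0..lam_total} \<Longrightarrow> Gm x \<le> t \<Longrightarrow> t \<le> Gp x \<Longrightarrow> hh t = x"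
  unfolding hh_def by (rule the_equality) (use hh_unique in blast)+

lemma hh_props:
  assumes "t \<in> {0..1}"
  shows "hh t \<in> {0..lam_total}" "Gm (hh t) \<le> t" "t \<le> Gp (hh t)"
proof -
  obtain x where "x \<in> {0..lam_total}" "Gm x \<le> t" "t \<le> Gp x"
    using quantile_ex[of t] assms by auto
  with hh_eq show "hh t \<in> {0..lam_total}" "Gm (hh t) \<le> t" "t \<le> Gp (hh t)"
    by auto
qed

lemma hh_mono: "s \<in> {0..1} \<Longrightarrow> t \<in> {0..1} \<Longrightarrow> s \<le> t \<Longrightarrow> hh s \<le> hh t"
  using Gp_less_Gm[of "hh t" "hh s"] hh_props[of s] hh_props[of t] by (cases "hh s \<le> hh t") auto

lemma hh_Gm: "x \<in> {0..lam_total} \<Longrightarrow> hh (Gm x) = x"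
  by (rule hh_eq) (auto simp: Gm_le_Gp)

lemma hh_Gp: "x \<in> {0..lam_total} \<Longrightarrow> hh (Gp x) = x"
  by (rule hh_eq) (auto simp: Gm_le_Gp)

lemma hh_image: "hh ` {0..1} = {0..lam_total}"
proof
  show "hh ` {0..1} \<subseteq> {0..lam_total}"
    using hh_props by blast
  show "{0..lam_total} \<subseteq> hh ` {0..1}"
    using hh_Gm Gm_range by (metis atLeastAtMost_iff image_eqI subsetI)
qed

lemma hh_less: "s \<in> {0..1} \<Longrightarrow> t \<in> {0..1} \<Longrightarrow> hh s < hh t \<Longrightarrow> s < t"
  using hh_mono[of t s] by force

text \<open>If \<open>a < hh t\<close>, then \<open>Gp a < t\<close>, so \<open>hh\<close> is at
  least \<open>a\<close> on a neighbourhood of \<open>t\<close>; the bound from above is symmetric,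
  with \<open>Gm b\<close>. At the ends of the range one of the bounds is automatic.\<close>

lemma hh_continuous: "continuous_on {0..1} hh"
  unfolding continuous_on_iff
proof (intro ballI allI impI)
  fix t e :: real assume t: "t \<in> {0..1}" and e: "0 < e"
  define a where "a = max 0 (hh t - e / 2)"
  define b where "b = min lam_total (hh t + e / 2)"
  have ab: "a \<in> {0..lam_total}" "b \<in> {0..lam_total}"
    using hh_props(1)[OF t] e lam_total_pos by (auto simp: a_def b_def)
  have lo: "\<exists>d>0. \<forall>s\<in>{0..1}. \<bar>s - t\<bar> < d \<longrightarrow> hh t - e < hh s"
  proof (cases "hh t = 0")
    case True
    then show ?thesis
      using hh_props(1) e by (intro exI[of _ 1]) force
  next
    case False
    then have "a < hh t"
      using hh_props(1)[OF t] e by (auto simp: a_def)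
    then have "Gp a < t"
      using Gp_less_Gm[of a "hh t"] hh_props[OF t] ab by auto
    moreover have "hh t - e < hh s" if "s \<in> {0..1}" "\<bar>s - t\<bar> < t - Gp a" for s
    proof -
      have "a \<le> hh s"
        using hh_mono[of "Gp a" s] hh_Gp[OF ab(1)] that Gp_range[of a] by auto
      then show ?thesis
        using e by (auto simp: a_def)
    qed
    ultimately show ?thesis
      by (intro exI[of _ "t - Gp a"]) auto
  qed
  have hi: "\<exists>d>0. \<forall>s\<in>{0..1}. \<bar>s - t\<bar> < d \<longrightarrow> hh s < hh t + e"
  proof (cases "hh t = lam_total")
    case True
    then show ?thesis
      using hh_props(1) e by (intro exI[of _ 1]) force
  next
    case False
    then have "hh t < b"
      using hh_props(1)[OF t] e by (auto simp: b_def)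
    then have "t < Gm b"
      using Gp_less_Gm[of "hh t" b] hh_props[OF t] ab by auto
    moreover have "hh s < hh t + e" if "s \<in> {0..1}" "\<bar>s - t\<bar> < Gm b - t" for s
    proof -
      have "hh s \<le> b"
        using hh_mono[of s "Gm b"] hh_Gm[OF ab(2)] that Gm_range[of b] by auto
      then show ?thesis
        using e by (auto simp: b_def)
    qed
    ultimately show ?thesis
      by (intro exI[of _ "Gm b - t"]) auto
  qed
  obtain d1 d2 where "0 < d1" "0 < d2" "\<forall>s\<in>{0..1}. \<bar>s - t\<bar> < d1 \<longrightarrow> hh t - e < hh s"
      "\<forall>s\<in>{0..1}. \<bar>s - t\<bar> < d2 \<longrightarrow> hh s < hh t + e"
    using lo hi by blast
  then show "\<exists>d>0. \<forall>s\<in>{0..1}. dist s t < d \<longrightarrow> dist (hh s) (hh t) < e"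
    by (intro exI[of _ "min d1 d2"]) (force simp: dist_real_def)
qed

section \<open>The contracting interval map and its semiconjugacy to the exchange\<close>

definition f_map :: "real \<Rightarrow> real" where
  "f_map t = (if t < z1 \<or> z2 \<le> t \<and> t < z3 then (1 - t) / 2 else 1 - t / 2)"

definition f_piece :: "real \<Rightarrow> nat" where
  "f_piece t = (if t < z1 then 1 else if t < z2 then 2 else if t < z3 then 3 else 4)"

lemma Gm_brk: "Gm (lam $ 1) = z1" "Gm (brk2) = z2" "Gm (brk3) = z3"
  using mu_I_set mu_Ico[of 0 "lam $ 1"] mu_Ico[of "lam $ 1" "brk2"]
    mu_Ico[of "brk2" "brk3"] lam_pos
  by (simp_all add: I_set_def Gm_0)

lemma hh_less_brk: "t \<in> {0..1} \<Longrightarrow> t < Gm x \<Longrightarrow> hh t < x"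
  using Gm_mono[of x "hh t"] hh_props[of t] by (cases "hh t < x") auto

lemma hh_ge_brk: "t \<in> {0..1} \<Longrightarrow> Gm x \<le> t \<Longrightarrow> x \<le> lam_total \<Longrightarrow> x \<le> hh t"
  using Gp_less_Gm[of "hh t" x] hh_props[of t] by (cases "x \<le> hh t") auto

lemma hh_I_set:
  assumes t: "t \<in> {0..1}"
  shows "hh t \<in> I_set (f_piece t)"
proof -
  have le: "lam $ 1 \<le> lam_total" "brk2 \<le> lam_total" "brk3 \<le> lam_total"
    using lam_pos by (simp_all add: lam_total_def)
  note less = hh_less_brk[OF t, of "lam $ 1", unfolded Gm_brk] hh_less_brk[OF t, of "brk2", unfolded Gm_brk]
    hh_less_brk[OF t, of "brk3", unfolded Gm_brk]
  note ge = hh_ge_brk[OF t _ le(1), unfolded Gm_brk] hh_ge_brk[OF t _ le(2), unfolded Gm_brk]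
    hh_ge_brk[OF t _ le(3), unfolded Gm_brk]
  consider "t < z1" | "z1 \<le> t" "t < z2" | "z2 \<le> t" "t < z3" | "z3 \<le> t"
    by linarith
  then show ?thesis
  proof cases
    case 1
    then show ?thesis
      using less hh_props(1)[OF t] by (simp add: f_piece_def I_set_def)
  next
    case 2
    then show ?thesis
      using less ge by (simp add: f_piece_def I_set_def)
  next
    case 3
    then show ?thesis
      using less ge z_order by (simp add: f_piece_def I_set_def)
  next
    case 4
    then show ?thesis
      using ge z_order hh_props(1)[OF t] by (simp add: f_piece_def I_set_def)
  qed
qed

lemma f_map_range: "t \<in> {0..1} \<Longrightarrow> f_map t \<in> {0<..<1}"
  using z_order by (auto simp: f_map_def)

lemma f_map_Icc: "t \<in> {0..1} \<Longrightarrow> f_map t \<in> {0..1}"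
  using f_map_range[of t] by auto

text \<open>Both sides of the functional equation of \<open>mu\<close>, evaluated on the initial segments that end at
  \<open>T x\<close>, squeeze \<open>f t\<close>.\<close>

lemma Gm_T_le:
  assumes "T_map -` {..<y} \<inter> {0..lam_total} \<subseteq> A"
    and "(if 0 < y then 1 - z3 else 0) + (if p_pt 2 < y then z2 - z1 else 0)
     + (if p_pt 3 < y then z3 - z2 else 0) + (if lam_total < y then z1 else 0) \<le> w"
  shows "Gm y \<le> (w + mu A) / 2"
proof -
  have aux: "a = s / 2 + m / 2 \<Longrightarrow> m \<le> m' \<Longrightarrow> s \<le> w \<Longrightarrow> a \<le> (w + m') / 2" for a s m m' :: real
    by simp
  show ?thesis
    unfolding Gm_def
    by (rule aux[OF mu_step[of "{..<y}", unfolded lessThan_iff p_pt_eq(1,4)] mu_subset[OF assms(1)] assms(2)])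
qed

lemma Gp_T_ge:
  assumes "A \<subseteq> T_map -` {..y}"
    and "w \<le> (if 0 \<le> y then 1 - z3 else 0) + (if p_pt 2 \<le> y then z2 - z1 else 0)
     + (if p_pt 3 \<le> y then z3 - z2 else 0) + (if lam_total \<le> y then z1 else 0)"
  shows "(w + mu A) / 2 \<le> Gp y"
proof -
  have aux: "a = s / 2 + m / 2 \<Longrightarrow> m' \<le> m \<Longrightarrow> w \<le> s \<Longrightarrow> (w + m') / 2 \<le> a" for a s m m' :: real
    by simp
  show ?thesis
    unfolding Gp_def
    by (rule aux[OF mu_step[of "{..y}", unfolded atMost_iff p_pt_eq(1,4)] mu_mono[OF assms(1)] assms(2)])
qed

lemma mu_Un_le: "mu (A \<union> B) \<le> mu A + mu B"
proof -
  have "mu (A \<union> B) = mu (A \<union> (B - A))"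
    by (rule arg_cong[of _ _ mu]) auto
  also have "\<dots> = mu A + mu (B - A)"
    by (rule mu_Un) auto
  also have "\<dots> \<le> mu A + mu B"
    using mu_mono[of "B - A" B] by auto
  finally show ?thesis .
qed

lemma T_values:
  "x \<in> I_set 1 \<Longrightarrow> lam $ 3 < T_map x \<and> T_map x \<le> lam $ 1 + lam $ 3 \<and> T_map x = lam $ 1 + lam $ 3 - x"
  "x \<in> I_set 2 \<Longrightarrow> top4 < T_map x \<and> T_map x \<le> lam_total \<and> T_map x = lam $ 1 + lam_total - x"
  "x \<in> I_set 3 \<Longrightarrow> 0 < T_map x \<and> T_map x \<le> lam $ 3 \<and> T_map x = brk3 - x"
  "x \<in> I_set 4 \<Longrightarrow> lam $ 1 + lam $ 3 \<le> T_map x \<and> T_map x \<le> top4 \<and> T_map x = lam $ 1 + lam $ 3 + lam_total - x"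
  by (simp_all add: T_map_I_set T_tr_def) (auto simp: I_set_def lam_total_def)

lemma p_pt_23: "p_pt 2 = lam $ 3" "p_pt 3 = top4"
  by (simp_all add: p_pt_eq) (simp add: lam_entries)

lemma lam_total_split: "lam_total = lam $ 1 + lam $ 3 + lam $ 4 + lam $ 2"
  by (simp add: lam_total_def)

lemma T_preimage_cases: "x' \<in> T_map -` A \<inter> {0..lam_total} \<Longrightarrow>
    (x' \<in> I_set 1 \<or> x' \<in> I_set 2 \<or> x' \<in> I_set 3 \<or> x' \<in> I_set 4) \<and> T_map x' \<in> A"
  using in_I_set[of x'] I_set_range[of x'] unfolding atLeastAtMost_1_4 by auto

text \<open>From left to right, \<open>T_map\<close> arranges the images of the pieces in the order
  3, 1, 4, 2. Below y = T x lie whole images of pieces and, since orientation is reversed, the image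
  of the part of the current piece to the right of x. Together with the weights of the p_j below y,
  everything cancels except 1 - t (pieces 1 and 3) or 2 - t (pieces 2 and 4), up to the atom at
  x.\<close>

lemma f_map_squeeze:
  assumes t: "t \<in> {0..1}"
  shows "Gm (T_map (hh t)) \<le> f_map t \<and> f_map t \<le> Gp (T_map (hh t))"
proof -
  define x where "x = hh t"
  have x: "Gm x \<le> t" "t \<le> Gp x" and xI: "x \<in> I_set (f_piece t)"
    using hh_props[OF t] hh_I_set[OF t] by (simp_all add: x_def)
  note Tv = T_values
  note lp = lam_pos
  consider "f_piece t = 1" "t < z1" | "f_piece t = 2" "z1 \<le> t" "t < z2" | "f_piece t = 3" "z2 \<le> t" "t < z3"
    | "f_piece t = 4" "z3 \<le> t"
    using z_order by (cases "t < z1"; cases "t < z2"; cases "t < z3") (auto simp: f_piece_def)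
  then show ?thesis
    unfolding x_def[symmetric]
  proof cases
    case 1
    define y where "y = T_map x"
    have y: "lam $ 3 < y" "y \<le> lam $ 1 + lam $ 3" "y = lam $ 1 + lam $ 3 - x" and xb: "0 \<le> x" "x < lam $ 1"
      using Tv(1)[of x] xI 1 by (simp_all add: y_def I_set_def)
    have "Gm y \<le> ((1 - z3 + (z2 - z1)) + mu (I_set 3 \<union> {x<..<lam $ 1})) / 2"
    proof (rule Gm_T_le)
      show "T_map -` {..<y} \<inter> {0..lam_total} \<subseteq> I_set 3 \<union> {x<..<lam $ 1}"
      proof
        fix x' assume x': "x' \<in> T_map -` {..<y} \<inter> {0..lam_total}"
        then show "x' \<in> I_set 3 \<union> {x<..<lam $ 1}"
          using T_preimage_cases[OF x'] Tv[of x'] y lp by (auto simp: I_set_def[of "Suc 0"])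
      qed
    qed (use y z_order lp in \<open>simp add: p_pt_23 lam_total_split\<close>)
    moreover have "mu (I_set 3 \<union> {x<..<lam $ 1}) \<le> z3 - z2 + (z1 - Gp x)"
      using mu_Un_le[of "I_set 3" "{x<..<lam $ 1}"] mu_open[OF xb(2)] by (simp add: mu_I_set Gm_brk)
    moreover have "((1 - z3 + (z2 - z1)) + mu (I_set 3 \<union> {x..<lam $ 1})) / 2 \<le> Gp y"
    proof (rule Gp_T_ge)
      show "I_set 3 \<union> {x..<lam $ 1} \<subseteq> T_map -` {..y}"
      proof
        fix x' assume x': "x' \<in> I_set 3 \<union> {x..<lam $ 1}"
        then have "x' \<in> I_set 3 \<or> x' \<in> I_set 1 \<and> x \<le> x'"
          using xb by (auto simp: I_set_def[of "Suc 0"])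
        then show "x' \<in> T_map -` {..y}"
          using Tv[of x'] y by auto
      qed
    qed (use y z_order lp in \<open>simp add: p_pt_23 lam_total_split\<close>)
    moreover have "mu (I_set 3 \<union> {x..<lam $ 1}) = z3 - z2 + (z1 - Gm x)"
    proof -
      have "I_set 3 \<inter> {x..<lam $ 1} = {}"
        using lp by (auto simp: I_set_def)
      then show ?thesis
        using mu_Ico[of x "lam $ 1"] xb by (simp add: mu_Un mu_I_set Gm_brk)
    qed
    ultimately show "Gm (T_map x) \<le> f_map t \<and> f_map t \<le> Gp (T_map x)"
      using x 1 by (simp add: f_map_def y_def)
  next
    case 2
    define y where "y = T_map x"
    have y: "top4 < y" "y \<le> lam_total" "y = lam $ 1 + lam_total - x"
      and xb: "lam $ 1 \<le> x" "x < brk2"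
      using Tv(2)[of x] xI 2 by (simp_all add: y_def I_set_def)
    have "Gm y \<le> (((1 - z3) + (z2 - z1) + (z3 - z2)) + mu (I_set 1 \<union> I_set 3 \<union> I_set 4 \<union> {x<..<brk2})) / 2"
    proof (rule Gm_T_le)
      show "T_map -` {..<y} \<inter> {0..lam_total} \<subseteq> I_set 1 \<union> I_set 3 \<union> I_set 4 \<union> {x<..<brk2}"
      proof
        fix x' assume x': "x' \<in> T_map -` {..<y} \<inter> {0..lam_total}"
        then show "x' \<in> I_set 1 \<union> I_set 3 \<union> I_set 4 \<union> {x<..<brk2}"
          using T_preimage_cases[OF x'] Tv[of x'] y lp by (auto simp: I_set_def[of 2])
      qed
    qed (use y z_order lp in \<open>simp add: p_pt_23 lam_total_split\<close>)
    moreover have "mu (I_set 1 \<union> I_set 3 \<union> I_set 4 \<union> {x<..<brk2}) \<le> z1 + (z3 - z2) + (1 - z3) + (z2 - Gp x)"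
      using mu_Un_le[of "I_set 1 \<union> I_set 3 \<union> I_set 4" "{x<..<brk2}"] mu_Un_le[of "I_set 1 \<union> I_set 3" "I_set 4"]
        mu_Un_le[of "I_set 1" "I_set 3"] mu_open[OF xb(2)] by (simp add: mu_I_set Gm_brk del: One_nat_def)
    moreover have "(((1 - z3) + (z2 - z1) + (z3 - z2)) + mu (I_set 1 \<union> I_set 3 \<union> I_set 4 \<union> {x..<brk2})) / 2 \<le> Gp y"
    proof (rule Gp_T_ge)
      show "I_set 1 \<union> I_set 3 \<union> I_set 4 \<union> {x..<brk2} \<subseteq> T_map -` {..y}"
      proof
        fix x' assume x': "x' \<in> I_set 1 \<union> I_set 3 \<union> I_set 4 \<union> {x..<brk2}"
        then have "x' \<in> I_set 1 \<or> x' \<in> I_set 3 \<or> x' \<in> I_set 4 \<or> x' \<in> I_set 2 \<and> x \<le> x'"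
          using xb by (auto simp: I_set_def[of 2])
        then show "x' \<in> T_map -` {..y}"
          using Tv[of x'] y lp by auto
      qed
    qed (use y z_order lp in \<open>simp add: p_pt_23 lam_total_split\<close>)
    moreover have "mu (I_set 1 \<union> I_set 3 \<union> I_set 4 \<union> {x..<brk2}) = z1 + (z3 - z2) + (1 - z3) + (z2 - Gm x)"
    proof -
      have "I_set 1 \<inter> I_set 3 = {}" "(I_set 1 \<union> I_set 3) \<inter> I_set 4 = {}"
        using I_set_disj[of _ 1 3] I_set_disj[of _ 1 4] I_set_disj[of _ 3 4] by auto
      moreover have "(I_set 1 \<union> I_set 3 \<union> I_set 4) \<inter> {x..<brk2} = {}"
        using xb lp by (auto simp: I_set_def)
      ultimately show ?thesis
        using mu_Ico[of x "brk2"] xb by (simp add: mu_Un mu_I_set Gm_brk del: One_nat_def)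
    qed
    ultimately show "Gm (T_map x) \<le> f_map t \<and> f_map t \<le> Gp (T_map x)"
      using x 2 by (simp add: f_map_def y_def)
  next
    case 3
    define y where "y = T_map x"
    have y: "0 < y" "y \<le> lam $ 3" "y = brk3 - x"
      and xb: "brk2 \<le> x" "x < brk3"
      using Tv(3)[of x] xI 3 by (simp_all add: y_def I_set_def)
    have "Gm y \<le> ((1 - z3) + mu {x<..<brk3}) / 2"
    proof (rule Gm_T_le)
      show "T_map -` {..<y} \<inter> {0..lam_total} \<subseteq> {x<..<brk3}"
      proof
        fix x' assume x': "x' \<in> T_map -` {..<y} \<inter> {0..lam_total}"
        then show "x' \<in> {x<..<brk3}"
          using T_preimage_cases[OF x'] Tv[of x'] y lp by (auto simp: I_set_def[of 3])
      qed
    qed (use y z_order lp in \<open>simp add: p_pt_23 lam_total_split\<close>)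
    moreover have "((1 - z3) + mu {x..<brk3}) / 2 \<le> Gp y"
    proof (rule Gp_T_ge)
      show "{x..<brk3} \<subseteq> T_map -` {..y}"
      proof
        fix x' assume x': "x' \<in> {x..<brk3}"
        then have "x' \<in> I_set 3 \<and> x \<le> x'"
          using xb by (auto simp: I_set_def[of 3])
        then show "x' \<in> T_map -` {..y}"
          using Tv(3)[of x'] y by auto
      qed
    qed (use y z_order lp in \<open>simp add: p_pt_23 lam_total_split\<close>)
    ultimately show "Gm (T_map x) \<le> f_map t \<and> f_map t \<le> Gp (T_map x)"
      using x 3 mu_open[OF xb(2)] mu_Ico[of x "brk3"] xb
      by (simp add: f_map_def y_def Gm_brk)
  next
    case 4
    define y where "y = T_map x"
    have y: "lam $ 1 + lam $ 3 \<le> y" "y \<le> top4" "y = lam $ 1 + lam $ 3 + lam_total - x"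
      and xb: "brk3 \<le> x" "x \<le> lam_total"
      using Tv(4)[of x] xI 4 by (simp_all add: y_def I_set_def)
    have "Gm y \<le> ((1 - z3 + (z2 - z1)) + mu (I_set 1 \<union> I_set 3 \<union> {x<..})) / 2"
    proof (rule Gm_T_le)
      show "T_map -` {..<y} \<inter> {0..lam_total} \<subseteq> I_set 1 \<union> I_set 3 \<union> {x<..}"
      proof
        fix x' assume x': "x' \<in> T_map -` {..<y} \<inter> {0..lam_total}"
        then show "x' \<in> I_set 1 \<union> I_set 3 \<union> {x<..}"
          using T_preimage_cases[OF x'] Tv[of x'] y lp by auto
      qed
    qed (use y z_order lp in \<open>simp add: p_pt_23 lam_total_split\<close>)
    moreover have "mu (I_set 1 \<union> I_set 3 \<union> {x<..}) \<le> z1 + (z3 - z2) + (1 - Gp x)"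
      using mu_Un_le[of "I_set 1 \<union> I_set 3" "{x<..}"] mu_Un_le[of "I_set 1" "I_set 3"]
      by (simp add: mu_I_set mu_Ioi del: One_nat_def)
    moreover have "((1 - z3 + (z2 - z1)) + mu (I_set 1 \<union> I_set 3 \<union> {x..lam_total})) / 2 \<le> Gp y"
    proof (rule Gp_T_ge)
      show "I_set 1 \<union> I_set 3 \<union> {x..lam_total} \<subseteq> T_map -` {..y}"
      proof
        fix x' assume x': "x' \<in> I_set 1 \<union> I_set 3 \<union> {x..lam_total}"
        then have "x' \<in> I_set 1 \<or> x' \<in> I_set 3 \<or> x' \<in> I_set 4 \<and> x \<le> x'"
          using xb by (auto simp: I_set_def[of 4])
        then show "x' \<in> T_map -` {..y}"
          using Tv[of x'] y lp by auto
      qed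
    qed (use y z_order lp in \<open>simp add: p_pt_23 lam_total_split\<close>)
    moreover have "mu (I_set 1 \<union> I_set 3 \<union> {x..lam_total}) = z1 + (z3 - z2) + (1 - Gm x)"
    proof -
      have "I_set 1 \<inter> I_set 3 = {}"
        using I_set_disj[of _ 1 3] by auto
      moreover have "(I_set 1 \<union> I_set 3) \<inter> {x..lam_total} = {}"
        using xb lp by (auto simp: I_set_def)
      moreover have "{x..} \<inter> {0..lam_total} = {x..lam_total}"
        using xb lp by auto
      then have "mu {x..lam_total} = 1 - Gm x"
        using mu_range[of "{x..}"] mu_Ici[of x] by (simp only:)
      ultimately show ?thesis
        by (simp add: mu_Un mu_I_set del: One_nat_def)
    qed
    ultimately show "Gm (T_map x) \<le> f_map t \<and> f_map t \<le> Gp (T_map x)"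
      using x 4 z_order by (simp add: f_map_def y_def)
  qed
qed

lemma hh_f_map: "t \<in> {0..1} \<Longrightarrow> hh (f_map t) = T_map (hh t)"
  using f_map_squeeze[of t] T_range hh_props(1) by (intro hh_eq) auto

lemma f_iter_range: "t \<in> {0..1} \<Longrightarrow> (f_map ^^ n) t \<in> {0..1}"
  by (induction n) (simp_all only: funpow.simps comp_apply id_apply f_map_Icc)

lemma hh_f_iter: "t \<in> {0..1} \<Longrightarrow> hh ((f_map ^^ n) t) = (T_map ^^ n) (hh t)"
  by (induction n) (simp_all only: funpow.simps comp_apply id_apply hh_f_map f_iter_range)

section \<open>The attractor\<close>

text \<open>The complement of the open gaps, i.e. of the set where \<open>h\<close> is locally constant.\<close>

definition attractor :: "real set" where
  "attractor = {s \<in> {0..1}. \<forall>e>0. \<exists>s'\<in>{0..1}. \<bar>s' - s\<bar> < e \<and> hh s' \<noteq> hh s}"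

lemma hh_between:
  assumes "s \<in> {0..1}" "t \<in> {0..1}" "s < t" "hh s = hh t" "s < r" "r < t"
  shows "r \<notin> attractor"
proof
  assume "r \<in> attractor"
  then obtain r' where r': "r' \<in> {0..1}" "\<bar>r' - r\<bar> < min (r - s) (t - r)" "hh r' \<noteq> hh r"
    unfolding attractor_def using assms(5,6) by (auto dest!: spec[of _ "min (r - s) (t - r)"])
  have "s \<le> r'" "r' \<le> t" "r \<in> {0..1}"
    using r'(2) assms by (auto simp: abs_less_iff min_less_iff_conj)
  then have "hh r' = hh s" "hh r = hh s"
    using hh_mono[of s r'] hh_mono[of r' t] hh_mono[of s r] hh_mono[of r t] assms r'(1) by auto
  with r'(3) show False
    by simp
qed

text \<open>Atoms of \<open>mu\<close> are dense: if \<open>hh\<close> grows from a to b, some orbit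
  point of p_1 lies strictly between the two values, and its atom yields a plateau of
  \<open>hh\<close> inside the interval. If \<open>hh\<close> does not grow, the interval is itself
  part of a plateau.\<close>

lemma attractor_interior: "a < b \<Longrightarrow> \<not> {a..b} \<subseteq> attractor"
proof
  assume ab: "a < b" and sub: "{a..b} \<subseteq> attractor"
  then have *: "a \<in> {0..1}" "b \<in> {0..1}"
    by (auto simp: attractor_def subset_iff)
  have "hh a \<le> hh b"
    using hh_mono * ab by auto
  then consider "hh a = hh b" | "hh a < hh b"
    by linarith
  then show False
  proof cases
    case 1
    then show False
      using hh_between[OF * ab 1, of "(a + b) / 2"] subsetD[OF sub, of "(a + b) / 2"] ab by simp
  next
    case 2
    have "\<exists>k\<ge>0. (T_map ^^ k) (p_pt 1) \<in> {hh a<..<hh b}"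
      using 2 p_pt_range[of 1] hh_props(1)[OF *(1)] hh_props(1)[OF *(2)] by (intro T_dense) auto
    then obtain k where k: "(T_map ^^ k) (p_pt 1) \<in> {hh a<..<hh b}"
      by blast
    define x where "x = (T_map ^^ k) (p_pt 1)"
    have x: "hh a < x" "x < hh b" "x \<in> {0..lam_total}"
      using k hh_props(1)[OF *(1)] hh_props(1)[OF *(2)] by (auto simp: x_def)
    have "0 < mass (p_pt 1) {x}"
      using mass_atom[of k "p_pt 1" "{x}"] by (simp add: x_def) (meson less_le_trans zero_less_divide_1_iff zero_less_numeral zero_less_power)
    then have "0 < mu {x}"
      unfolding mu_def using weights_pos mass_nonneg
      by (intro divide_pos_pos add_pos_nonneg mult_pos_pos mult_nonneg_nonneg) auto
    moreover have "Gp x = Gm x + mu {x}"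
      unfolding Gm_def Gp_def by (subst mu_Un[symmetric]) (auto intro: arg_cong[of _ _ mu])
    ultimately have lt: "Gm x < Gp x"
      by simp
    have "a < Gm x"
      using hh_less[of a "Gm x"] *(1) hh_Gm[OF x(3)] Gm_range[of x] x(1) by auto
    moreover have "Gp x < b"
      using hh_less[of "Gp x" b] *(2) hh_Gp[OF x(3)] Gp_range[of x] x(2) by auto
    ultimately have "(Gm x + Gp x) / 2 \<in> attractor"
      using sub lt by auto
    then show False
      using hh_between[of "Gm x" "Gp x" "(Gm x + Gp x) / 2"] lt Gm_range[of x] Gp_range[of x]
        hh_Gm[OF x(3)] hh_Gp[OF x(3)] by auto
  qed
qed

lemma attractor_closed: "closed attractor"
proof -
  have sub: "attractor \<subseteq> {0..1}"
    by (auto simp: attractor_def)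
  have "\<exists>e>0. ball s e \<subseteq> - attractor" if "s \<notin> attractor" for s
  proof (cases "s \<in> {0..1}")
    case False
    then have "s \<in> - {0..1}"
      by simp
    then obtain e where "0 < e" "ball s e \<subseteq> - {0..1}"
      using open_Compl[OF closed_atLeastAtMost, of 0 1] open_contains_ball by metis
    with sub show ?thesis
      by blast
  next
    case True
    with that have "\<exists>e>0. \<forall>s'\<in>{0..1}. \<bar>s' - s\<bar> < e \<longrightarrow> hh s' = hh s"
      unfolding attractor_def by blast
    then obtain e where e: "0 < e" "\<And>s'. s' \<in> {0..1} \<Longrightarrow> \<bar>s' - s\<bar> < e \<Longrightarrow> hh s' = hh s"
      by blast
    have "r \<notin> attractor" if r': "\<bar>r - s\<bar> < e / 2" for r
    proof
      assume r: "r \<in> attractor"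
      have "0 < e / 2"
        using e(1) by simp
      then obtain r' where r': "r' \<in> {0..1}" "\<bar>r' - r\<bar> < e / 2" "hh r' \<noteq> hh r"
        using r unfolding attractor_def by blast
      have "\<bar>r' - s\<bar> < e" "\<bar>r - s\<bar> < e"
        using r'(2) \<open>\<bar>r - s\<bar> < e / 2\<close> by linarith+
      then have "hh r' = hh s" "hh r = hh s"
        using e(2) r'(1) r sub by blast+
      with r'(3) show False
        by simp
    qed
    then have "ball s (e / 2) \<subseteq> - attractor"
      by (auto simp: dist_real_def abs_minus_commute)
    then show ?thesis
      using e(1) by (intro exI[of _ "e / 2"]) simp
  qed
  then show ?thesis
    unfolding closed_def open_contains_ball by blast
qed

text \<open>\<open>mu\<close> has atoms at both ends, p_1 = 0 and p_4 = \<open>lam_total\<close>, so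
  \<open>hh\<close> is constant near 0 and near 1. This keeps the attractor away from the two
  parameters that \<open>phi\<close> identifies.\<close>

lemma attractor_open_01: "attractor \<subseteq> {0<..<1}"
proof
  fix s assume s: "s \<in> attractor"
  have 0: "(0::real) < mu {..0}" "0 < mu {lam_total..}"
    using mu_pos[of 1 "{..0}"] mu_pos[of 4 "{lam_total..}"] by (auto simp: p_pt_eq[unfolded One_nat_def])
  have G0: "0 < Gp 0" "hh (Gp 0) = 0"
    using 0 hh_Gp[of 0] lam_total_pos by (simp_all add: Gp_def)
  have "s \<noteq> 0"
  proof
    assume "s = 0"
    obtain s' where "s' \<in> {0..1}" "\<bar>s' - s\<bar> < Gp 0" "hh s' \<noteq> hh s"
      using s G0(1) unfolding attractor_def by blast
    then have s': "s' \<in> {0..1}" "\<bar>s'\<bar> < Gp 0" "hh s' \<noteq> hh 0"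
      using \<open>s = 0\<close> by simp_all
    have "hh s' \<le> hh (Gp 0)" "hh 0 \<le> hh s'"
      using s' Gp_range[of 0] by (intro hh_mono; simp)+
    with G0(2) s'(3) hh_props(1)[of 0] show False
      by simp
  qed
  moreover have G1: "Gm lam_total < 1" "hh (Gm lam_total) = lam_total"
    using 0(2) mu_Ici[of lam_total] hh_Gm[of lam_total] lam_total_pos by simp_all
  have "s \<noteq> 1"
  proof
    assume "s = 1"
    have "0 < 1 - Gm lam_total"
      using G1(1) by simp
    then obtain s' where "s' \<in> {0..1}" "\<bar>s' - s\<bar> < 1 - Gm lam_total" "hh s' \<noteq> hh s"
      using s unfolding attractor_def by blast
    then have s': "s' \<in> {0..1}" "\<bar>s' - 1\<bar> < 1 - Gm lam_total" "hh s' \<noteq> hh 1"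
      using \<open>s = 1\<close> by simp_all
    have "hh (Gm lam_total) \<le> hh s'" "hh s' \<le> hh 1"
      using s' Gm_range[of lam_total] by (intro hh_mono; simp)+
    with G1(2) s'(3) hh_props(1)[of 1] show False
      by simp
  qed
  ultimately show "s \<in> {0<..<1}"
    using s by (auto simp: attractor_def)
qed

text \<open>Near \<open>s\<close> there is \<open>s'\<close> with another value of
  \<open>hh\<close>. A dense orbit of \<open>T_map\<close> enters the interval between the two
  values, and monotonicity of \<open>hh\<close> places the corresponding point of the
  \<open>f_map\<close>-orbit between \<open>s\<close> and \<open>s'\<close>.\<close>

lemma attractor_recurrent:
  assumes s: "s \<in> attractor" and t: "t \<in> {0..1}" and e: "0 < e"
  shows "\<exists>n\<ge>N. \<bar>(f_map ^^ n) t - s\<bar> < e"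
proof -
  obtain s' where s': "s' \<in> {0..1}" "\<bar>s' - s\<bar> < e" "hh s' \<noteq> hh s"
    using s e by (auto simp: attractor_def)
  have s01: "s \<in> {0..1}"
    using s by (simp add: attractor_def)
  define a b where "a = min (hh s) (hh s')" and "b = max (hh s) (hh s')"
  have ab: "a < b" "0 \<le> a" "b \<le> lam_total"
    using s'(3) hh_props(1)[OF s'(1)] hh_props(1)[OF s01] by (auto simp: a_def b_def)
  have "\<exists>n\<ge>N. (T_map ^^ n) (hh t) \<in> {a<..<b}"
    using ab hh_props(1)[OF t] by (intro T_dense) auto
  then obtain n where n: "N \<le> n" "hh ((f_map ^^ n) t) \<in> {a<..<b}"
    using hh_f_iter[OF t] by auto
  have r: "(f_map ^^ n) t \<in> {0..1}"
    using f_iter_range[OF t] .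
  have "min s s' < (f_map ^^ n) t \<and> (f_map ^^ n) t < max s s'"
  proof (cases "hh s < hh s'")
    case True
    then have "s < (f_map ^^ n) t" "(f_map ^^ n) t < s'"
      using n(2) by (auto simp: a_def b_def intro: hh_less[OF s01 r] hh_less[OF r s'(1)])
    then show ?thesis
      by simp
  next
    case False
    then have "s' < (f_map ^^ n) t" "(f_map ^^ n) t < s"
      using n(2) s'(3) by (auto simp: a_def b_def intro: hh_less[OF s'(1) r] hh_less[OF r s01])
    then show ?thesis
      by simp
  qed
  then show ?thesis
    using n(1) s'(2) by (intro exI[of _ n]) auto
qed

text \<open>Orbits of \<open>T_map\<close> never repeat a value, so two terms of the subsequence
  close to \<open>s\<close> have different images under \<open>hh\<close>, and one of these differs
  from \<open>hh s\<close>.\<close>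

lemma limit_in_attractor:
  assumes t: "t \<in> {0..1}" and r: "strict_mono (r :: nat \<Rightarrow> nat)" and lim: "(\<lambda>n. (f_map ^^ r n) t) \<longlonglongrightarrow> s"
  shows "s \<in> attractor"
proof -
  have "s \<in> {0..1}"
    using closed_sequentially[OF closed_atLeastAtMost _ lim] f_iter_range[OF t] by blast
  moreover have "\<exists>s'\<in>{0..1}. \<bar>s' - s\<bar> < e \<and> hh s' \<noteq> hh s" if e: "0 < e" for e
  proof -
    obtain N where N: "\<And>n. n \<ge> N \<Longrightarrow> \<bar>(f_map ^^ r n) t - s\<bar> < e"
      using LIMSEQ_D[OF lim e] by auto
    have "hh ((f_map ^^ r N) t) \<noteq> hh ((f_map ^^ r (Suc N)) t)"
    proof
      assume "hh ((f_map ^^ r N) t) = hh ((f_map ^^ r (Suc N)) t)"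
      then have "r N = r (Suc N)"
        using T_orbit_inj[OF hh_props(1)[OF t]] by (simp only: hh_f_iter[OF t])
      then show False
        using strict_mono_less[OF r, of N "Suc N"] by simp
    qed
    then have "hh ((f_map ^^ r N) t) \<noteq> hh s \<or> hh ((f_map ^^ r (Suc N)) t) \<noteq> hh s"
      by metis
    then show ?thesis
      using N[of N] N[of "Suc N"] f_iter_range[OF t] by (metis le_SucI order_refl)
  qed
  ultimately show ?thesis
    by (simp add: attractor_def)
qed

lemma attractor_subsequence:
  assumes s: "s \<in> attractor" and t: "t \<in> {0..1}"
  shows "\<exists>r. strict_mono (r :: nat \<Rightarrow> nat) \<and> (\<lambda>n. (f_map ^^ r n) t) \<longlonglongrightarrow> s"
proof -
  have "\<exists>r. \<forall>n. \<bar>(f_map ^^ r n) t - s\<bar> < 1 / real (Suc n) \<and> r n < r (Suc n)"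
  proof (rule dependent_nat_choice)
    show "\<exists>x. \<bar>(f_map ^^ x) t - s\<bar> < 1 / real (Suc 0)"
      using attractor_recurrent[OF s t, of 1 0] by auto
    show "\<exists>y. \<bar>(f_map ^^ y) t - s\<bar> < 1 / real (Suc (Suc n)) \<and> x < y" for x n
      using attractor_recurrent[OF s t, of "1 / real (Suc (Suc n))" "Suc x"] by (auto simp: Suc_le_eq)
  qed
  then obtain r where r: "\<And>n. \<bar>(f_map ^^ r n) t - s\<bar> < 1 / real (Suc n)" "\<And>n. r n < r (Suc n)"
    by blast
  have "(\<lambda>n. (f_map ^^ r n) t - s) \<longlonglongrightarrow> 0"
  proof (rule Lim_null_comparison)
    show "\<forall>\<^sub>F n in sequentially. norm ((f_map ^^ r n) t - s) \<le> 1 / real (Suc n)"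
      using r(1) by (auto intro!: always_eventually less_imp_le)
    show "(\<lambda>n. 1 / real (Suc n)) \<longlonglongrightarrow> 0"
      using LIMSEQ_Suc[OF lim_1_over_n] by simp
  qed
  then have "(\<lambda>n. (f_map ^^ r n) t) \<longlonglongrightarrow> s"
    by (rule LIM_zero_cancel)
  with r(2) show ?thesis
    by (auto simp: strict_mono_Suc_iff)
qed

lemma attractor_nonempty: "attractor \<noteq> {}"
proof -
  have "\<forall>n. (f_map ^^ n) 0 \<in> {0..1}"
    using f_iter_range[of 0] by simp
  then obtain s r where "strict_mono r" "((\<lambda>n. (f_map ^^ n) 0) \<circ> r) \<longlonglongrightarrow> s"
    using compact_Icc[of "0::real" 1] unfolding compact_def by metis
  then have "s \<in> attractor"
    by (intro limit_in_attractor[of 0 r s]) (auto simp: o_def)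
  then show ?thesis
    by blast
qed

text \<open>For y slightly to the left of x, the value \<open>Gp y\<close> is close to
  \<open>Gm x\<close>, and \<open>hh\<close> sends these two parameters to the different points y
  and x.\<close>

lemma Gm_in_attractor:
  assumes x: "0 < x" "x \<le> lam_total"
  shows "Gm x \<in> attractor"
proof -
  have "\<exists>s'\<in>{0..1}. \<bar>s' - Gm x\<bar> < e \<and> hh s' \<noteq> hh (Gm x)" if e: "0 < e" for e
  proof -
    obtain d where d: "0 < d" "mu ({x - d<..<x + d} - {x}) < e"
      using mu_small[OF e] by blast
    define y where "y = max 0 (x - d / 2)"
    have y: "0 \<le> y" "y < x" "x - d < y"
      using x d(1) by (auto simp: y_def)
    have "mu {y<..<x} \<le> mu ({x - d<..<x + d} - {x})"
      using y by (intro mu_mono) auto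
    then have "Gm x - Gp y < e" "0 < Gm x - Gp y"
      using d(2) mu_open[OF y(2)] mu_interval_pos[OF y(1,2) x(2)] by auto
    moreover have "hh (Gp y) = y" "hh (Gm x) = x"
      using hh_Gp[of y] hh_Gm[of x] x y by auto
    ultimately show ?thesis
      using y(2) Gp_range[of y] by (intro bexI[of _ "Gp y"]) auto
  qed
  then show ?thesis
    using Gm_range[of x] by (auto simp: attractor_def)
qed

text \<open>A point x strictly between \<open>hh s\<close> and \<open>hh s'\<close> gives the point
  \<open>Gm x\<close> of the attractor strictly between \<open>s\<close> and
  \<open>s'\<close>.\<close>

lemma attractor_perfect:
  assumes s: "s \<in> attractor"
  shows "s islimpt attractor"
  unfolding islimpt_approachable
proof (intro allI impI)
  fix e :: real assume e: "0 < e"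
  obtain s' where s': "s' \<in> {0..1}" "\<bar>s' - s\<bar> < e" "hh s' \<noteq> hh s"
    using s e by (auto simp: attractor_def)
  have s01: "s \<in> {0..1}"
    using s by (simp add: attractor_def)
  define x where "x = (hh s + hh s') / 2"
  have x: "0 < x" "x \<le> lam_total"
    using s'(3) hh_props(1)[OF s'(1)] hh_props(1)[OF s01] by (auto simp: x_def)
  have G: "Gm x \<in> {0..1}" "hh (Gm x) = x"
    using Gm_range[of x] hh_Gm[of x] x by auto
  have "min s s' < Gm x \<and> Gm x < max s s'"
  proof (cases "hh s < hh s'")
    case True
    then have "hh s < x" "x < hh s'"
      by (simp_all add: x_def)
    then have "s < Gm x" "Gm x < s'"
      using hh_less[OF s01 G(1)] hh_less[OF G(1) s'(1)] G(2) by simp_all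
    then show ?thesis
      by simp
  next
    case False
    then have "hh s' < x" "x < hh s"
      using s'(3) by (simp_all add: x_def)
    then have "s' < Gm x" "Gm x < s"
      using hh_less[OF s'(1) G(1)] hh_less[OF G(1) s01] G(2) by simp_all
    then show ?thesis
      by simp
  qed
  then have "Gm x \<noteq> s" "dist (Gm x) s < e"
    using s'(2) by (auto simp: dist_real_def)
  then show "\<exists>x'\<in>attractor. x' \<noteq> s \<and> dist x' s < e"
    using Gm_in_attractor[OF x] by blast
qed

section \<open>The switched server system on the boundary of the simplex\<close>

lemma phi_nth:
  "phi t $ 1 = (if t < 1/3 then 0 else if t < 2/3 then 3 * t - 1 else 3 - 3 * t)"
  "phi t $ 2 = (if t < 1/3 then 1 - 3 * t else if t < 2/3 then 0 else 3 * t - 2)"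
  "phi t $ 3 = (if t < 1/3 then 3 * t else if t < 2/3 then 2 - 3 * t else 0)"
  by (simp_all add: phi_def axis_def)

lemma phi_in_Delta: "t \<in> {0..1} \<Longrightarrow> phi t \<in> Delta"
  by (auto simp: Delta_def forall_3 sum_3 phi_nth)

lemma phi_in_bd: "t \<in> {0..1} \<Longrightarrow> phi t \<in> bd_Delta"
proof -
  assume t: "t \<in> {0..1}"
  have "phi t $ 1 = 0 \<or> phi t $ 2 = 0 \<or> phi t $ 3 = 0"
    by (auto simp: phi_nth)
  then show ?thesis
    using phi_in_Delta[OF t] by (auto simp: bd_Delta_def)
qed

lemma bd_Delta_phi: "x \<in> bd_Delta \<Longrightarrow> \<exists>t\<in>{0..1}. phi t = x"
proof -
  assume "x \<in> bd_Delta"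
  then have nn: "0 \<le> x $ 1" "0 \<le> x $ 2" "0 \<le> x $ 3" and s: "x $ 1 + x $ 2 + x $ 3 = 1"
    and "\<exists>i. x $ i = 0"
    by (auto simp: bd_Delta_def Delta_def forall_3 sum_3)
  then consider "x $ 1 = 0" "x $ 3 < 1" | "x $ 2 = 0" "x $ 1 < 1" | "x $ 3 = 0"
    using exhaust_3 by (smt (verit))
  then show ?thesis
  proof cases
    case 1
    then show ?thesis
      using nn s by (intro bexI[of _ "x $ 3 / 3"]) (auto simp: vec_eq_iff forall_3 phi_nth)
  next
    case 2
    then show ?thesis
      using nn s by (intro bexI[of _ "(x $ 1 + 1) / 3"]) (auto simp: vec_eq_iff forall_3 phi_nth add_divide_distrib)
  next
    case 3
    then show ?thesis
      using nn s by (intro bexI[of _ "(x $ 2 + 2) / 3"]) (auto simp: vec_eq_iff forall_3 phi_nth add_divide_distrib)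
  qed
qed

lemma phi_inj: "s \<in> {0..1} \<Longrightarrow> t \<in> {0<..<1} \<Longrightarrow> phi s = phi t \<Longrightarrow> s = t"
  unfolding vec_eq_iff forall_3 phi_nth by (auto split: if_splits)

lemma phi_continuous: "continuous_on {0..1} phi"
proof -
  have 1: "phi t = (1 - 3*t) *\<^sub>R axis 2 1 + (3*t) *\<^sub>R axis 3 1" if "t \<in> {0..1/3}" for t
    using that by (auto simp: vec_eq_iff forall_3 phi_nth axis_def)
  have 2: "phi t = (2 - 3*t) *\<^sub>R axis 3 1 + (3*t - 1) *\<^sub>R axis 1 1" if "t \<in> {1/3..2/3}" for t
    using that by (auto simp: vec_eq_iff forall_3 phi_nth axis_def)
  have 3: "phi t = (3 - 3*t) *\<^sub>R axis 1 1 + (3*t - 2) *\<^sub>R axis 2 1" if "t \<in> {2/3..1}" for t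
    using that by (auto simp: vec_eq_iff forall_3 phi_nth axis_def)
  have "continuous_on {0..1/3} phi" "continuous_on {1/3..2/3} phi" "continuous_on {2/3..1} phi"
    by (subst continuous_on_cong[OF refl 1], assumption, intro continuous_intros,
        subst continuous_on_cong[OF refl 2], assumption, intro continuous_intros,
        subst continuous_on_cong[OF refl 3], assumption, intro continuous_intros)
  then have "continuous_on ({0..1/3} \<union> {1/3..2/3} \<union> {2/3..1}) phi"
    by (intro continuous_on_closed_Un closed_Un closed_atLeastAtMost)
  moreover have "{0..1/3} \<union> {1/3..2/3} \<union> {2/3..1} = {0..1::real}"
    by auto
  ultimately show ?thesis
    by simp
qed

text \<open>The tank chosen in the state \<open>phi t\<close>, as \<open>moves_to_srv\<close>
  confirms. The pieces 1 and 4 lead to the same tank from two different sides of the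
  triangle.\<close>

definition srv :: "real \<Rightarrow> 3" where
  "srv t = (if f_piece t = 1 \<or> f_piece t = 4 then 2 else if f_piece t = 2 then 3 else 1)"

definition vol :: "real \<Rightarrow> real" where
  "vol t = phi t $ srv t"

text \<open>Velocity of the state while the server is at tank \<open>j\<close>.\<close>

definition dir :: "3 \<Rightarrow> real^3" where
  "dir j = (\<chi> i. 1 / 3 - (if j = i then 1 else 0))"

lemma dir_nth: "dir j $ i = 1 / 3 - (if j = i then 1 else 0)"
  by (simp add: dir_def)

lemma srv_cases: "srv t = (if t < z1 then 2 else if t < z2 then 3 else if t < z3 then 1 else 2)"
  by (simp add: srv_def f_piece_def)

text \<open>A lower bound for the volume of the tank about to be served; it prevents switching times
  from accumulating.\<close>

definition vol_min :: real where
  "vol_min = 1 / 20"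

lemma vol_ge: "t \<in> {0..1} \<Longrightarrow> vol_min \<le> vol t"
proof -
  assume t: "t \<in> {0..1}"
  have z: "z1 < 0.3" "0.2 < z1" "z2 < 0.5" "0.38 < z2" "z3 < 0.9" "0.7 < z3"
    using z_bounds unfolding abs_le_iff by simp_all
  show ?thesis
    using t z unfolding vol_def srv_cases vol_min_def
    by (cases "t < z1"; cases "t < z2"; cases "t < z3") (simp_all add: phi_nth)
qed

lemma vol_min_pos: "0 < vol_min"
  by (simp add: vol_min_def)

text \<open>The served tank loses fluid at rate 2/3 and is empty after 3/2 times its volume; the
  straight line across the triangle then ends at the parameter given by
  \<open>f_map\<close>.\<close>

lemma phi_step: "t \<in> {0..1} \<Longrightarrow> phi t + (3 / 2 * vol t) *\<^sub>R dir (srv t) = phi (f_map t)"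
proof -
  assume t: "t \<in> {0..1}"
  consider "t < z1" | "z1 \<le> t" "t < 1 / 3" | "1 / 3 \<le> t" "t < z2" | "z2 \<le> t" "t < 2 / 3" | "2 / 3 \<le> t" "t < z3" | "z3 \<le> t"
    by linarith
  then show ?thesis
    by cases (use t z_order in \<open>simp_all add: vec_eq_iff forall_3 vol_def srv_cases dir_nth phi_nth f_map_def field_simps\<close>)
qed

section \<open>The switching rule in the boundary coordinate\<close>

locale server_params =
  fixes d :: "3 \<Rightarrow> 3 \<Rightarrow> real"
  assumes d_pos: "\<And>i j. i \<noteq> j \<Longrightarrow> 0 < d i j"
    and d_ratio: "d 1 3 / d 1 2 = 1 / (3 * z1) - 1" "d 2 1 / d 2 3 = (2 - 3 * z2) / (3 * z2 - 1)"
      "d 3 2 / d 3 1 = (3 - 3 * z3) / (3 * z3 - 2)"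
begin

lemma ratio_compare:
  fixes p q a b :: real
  assumes "0 < q" "p / q = a / b" "0 < b"
  shows "p * x < q * y \<longleftrightarrow> a * x < b * y" "q * y < p * x \<longleftrightarrow> b * y < a * x" "p * x = q * y \<longleftrightarrow> a * x = b * y"
proof -
  have p: "p = q * (a / b)"
    using assms by (simp add: field_simps)
  define k where "k = q / b"
  have *: "p * x - q * y = k * (a * x - b * y)"
    using assms by (simp add: p k_def field_simps)
  have "0 < k"
    using assms by (simp add: k_def)
  then have "p * x - q * y < 0 \<longleftrightarrow> a * x - b * y < 0" "0 < p * x - q * y \<longleftrightarrow> 0 < a * x - b * y"
    "p * x - q * y = 0 \<longleftrightarrow> a * x - b * y = 0"
    unfolding * by (simp_all add: mult_less_0_iff zero_less_mult_iff)
  then show "p * x < q * y \<longleftrightarrow> a * x < b * y" "q * y < p * x \<longleftrightarrow> b * y < a * x" "p * x = q * y \<longleftrightarrow> a * x = b * y"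
    by simp_all
qed

text \<open>The value of the ratio \<open>d 1 3 / d 1 2\<close> says that the two scaled volumes tie
  exactly at \<open>t = z1\<close>; the other two sides of the triangle are analogous.\<close>

lemma compare_1: "d 1 3 * (3 * t) < d 1 2 * (1 - 3 * t) \<longleftrightarrow> t < z1" "d 1 2 * (1 - 3 * t) < d 1 3 * (3 * t) \<longleftrightarrow> z1 < t"
  "d 1 3 * (3 * t) = d 1 2 * (1 - 3 * t) \<longleftrightarrow> t = z1"
proof -
  have "d 1 3 / d 1 2 = (1 - 3 * z1) / (3 * z1)"
    using z_order by (simp add: d_ratio field_simps)
  from ratio_compare[OF _ this, where x = "3 * t" and y = "1 - 3 * t"]
  show "d 1 3 * (3 * t) < d 1 2 * (1 - 3 * t) \<longleftrightarrow> t < z1" "d 1 2 * (1 - 3 * t) < d 1 3 * (3 * t) \<longleftrightarrow> z1 < t"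
    "d 1 3 * (3 * t) = d 1 2 * (1 - 3 * t) \<longleftrightarrow> t = z1"
    using d_pos[of 1 2] z_order by (simp_all add: algebra_simps)
qed

lemma compare_2: "d 2 1 * (3 * t - 1) < d 2 3 * (2 - 3 * t) \<longleftrightarrow> t < z2" "d 2 3 * (2 - 3 * t) < d 2 1 * (3 * t - 1) \<longleftrightarrow> z2 < t"
  "d 2 1 * (3 * t - 1) = d 2 3 * (2 - 3 * t) \<longleftrightarrow> t = z2"
  using ratio_compare[OF _ d_ratio(2), where x = "3 * t - 1" and y = "2 - 3 * t"] d_pos[of 2 3] z_order
  by (simp_all add: algebra_simps)

lemma compare_3: "d 3 2 * (3 * t - 2) < d 3 1 * (3 - 3 * t) \<longleftrightarrow> t < z3" "d 3 1 * (3 - 3 * t) < d 3 2 * (3 * t - 2) \<longleftrightarrow> z3 < t"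
  "d 3 2 * (3 * t - 2) = d 3 1 * (3 - 3 * t) \<longleftrightarrow> t = z3"
  using ratio_compare[OF _ d_ratio(3), where x = "3 * t - 2" and y = "3 - 3 * t"] d_pos[of 3 1] z_order
  by (simp_all add: algebra_simps)

lemma ex_3: "(\<exists>i::3. P i) \<longleftrightarrow> P 1 \<or> P 2 \<or> P 3"
  by (metis exhaust_3)

text \<open>The tie rule assigns each threshold to the piece on its right, which matches the strict
  inequalities in \<open>f_piece\<close>. At a corner two tanks are empty, and the rule gives the
  third one for either of them.\<close>

lemma moves_to_srv:
  assumes t: "t \<in> {0..1}"
  shows "(\<forall>i. phi t $ i = 0 \<longrightarrow> moves_to d (phi t) i j) \<longleftrightarrow> j = srv t"
proof -
  have j: "j = 1 \<or> j = 2 \<or> j = 3"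
    by (rule exhaust_3)
  consider "t = 0" | "0 < t" "t < 1 / 3" | "t = 1 / 3" | "1 / 3 < t" "t < 2 / 3" | "t = 2 / 3" | "2 / 3 < t" "t < 1" | "t = 1"
    using t by (auto, linarith)
  then show ?thesis
  proof cases
    case 2
    have "(\<forall>i. phi t $ i = 0 \<longrightarrow> moves_to d (phi t) i j) \<longleftrightarrow> moves_to d (phi t) 1 j"
      using 2 by (simp add: forall_3 phi_nth)
    also have "\<dots> \<longleftrightarrow> j = srv t"
      using j 2 z_order compare_1[of t]
      by (elim disjE) (auto simp: moves_to_def forall_3 ex_3 phi_nth srv_cases tie_tank_def)
    finally show ?thesis .
  next
    case 4
    have "(\<forall>i. phi t $ i = 0 \<longrightarrow> moves_to d (phi t) i j) \<longleftrightarrow> moves_to d (phi t) 2 j"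
      using 4 by (simp add: forall_3 phi_nth)
    also have "\<dots> \<longleftrightarrow> j = srv t"
      using j 4 z_order compare_2[of t]
      by (elim disjE) (auto simp: moves_to_def forall_3 ex_3 phi_nth srv_cases tie_tank_def)
    finally show ?thesis .
  next
    case 6
    have "(\<forall>i. phi t $ i = 0 \<longrightarrow> moves_to d (phi t) i j) \<longleftrightarrow> moves_to d (phi t) 3 j"
      using 6 by (simp add: forall_3 phi_nth)
    also have "\<dots> \<longleftrightarrow> j = srv t"
      using j 6 z_order compare_3[of t]
      by (elim disjE) (auto simp: moves_to_def forall_3 ex_3 phi_nth srv_cases tie_tank_def)
    finally show ?thesis .
  qed (use j z_order in \<open>auto simp: moves_to_def forall_3 ex_3 phi_nth srv_cases\<close>)
qed

end

subsection \<open>Trajectories\<close>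

lemmas server_trajectoryD =
  server_trajectory_def[THEN iffD1, THEN conjunct1]
  server_trajectory_def[THEN iffD1, THEN conjunct2, THEN conjunct1]
  server_trajectory_def[THEN iffD1, THEN conjunct2, THEN conjunct2, THEN conjunct1]
  server_trajectory_def[THEN iffD1, THEN conjunct2, THEN conjunct2, THEN conjunct2, THEN conjunct1]
  server_trajectory_def[THEN iffD1, THEN conjunct2, THEN conjunct2, THEN conjunct2, THEN conjunct2, THEN conjunct1]
  server_trajectory_def[THEN iffD1, THEN conjunct2, THEN conjunct2, THEN conjunct2, THEN conjunct2, THEN conjunct2]

lemma not_switching: "(\<And>i. 0 < v r $ i) \<Longrightarrow> r \<notin> switching_times v"
proof
  assume p: "\<And>i. 0 < v r $ i" and "r \<in> switching_times v"
  then obtain i where "v r $ i = 0"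
    by (auto simp: switching_times_def)
  with p[of i] show False
    by simp
qed

lemma trajectory_linear:
  assumes tr: "server_trajectory d v l" and s: "0 \<le> s" "s \<le> t" and l: "\<And>r. s \<le> r \<Longrightarrow> r < t \<Longrightarrow> l r = j"
  shows "v t = v s + (t - s) *\<^sub>R dir j"
  unfolding vec_eq_iff
proof
  fix i
  define f where "f r = 1 / 3 - (if l r = i then 1 else (0::real))" for r
  have int: "(f has_integral (v r $ i - v 0 $ i)) {0..r}" if "0 \<le> r" for r
    using server_trajectoryD(3)[OF tr] that unfolding f_def by blast
  have "integral {0..s} f + integral {s..t} f = integral {0..t} f"
    using s int[of t] by (intro Henstock_Kurzweil_Integration.integral_combine) auto
  then have "integral {s..t} f = v t $ i - v s $ i"
    using integral_unique[OF int[of s]] integral_unique[OF int[of t]] s by simp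
  moreover
  have "((\<lambda>r. dir j $ i) has_integral (t - s) * dir j $ i) {s..t}"
    using has_integral_const_real[of "dir j $ i" s t] s by simp
  \<comment> \<open>At the right end the server may already have moved; a single point does not
    affect the integral.\<close>
  then have "(f has_integral (t - s) * dir j $ i) {s..t}"
    by (rule has_integral_spike_finite[of "{t}", rotated 2]) (auto simp: f_def dir_nth l)
  from integral_unique[OF this] have "integral {s..t} f = (t - s) * dir j $ i" .
  ultimately show "v t $ i = (v s + (t - s) *\<^sub>R dir j) $ i"
    by simp
qed

text \<open>Let b be the infimum of the times before \<open>e\<close> at which the server is
  elsewhere. Up to b the motion is linear and no tank is empty after \<open>s\<close>, so the server
  is still in place at time b; right continuity keeps it there a little longer, contrary to the
  choice of b.\<close>

lemma trajectory_flow: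
  assumes tr: "server_trajectory d v l" and s: "0 \<le> s" and pos: "0 < v s $ l s"
  defines "e \<equiv> s + 3 / 2 * v s $ l s"
  shows "\<And>t. s \<le> t \<Longrightarrow> t < e \<Longrightarrow> l t = l s"
    and "\<And>t. s \<le> t \<Longrightarrow> t \<le> e \<Longrightarrow> v t = v s + (t - s) *\<^sub>R dir (l s)"
    and "\<And>t i. s < t \<Longrightarrow> t < e \<Longrightarrow> 0 < v t $ i"
    and "v e $ l s = 0"
proof -
  define j where "j = l s"
  have D: "v s \<in> Delta"
    using server_trajectoryD(1)[OF tr] s by blast
  have inside: "0 < (v s + (t - s) *\<^sub>R dir j) $ i" if "s < t" "t < e" for t i
  proof (cases "i = j")
    case True
    then show ?thesis
      using that by (simp add: dir_nth e_def j_def)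
  next
    case False
    have "0 \<le> v s $ i"
      using D by (simp add: Delta_def)
    then show ?thesis
      using that False by (simp add: dir_nth add_nonneg_pos)
  qed
  define B where "B = {t. s \<le> t \<and> t < e \<and> l t \<noteq> j}"
  have "B = {}"
  proof (rule ccontr)
    assume ne: "B \<noteq> {}"
    have bdd: "bdd_below B"
      by (rule bdd_belowI[of _ s]) (simp add: B_def)
    define b where "b = Inf B"
    have b: "s \<le> b" "b < e"
    proof -
      show "s \<le> b"
        unfolding b_def using ne by (intro cInf_greatest) (auto simp: B_def)
      obtain t where "t \<in> B"
        using ne by blast
      then show "b < e"
        using cInf_lower[OF _ bdd, of t] by (auto simp: b_def B_def)
    qed
    have before: "l r = j" if "s \<le> r" "r < b" for r
    proof (rule ccontr)
      assume "l r \<noteq> j"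
      then have "r \<in> B"
        using that b by (simp add: B_def)
      then show False
        using cInf_lower[OF _ bdd, of r] that by (simp add: b_def)
    qed
    have lb: "l b = j"
    proof (cases "b = s")
      case False
      have "{s<..b} \<inter> switching_times v = {}"
      proof -
        have "0 < v r $ i" if "r \<in> {s<..b}" for r i
        proof -
          have "v r = v s + (r - s) *\<^sub>R dir j"
            using that by (intro trajectory_linear[OF tr s]) (auto intro: before)
          then show ?thesis
            using inside[of r i] that b by auto
        qed
        then show ?thesis
          using not_switching by blast
      qed
      moreover have "s < b"
        using b(1) False by simp
      ultimately show ?thesis
        using server_trajectoryD(6)[OF tr] s unfolding j_def by blast
    qed (simp add: j_def)
    have "\<forall>\<^sub>F r in at_right b. l r = l b"
      using server_trajectoryD(4)[OF tr] order_trans[OF s b(1)] by blast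
    then obtain c where c: "b < c" "\<And>r. b < r \<Longrightarrow> r < c \<Longrightarrow> l r = j"
      unfolding eventually_at_right_field lb by blast
    have "c \<le> b"
      unfolding b_def
    proof (rule cInf_greatest[OF ne])
      fix t assume t: "t \<in> B"
      then have "b \<le> t"
        using cInf_lower[OF _ bdd] by (simp add: b_def)
      moreover have "t \<noteq> b"
        using t lb by (auto simp: B_def)
      ultimately show "c \<le> t"
        using c(2)[of t] t by (cases "t < c") (auto simp: B_def)
    qed
    with c(1) show False
      by simp
  qed
  then show l: "l t = l s" if "s \<le> t" "t < e" for t
    using that unfolding B_def j_def by blast
  show lin: "v t = v s + (t - s) *\<^sub>R dir (l s)" if "s \<le> t" "t \<le> e" for t
    using that(1)
  proof (rule trajectory_linear[OF tr s])
    show "l r = l s" if "s \<le> r" "r < t" for r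
      using that \<open>t \<le> e\<close> by (intro l) auto
  qed
  show "0 < v t $ i" if "s < t" "t < e" for t i
    using lin[of t] inside[OF that, of i] that unfolding j_def by simp
  show "v e $ l s = 0"
    using lin[of e] pos by (simp add: e_def dir_nth)
qed

context server_params
begin

lemma trajectory_step:
  assumes tr: "server_trajectory d v l" and s: "0 \<le> s" and t: "t \<in> {0..1}" and v: "v s = phi t"
  defines "e \<equiv> s + 3 / 2 * vol t"
  shows "l s = srv t" "v e = phi (f_map t)" "\<And>r. s < r \<Longrightarrow> r < e \<Longrightarrow> r \<notin> switching_times v"
    "e \<in> switching_times v" "s < e" "s \<in> switching_times v"
proof -
  have vp: "0 < vol t"
    using vol_ge[OF t] vol_min_pos by simp
  have "\<forall>i. phi t $ i = 0 \<longrightarrow> moves_to d (phi t) i (l s)"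
    using server_trajectoryD(5)[OF tr] s unfolding v[symmetric] by blast
  then show ls: "l s = srv t"
    using moves_to_srv[OF t] by blast
  have p: "0 < v s $ l s" and e: "e = s + 3 / 2 * v s $ l s"
    using vp by (simp_all add: v ls e_def vol_def)
  note flow = trajectory_flow[OF tr s p, folded e]
  show se: "s < e"
    using vp by (simp add: e_def)
  have "v e = v s + (e - s) *\<^sub>R dir (l s)"
    using flow(2)[of e] se by simp
  then show ve: "v e = phi (f_map t)"
    using phi_step[OF t] by (simp add: v ls e_def)
  show "r \<notin> switching_times v" if "s < r" "r < e" for r
    using flow(3)[OF that] by (rule not_switching)
  show "e \<in> switching_times v"
    using flow(4) se s by (auto simp: switching_times_def)
  have "phi t \<in> bd_Delta"
    using phi_in_bd[OF t] .
  then show "s \<in> switching_times v"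
    using s v by (auto simp: switching_times_def bd_Delta_def)
qed

text \<open>Switching times of a trajectory that is in the state \<open>phi t\<close> at time
  \<open>s\<close>, computed from \<open>f_map\<close> alone.\<close>

definition times :: "real \<Rightarrow> real \<Rightarrow> nat \<Rightarrow> real" where
  "times s t n = s + (\<Sum>k<n. 3 / 2 * vol ((f_map ^^ k) t))"

lemma times_Suc: "times s t (Suc n) = times s t n + 3 / 2 * vol ((f_map ^^ n) t)"
  by (simp add: times_def)

lemma times_less: "t \<in> {0..1} \<Longrightarrow> times s t n < times s t (Suc n)"
proof -
  assume "t \<in> {0..1}"
  then have "vol_min \<le> vol ((f_map ^^ n) t)"
    by (intro vol_ge f_iter_range)
  then show ?thesis
    unfolding times_Suc using vol_min_pos by simp
qed

lemma times_mono: "t \<in> {0..1} \<Longrightarrow> strict_mono (times s t)"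
  by (simp add: strict_mono_Suc_iff times_less)

lemma times_unbounded: "t \<in> {0..1} \<Longrightarrow> \<exists>n. r < times s t n"
proof -
  assume t: "t \<in> {0..1}"
  obtain n where n: "(r - s) / (3 / 2 * vol_min) < real n"
    using reals_Archimedean2 by blast
  have "real n * (3 / 2 * vol_min) = (\<Sum>k<n. 3 / 2 * vol_min)"
    by simp
  also have "\<dots> \<le> (\<Sum>k<n. 3 / 2 * vol ((f_map ^^ k) t))"
    using vol_ge[OF f_iter_range[OF t]] by (intro sum_mono) simp
  finally have "real n * (3 / 2 * vol_min) \<le> times s t n - s"
    by (simp add: times_def)
  moreover have "r - s < real n * (3 / 2 * vol_min)"
    using n vol_min_pos by (simp add: pos_divide_less_eq)
  ultimately show ?thesis
    by (intro exI[of _ n]) simp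
qed

lemma trajectory_times:
  assumes tr: "server_trajectory d v l" and s: "0 \<le> s" and t: "t \<in> {0..1}" and v: "v s = phi t"
  shows "0 \<le> times s t n \<and> v (times s t n) = phi ((f_map ^^ n) t)"
proof (induction n)
  case 0
  then show ?case
    using s v by (simp add: times_def)
next
  case (Suc n)
  then show ?case
    using trajectory_step(2,5)[OF tr _ f_iter_range[OF t], of "times s t n" n] times_less[OF t, of s n]
    by (auto simp: times_Suc)
qed

lemma switching_is_time:
  assumes tr: "server_trajectory d v l" and s: "0 \<le> s" and t: "t \<in> {0..1}" and v: "v s = phi t"
    and r: "r \<in> switching_times v" "s \<le> r"
  shows "\<exists>n. r = times s t n"
proof -
  define n where "n = (LEAST n. r < times s t n)"
  have n: "r < times s t n"
    unfolding n_def using times_unbounded[OF t] by (rule LeastI_ex)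
  have "n \<noteq> 0"
    using n r(2) by (intro notI) (simp add: times_def)
  then obtain m where m: "n = Suc m"
    by (cases n) auto
  have "\<not> r < times s t m"
    using not_less_Least[of m "\<lambda>n. r < times s t n"] m by (simp add: n_def)
  moreover have "\<not> times s t m < r"
    using trajectory_step(3)[OF tr _ f_iter_range[OF t], of "times s t m" m r] trajectory_times[OF tr s t v, of m]
      n r(1) by (auto simp: m times_Suc)
  ultimately show ?thesis
    by (intro exI[of _ m]) simp
qed

text \<open>If time 0 is not a switching time, the tank served at the start is the first to become
  empty, after 3/2 of its volume. From the first switching time on, \<open>times\<close> lists all
  of them.\<close>

lemma switch_time_eq:
  assumes tr: "server_trajectory d v l"
  shows "\<exists>s t. 0 \<le> s \<and> t \<in> {0..1} \<and> v s = phi t \<and> (\<forall>n. switch_time v n = times s t n)"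
proof -
  have D: "v r \<in> Delta" if "0 \<le> r" for r
    using server_trajectoryD(1)[OF tr] that by blast
  have "\<exists>s. s \<in> switching_times v \<and> (\<forall>r\<in>switching_times v. s \<le> r)"
  proof (cases "0 \<in> switching_times v")
    case True
    then show ?thesis
      by (intro exI[of _ 0]) (auto simp: switching_times_def)
  next
    case False
    have "v 0 $ l 0 \<noteq> 0" "0 \<le> v 0 $ l 0"
      using server_trajectoryD(2)[OF tr] D[of 0] by (simp_all add: Delta_def)
    then have p: "0 < v 0 $ l 0"
      by simp
    note flow = trajectory_flow[OF tr order_refl p]
    have "3 / 2 * v 0 $ l 0 \<in> switching_times v"
      using flow(4) p by (auto simp: switching_times_def)
    moreover have "3 / 2 * v 0 $ l 0 \<le> r" if "r \<in> switching_times v" for r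
    proof (rule ccontr)
      assume *: "\<not> 3 / 2 * v 0 $ l 0 \<le> r"
      have "0 < r"
        using that False by (cases "r = 0") (auto simp: switching_times_def)
      then have "r \<notin> switching_times v"
        using * by (intro not_switching flow(3)) auto
      with that show False
        by simp
    qed
    ultimately show ?thesis
      by blast
  qed
  then obtain s where s: "s \<in> switching_times v" "\<And>r. r \<in> switching_times v \<Longrightarrow> s \<le> r"
    by blast
  have s0: "0 \<le> s"
    using s(1) by (simp add: switching_times_def)
  have "v s \<in> bd_Delta"
    using s(1) D[OF s0] by (auto simp: switching_times_def bd_Delta_def)
  then obtain t where t: "t \<in> {0..1}" "v s = phi t"
    using bd_Delta_phi by metis
  have "switch_time v n = times s t n" for n
  proof (induction n)
    case 0
    show ?case
      using s by (simp add: times_def Least_equality)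
  next
    case (Suc n)
    have st: "times s t (Suc n) \<in> switching_times v"
      using trajectory_step(6)[OF tr _ f_iter_range[OF t(1)], of "times s t (Suc n)" "Suc n"]
        trajectory_times[OF tr s0 t, of "Suc n"] by blast
    have "(LEAST r. r \<in> switching_times v \<and> times s t n < r) = times s t (Suc n)"
    proof (rule Least_equality)
      show "times s t (Suc n) \<in> switching_times v \<and> times s t n < times s t (Suc n)"
        using st times_less[OF t(1)] by blast
      fix r assume r: "r \<in> switching_times v \<and> times s t n < r"
      then obtain m where m: "r = times s t m"
        using switching_is_time[OF tr s0 t, of r] s(2) by blast
      then have "n < m"
        using r strict_mono_less[OF times_mono[OF t(1)]] by blast
      then show "times s t (Suc n) \<le> r"
        using m strict_mono_less_eq[OF times_mono[OF t(1)]] by (simp add: Suc_le_eq)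
    qed
    then show ?case
      by (simp add: Suc)
  qed
  with s0 t show ?thesis
    by blast
qed

end

context server_params
begin

subsection \<open>Existence of trajectories\<close>

context
  fixes t0 :: real
  assumes t0: "t0 \<in> {0..1}"
begin

definition state :: "nat \<Rightarrow> real" where
  "state n = (f_map ^^ n) t0"

text \<open>Number of the last switching time up to \<open>t\<close>; it exists because the
  switching times tend to infinity.\<close>

definition idx :: "real \<Rightarrow> nat" where
  "idx t = (LEAST n. t < times 0 t0 (Suc n))"

definition flow :: "real \<Rightarrow> real^3" where
  "flow t = phi (state (idx t)) + (t - times 0 t0 (idx t)) *\<^sub>R dir (srv (state (idx t)))"

definition pos :: "real \<Rightarrow> 3" where
  "pos t = srv (state (idx t))"

lemma state_range: "state n \<in> {0..1}"
  unfolding state_def using f_iter_range[OF t0] .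

lemma times_0: "times 0 t0 0 = 0"
  by (simp add: times_def)

lemma times_nonneg: "0 \<le> times 0 t0 n"
  using strict_mono_less_eq[OF times_mono[OF t0, of 0], of 0 n] by (simp add: times_0)

lemma idx_bounds: "0 \<le> t \<Longrightarrow> times 0 t0 (idx t) \<le> t \<and> t < times 0 t0 (Suc (idx t))"
proof -
  assume t: "0 \<le> t"
  obtain n where "t < times 0 t0 n"
    using times_unbounded[OF t0] by blast
  then have "t < times 0 t0 (Suc n)"
    using times_less[OF t0, of 0 n] by linarith
  then have 1: "t < times 0 t0 (Suc (idx t))"
    unfolding idx_def by (rule LeastI)
  have "times 0 t0 (idx t) \<le> t"
  proof (cases "idx t")
    case 0
    then show ?thesis
      using t by (simp add: times_0)
  next
    case (Suc m)
    then have "\<not> t < times 0 t0 (Suc m)"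
      using not_less_Least[of m "\<lambda>n. t < times 0 t0 (Suc n)"] by (simp add: idx_def)
    with Suc show ?thesis
      by simp
  qed
  with 1 show ?thesis
    by blast
qed

lemma idx_eq: "times 0 t0 n \<le> t \<Longrightarrow> t < times 0 t0 (Suc n) \<Longrightarrow> idx t = n"
proof -
  assume n: "times 0 t0 n \<le> t" "t < times 0 t0 (Suc n)"
  have b: "times 0 t0 (idx t) \<le> t" "t < times 0 t0 (Suc (idx t))"
    using idx_bounds[of t] n(1) times_nonneg[of n] by auto
  have "times 0 t0 n < times 0 t0 (Suc (idx t))" "times 0 t0 (idx t) < times 0 t0 (Suc n)"
    using n b by linarith+
  then show ?thesis
    using strict_mono_less[OF times_mono[OF t0, of 0]] by auto
qed

lemma idx_times: "idx (times 0 t0 n) = n"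
  by (intro idx_eq times_less[OF t0]) simp

lemma flow_times: "flow (times 0 t0 n) = phi (state n)"
  by (simp add: flow_def idx_times)

text \<open>At the right end \<open>flow\<close> already uses the next linear piece, and the two
  pieces agree there by \<open>phi_step\<close>. So the trajectory is continuous.\<close>

lemma flow_on:
  assumes "times 0 t0 n \<le> t" "t \<le> times 0 t0 (Suc n)"
  shows "flow t = phi (state n) + (t - times 0 t0 n) *\<^sub>R dir (srv (state n))"
proof (cases "t = times 0 t0 (Suc n)")
  case True
  have "flow t = phi (f_map (state n))"
    unfolding True flow_times by (simp add: state_def)
  also have "\<dots> = phi (state n) + (t - times 0 t0 n) *\<^sub>R dir (srv (state n))"
    using phi_step[OF state_range, of n] by (simp add: True times_Suc state_def)
  finally show ?thesis .
next
  case False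
  then have "idx t = n"
    using assms by (intro idx_eq) auto
  then show ?thesis
    by (simp add: flow_def)
qed

lemma flow_pos:
  assumes t: "0 \<le> t" and ne: "t \<noteq> times 0 t0 (idx t)"
  shows "0 < flow t $ i"
proof -
  note b = idx_bounds[OF t]
  have nn: "0 \<le> phi (state (idx t)) $ i"
    using phi_in_Delta[OF state_range] by (simp add: Delta_def)
  have lt: "0 < t - times 0 t0 (idx t)" "t - times 0 t0 (idx t) < 3 / 2 * vol (state (idx t))"
    using b ne by (auto simp: times_Suc state_def)
  show ?thesis
  proof (cases "i = srv (state (idx t))")
    case True
    then show ?thesis
      using lt by (simp add: flow_def dir_nth vol_def)
  next
    case False
    then show ?thesis
      using lt nn by (simp add: flow_def dir_nth add_nonneg_pos)
  qed
qed

lemma flow_integral: 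
  "((\<lambda>s. 1/3 - (if pos s = i then 1 else 0)) has_integral (flow t $ i - flow 0 $ i)) {0..t}" if "0 \<le> t"
proof -
  define f where "f = (\<lambda>s. 1 / 3 - (if pos s = i then 1 else (0::real)))"
  have piece: "(f has_integral (flow t $ i - flow (times 0 t0 n) $ i)) {times 0 t0 n..t}"
    if "times 0 t0 n \<le> t" "t \<le> times 0 t0 (Suc n)" for n t
  proof -
    have "((\<lambda>r. dir (srv (state n)) $ i) has_integral (t - times 0 t0 n) * dir (srv (state n)) $ i) {times 0 t0 n..t}"
      using has_integral_const_real[of "dir (srv (state n)) $ i" "times 0 t0 n" t] that by simp
    then have "(f has_integral (t - times 0 t0 n) * dir (srv (state n)) $ i) {times 0 t0 n..t}"
    proof (rule has_integral_spike_finite[of "{t}", rotated 2])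
      fix s assume "s \<in> {times 0 t0 n..t} - {t}"
      then have "idx s = n"
        using that by (intro idx_eq) auto
      then show "f s = dir (srv (state n)) $ i"
        by (simp add: f_def pos_def dir_nth)
    qed simp
    then show ?thesis
      using flow_on[OF that] flow_times[of n] by simp
  qed
  have upto: "(f has_integral (flow (times 0 t0 n) $ i - flow 0 $ i)) {0..times 0 t0 n}" for n
  proof (induction n)
    case 0
    then show ?case
      using has_integral_refl(2)[of f 0] by (simp add: times_0)
  next
    case (Suc n)
    have "(f has_integral (flow (times 0 t0 n) $ i - flow 0 $ i) + (flow (times 0 t0 (Suc n)) $ i - flow (times 0 t0 n) $ i))
        {0..times 0 t0 (Suc n)}"
      using times_less[OF t0, of 0 n] times_nonneg
      by (intro has_integral_combine[OF _ _ Suc piece]) auto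
    then show ?case
      by simp
  qed
  have "(f has_integral (flow (times 0 t0 (idx t)) $ i - flow 0 $ i) + (flow t $ i - flow (times 0 t0 (idx t)) $ i)) {0..t}"
    using idx_bounds[OF that] times_nonneg
    by (intro has_integral_combine[OF _ _ upto piece]) auto
  then show ?thesis
    by (simp add: f_def)
qed

lemma flow_trajectory: "server_trajectory d flow pos"
  unfolding server_trajectory_def
proof (intro conjI allI impI)
  fix t :: real assume t: "0 \<le> t"
  note b = idx_bounds[OF t]
  have D: "phi (state n) \<in> Delta" for n
    using phi_in_Delta[OF state_range] .
  show "flow t \<in> Delta"
  proof (cases "t = times 0 t0 (idx t)")
    case True
    then show ?thesis
      using D flow_times by metis
  next
    case False
    have "(\<Sum>i\<in>UNIV. dir j $ i) = 0" for j
      using exhaust_3[of j] by (auto simp: sum_3 dir_nth)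
    then have "(\<Sum>i\<in>UNIV. flow t $ i) = 1"
      using D by (simp add: flow_def sum.distrib Delta_def flip: sum_distrib_left)
    then show ?thesis
      using flow_pos[OF t False] by (auto simp: Delta_def less_imp_le)
  qed
  show "((\<lambda>s. 1/3 - (if pos s = i then 1 else 0)) has_integral (flow t $ i - flow 0 $ i)) {0..t}" for i
    using flow_integral[OF t] .
  show "\<forall>\<^sub>F s in at_right t. pos s = pos t"
  proof -
    have "pos s = pos t" if "t < s" "s < times 0 t0 (Suc (idx t))" for s
    proof -
      have "idx s = idx t"
        using b that by (intro idx_eq) auto
      then show ?thesis
        by (simp add: pos_def)
    qed
    with b show ?thesis
      unfolding eventually_at_right_field by blast
  qed
  show "moves_to d (flow t) i (pos t)" if z: "flow t $ i = 0" for i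
  proof -
    have "t = times 0 t0 (idx t)"
      using flow_pos[OF t, of i] z by fastforce
    then have "flow t = phi (state (idx t))"
      using flow_times by metis
    then show ?thesis
      using moves_to_srv[OF state_range, of "idx t" "pos t"] z by (simp add: pos_def)
  qed
next
  have "flow 0 = phi (state 0)" "pos 0 = srv (state 0)"
    using flow_times[of 0] idx_times[of 0] by (simp_all add: times_0 pos_def)
  then show "flow 0 $ pos 0 \<noteq> 0"
    using vol_ge[OF state_range, of 0] vol_min_pos by (simp add: vol_def)
next
  fix s t assume st: "0 \<le> s \<and> s < t \<and> {s<..t} \<inter> switching_times flow = {}"
  then have b: "t < times 0 t0 (Suc (idx t))" "times 0 t0 (idx t) \<le> t"
    "s < times 0 t0 (Suc (idx s))" "times 0 t0 (idx s) \<le> s"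
    using idx_bounds[of s] idx_bounds[of t] by auto
  have "times 0 t0 (Suc (idx s)) \<in> switching_times flow"
    using phi_in_bd[OF state_range] times_nonneg flow_times
    by (auto simp: switching_times_def bd_Delta_def)
  then have "t < times 0 t0 (Suc (idx s))"
    using st b(3) by (force simp: disjoint_iff)
  then have "idx t = idx s"
    using b st by (intro idx_eq) auto
  then show "pos t = pos s"
    by (simp add: pos_def)
qed

lemma flow_0: "flow 0 = phi t0"
  using flow_times[of 0] by (simp add: times_0 state_def)

end

lemma trajectory_exists: "t \<in> {0..1} \<Longrightarrow> \<exists>v l. server_trajectory d v l \<and> v 0 = phi t"
  using flow_trajectory flow_0 by blast

subsection \<open>The Poincare map\<close>

text \<open>The definite description ranges over all trajectories through the state. One exists by
  \<open>trajectory_exists\<close>, and \<open>trajectory_step\<close> gives all of them the same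
  state at the next switching time.\<close>

lemma poincare_phi:
  assumes t: "t \<in> {0..1}"
  shows "poincare_map d (phi t) = phi (f_map t)"
  unfolding poincare_map_def
proof (rule the_equality)
  obtain v l where v: "server_trajectory d v l" "v 0 = phi t"
    using trajectory_exists[OF t] by blast
  note step = trajectory_step[OF v(1) order_refl t v(2)]
  show "\<exists>v l s r. server_trajectory d v l \<and> s \<in> switching_times v \<and> r \<in> switching_times v \<and> s < r \<and>
        {s<..<r} \<inter> switching_times v = {} \<and> v s = phi t \<and> v r = phi (f_map t)"
    using v step by (intro exI[of _ v] exI[of _ l] exI[of _ 0] exI[of _ "0 + 3 / 2 * vol t"]) auto
next
  fix y assume "\<exists>v l s r. server_trajectory d v l \<and> s \<in> switching_times v \<and> r \<in> switching_times v \<and> s < r \<and>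
        {s<..<r} \<inter> switching_times v = {} \<and> v s = phi t \<and> v r = y"
  then obtain v l s r where v: "server_trajectory d v l" and sr: "s \<in> switching_times v" "r \<in> switching_times v" "s < r"
      "{s<..<r} \<inter> switching_times v = {}" "v s = phi t" "v r = y"
    by blast
  have "0 \<le> s"
    using sr(1) by (simp add: switching_times_def)
  note step = trajectory_step[OF v this t sr(5)]
  have "\<not> r < s + 3 / 2 * vol t"
    using step(3)[of r] sr(2,3) by blast
  moreover have "\<not> s + 3 / 2 * vol t < r"
    using step(4,5) sr(4) by (auto simp: disjoint_iff)
  ultimately show "y = phi (f_map t)"
    using step(2) sr(6) by (metis linorder_neqE)
qed

lemma poincare_iter: "t \<in> {0..1} \<Longrightarrow> (poincare_map d ^^ n) (phi t) = phi ((f_map ^^ n) t)"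
  by (induction n) (simp_all add: poincare_phi f_iter_range del: atLeastAtMost_iff)

lemma poincare_maps: "poincare_map d \<in> bd_Delta \<rightarrow> bd_Delta"
proof
  fix x assume "x \<in> bd_Delta"
  then obtain t where "t \<in> {0..1}" "phi t = x"
    using bd_Delta_phi by blast
  then show "poincare_map d x \<in> bd_Delta"
    using poincare_phi[of t] phi_in_bd f_map_Icc by metis
qed

text \<open>Values of \<open>f_map\<close> lie in the open interval, where \<open>phi\<close> has a
  unique preimage, so the choice in \<open>inv_into\<close> is forced.\<close>

lemma poincare_interval: "t \<in> {0..1} \<Longrightarrow> poincare_interval_map d t = f_map t"
proof -
  assume t: "t \<in> {0..1}"
  have f: "f_map t \<in> {0<..<1}" "phi (f_map t) \<in> phi ` {0..1}"
    using f_map_range[OF t] by auto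
  have "inv_into {0..1} phi (phi (f_map t)) = f_map t"
    using inv_into_into[OF f(2)] f_inv_into_f[OF f(2)] by (intro phi_inj[OF _ f(1)]) auto
  then show ?thesis
    by (simp add: poincare_interval_map_def poincare_phi[OF t])
qed

lemma semiconjugate: "semiconjugate_to_T (poincare_interval_map d)"
  unfolding semiconjugate_to_T_def
proof (intro conjI exI[of _ hh])
  show "poincare_interval_map d \<in> {0..1} \<rightarrow> {0..1}"
    using poincare_interval f_map_Icc by (auto simp del: atLeastAtMost_iff)
  show "mono_on {0..1} hh"
    using hh_mono by (intro mono_onI) auto
  show "\<forall>t\<in>{0..1}. hh (poincare_interval_map d t) = T_map (hh t)"
    using hh_f_map poincare_interval by simp
qed (rule hh_continuous hh_image)+

lemma omega_limit_eq:
  assumes t: "t \<in> {0..1}"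
  shows "omega_limit (poincare_map d) (phi t) = phi ` attractor"
proof
  show "phi ` attractor \<subseteq> omega_limit (poincare_map d) (phi t)"
  proof
    fix y assume "y \<in> phi ` attractor"
    then obtain s where s: "s \<in> attractor" "y = phi s"
      by blast
    obtain r where r: "strict_mono (r :: nat \<Rightarrow> nat)" "(\<lambda>n. (f_map ^^ r n) t) \<longlonglongrightarrow> s"
      using attractor_subsequence[OF s(1) t] by blast
    have "s \<in> {0..1}"
      using s(1) by (simp add: attractor_def)
    then have "(\<lambda>n. phi ((f_map ^^ r n) t)) \<longlonglongrightarrow> phi s"
      by (intro continuous_on_tendsto_compose[OF phi_continuous r(2)] always_eventually allI f_iter_range[OF t])
    then show "y \<in> omega_limit (poincare_map d) (phi t)"
      unfolding omega_limit_def s(2) poincare_iter[OF t] using r(1) by blast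
  qed
  show "omega_limit (poincare_map d) (phi t) \<subseteq> phi ` attractor"
  proof
    fix y assume "y \<in> omega_limit (poincare_map d) (phi t)"
    then obtain r where r: "strict_mono (r :: nat \<Rightarrow> nat)" "(\<lambda>n. phi ((f_map ^^ r n) t)) \<longlonglongrightarrow> y"
      unfolding omega_limit_def poincare_iter[OF t] by blast
    \<comment> \<open>A limit in the triangle is lifted to a parameter in [0, 1] by compactness,
      along a further subsequence.\<close>
    have "\<forall>n. (f_map ^^ r n) t \<in> {0..1}"
      using f_iter_range[OF t] by blast
    then obtain s q where q: "s \<in> {0..1}" "strict_mono (q :: nat \<Rightarrow> nat)" "((\<lambda>n. (f_map ^^ r n) t) \<circ> q) \<longlonglongrightarrow> s"
      using compact_Icc[of "0::real" 1] unfolding compact_def by metis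
    have lim: "(\<lambda>n. (f_map ^^ r (q n)) t) \<longlonglongrightarrow> s"
      using q(3) by (simp add: o_def)
    have "s \<in> attractor"
      using limit_in_attractor[OF t strict_mono_o[OF r(1) q(2)]] lim by (simp add: o_def)
    moreover have "(\<lambda>n. phi ((f_map ^^ r (q n)) t)) \<longlonglongrightarrow> phi s"
      by (intro continuous_on_tendsto_compose[OF phi_continuous lim q(1)] always_eventually allI f_iter_range[OF t])
    then have "phi s = y"
      using LIMSEQ_subseq_LIMSEQ[OF r(2) q(2)] unfolding o_def by (rule LIMSEQ_unique)
    ultimately show "y \<in> phi ` attractor"
      by blast
  qed
qed

end

section \<open>Transport of the attractor to the boundary of the simplex\<close>

lemma phi_inj_attractor: "inj_on phi attractor"
proof (rule inj_onI)
  fix s t assume "s \<in> attractor" "t \<in> attractor" "phi s = phi t"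
  moreover have "s \<in> {0<..<1}" "t \<in> {0<..<1}"
    using calculation(1,2) attractor_open_01 by blast+
  ultimately show "s = t"
    by (intro phi_inj) auto
qed

lemma attractor_compact: "compact attractor"
  using attractor_closed unfolding compact_eq_bounded_closed
  by (auto intro: bounded_subset[of "{0..1}"] simp: attractor_def)

text \<open>\<open>phi\<close> is a homeomorphism from the compact attractor onto its image. A
  connected subset of the image is pulled back to a connected set of reals, which is a single point
  or empty since the attractor contains no interval.\<close>

lemma attractor_cantor: "cantor_set (phi ` attractor)"
  unfolding cantor_set_def
proof (intro conjI ballI allI impI)
  have sub: "attractor \<subseteq> {0..1}"
    by (auto simp: attractor_def)
  have cont: "continuous_on attractor phi"
    using continuous_on_subset[OF phi_continuous sub] .
  show "phi ` attractor \<noteq> {}"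
    using attractor_nonempty by simp
  show "compact (phi ` attractor)"
    using compact_continuous_image[OF cont attractor_compact] .
  show "x islimpt phi ` attractor" if x: "x \<in> phi ` attractor" for x
  proof -
    obtain s where s: "s \<in> attractor" "x = phi s"
      using x by blast
    obtain u where u: "\<And>n. u n \<in> attractor - {s}" "u \<longlonglongrightarrow> s"
      using attractor_perfect[OF s(1)] unfolding islimpt_sequential by blast
    have "(\<lambda>n. phi (u n)) \<longlonglongrightarrow> phi s"
      using continuous_on_tendsto_compose[OF cont u(2) s(1)] u(1) by auto
    moreover have "phi (u n) \<in> phi ` attractor - {phi s}" for n
      using u(1)[of n] s(1) inj_onD[OF phi_inj_attractor, of "u n" s] by auto
    ultimately show ?thesis
      unfolding islimpt_sequential s(2) by (intro exI[of _ "\<lambda>n. phi (u n)"]) blast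
  qed
  obtain g where g: "homeomorphism attractor (phi ` attractor) phi g"
    using homeomorphism_compact[OF attractor_compact cont refl phi_inj_attractor] by blast
  show "\<exists>a. D \<subseteq> {a}" if D: "D \<subseteq> phi ` attractor \<and> connected D" for D
  proof -
    have "connected (g ` D)"
      using D g by (intro connected_continuous_image) (auto simp: homeomorphism_def intro: continuous_on_subset)
    moreover have gD: "g ` D \<subseteq> attractor"
      using D g by (auto simp: homeomorphism_def)
    ultimately have single: "a = b" if "a \<in> g ` D" "b \<in> g ` D" for a b
      using that attractor_interior[of a b] attractor_interior[of b a] connected_contains_Icc[of "g ` D"]
      by (metis linorder_neqE order_trans)
    have pg: "phi (g y) = y" if "y \<in> D" for y
      using D g that by (auto simp: homeomorphism_def)
    show ?thesis
    proof (cases "D = {}")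
      case False
      then obtain y where y: "y \<in> D"
        by blast
      have "x = y" if "x \<in> D" for x
        using single[of "g x" "g y"] pg[OF that] pg[OF y] that y by (metis imageI)
      then show ?thesis
        by blast
    qed auto
  qed
qed

section \<open>Absence of periodic orbits, and the frequencies\<close>

context server_params
begin

text \<open>Periodicity makes \<open>s + \<tau>\<close> a switching time with the same state as
  \<open>s\<close>, so an iterate of \<open>f_map\<close> returns to \<open>t\<close>, and
  \<open>hh\<close> turns this into a periodic orbit of \<open>T_map\<close>.\<close>

lemma no_periodic_orbit: "\<not> has_periodic_orbit d"
proof
  assume "has_periodic_orbit d"
  then obtain v l \<tau> where tr: "server_trajectory d v l" and \<tau>: "0 < \<tau>" "\<And>t. 0 \<le> t \<Longrightarrow> v (t + \<tau>) = v t"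
    unfolding has_periodic_orbit_def by blast
  obtain s t where s: "0 \<le> s" and t: "t \<in> {0..1}" and v: "v s = phi t"
    using switch_time_eq[OF tr] by blast
  have "phi t \<in> bd_Delta"
    using phi_in_bd[OF t] .
  then have "s + \<tau> \<in> switching_times v"
    using s \<tau> v by (auto simp: switching_times_def bd_Delta_def)
  then obtain n where n: "s + \<tau> = times s t n"
    using switching_is_time[OF tr s t v] \<tau>(1) by force
  have "n \<noteq> 0"
    using n \<tau>(1) by (intro notI) (simp add: times_def)
  then obtain m where m: "n = Suc m"
    by (cases n) auto
  have "phi t = phi ((f_map ^^ n) t)"
    using trajectory_times[OF tr s t v, of n] \<tau>(2)[OF s] v n by simp
  \<comment> \<open>As a value of \<open>f_map\<close> the iterate is neither 0 nor 1, so the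
    identification of these two parameters by \<open>phi\<close> does no harm.\<close>
  moreover have "(f_map ^^ n) t \<in> {0<..<1}"
    using f_map_range[OF f_iter_range[OF t, of m]] by (simp add: m)
  ultimately have "t = (f_map ^^ n) t"
    by (intro phi_inj[OF t])
  then have "hh t = (T_map ^^ n) (hh t)"
    using hh_f_iter[OF t] by metis
  then show False
    using T_aperiodic[OF hh_props(1)[OF t], of n] \<open>n \<noteq> 0\<close> by simp
qed

text \<open>The tank chosen at a switching time depends only on the piece of \<open>f_map\<close>,
  and \<open>hh\<close> maps that piece into the interval of the same number. So counts for tank
  \<open>j\<close> are visit counts of a \<open>T_map\<close>-orbit to the pieces \<open>S\<close>
  assigned to \<open>j\<close>.\<close>

lemma frequency:
  assumes tr: "server_trajectory d v l" and S: "\<And>i. i \<in> {1..4} \<Longrightarrow> (if i = 1 \<or> i = 4 then 2 else if i = 2 then 3 else (1::3)) = j \<longleftrightarrow> i \<in> S"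
    and r: "(\<Sum>i\<in>S \<inter> {1..4}. T_brk i - T_brk (i - 1)) / lam_total = r"
  shows "has_frequency v l j r"
proof -
  obtain s t where s: "0 \<le> s" and t: "t \<in> {0..1}" and v: "v s = phi t" and sw: "\<And>n. switch_time v n = times s t n"
    using switch_time_eq[OF tr] by blast
  have "l (switch_time v k) = j \<longleftrightarrow> (\<exists>i\<in>S. (T_map ^^ k) (hh t) \<in> I_set i)" for k
  proof -
    have "l (switch_time v k) = srv ((f_map ^^ k) t)"
      using trajectory_step(1)[OF tr _ f_iter_range[OF t]] trajectory_times[OF tr s t v, of k] by (simp add: sw)
    then have "l (switch_time v k) = j \<longleftrightarrow> f_piece ((f_map ^^ k) t) \<in> S"
      using S[of "f_piece ((f_map ^^ k) t)"] by (simp add: srv_def f_piece_def)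
    moreover have "(T_map ^^ k) (hh t) \<in> I_set (f_piece ((f_map ^^ k) t))"
      using hh_I_set[OF f_iter_range[OF t]] hh_f_iter[OF t] by metis
    ultimately show ?thesis
      using I_set_disj by blast
  qed
  then show ?thesis
    using T_frequency[OF hh_props(1)[OF t], of S] unfolding has_frequency_def r visits_def by simp
qed

end

text \<open>The quotients are near 0.34445, 0.41827 and 0.23729. The last two percentages are
  truncated rather than rounded, hence a tolerance of one unit of the last digit.\<close>

lemma lam_frequencies:
  "\<bar>lam $ 3 / lam_total - 34.44 / 100\<bar> < 0.01 / 100"
  "\<bar>(lam $ 1 + lam $ 4) / lam_total - 41.82 / 100\<bar> < 0.01 / 100"
  "\<bar>lam $ 2 / lam_total - 23.72 / 100\<bar> < 0.01 / 100"
proof -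
  have L: "1.311106 < lam_total" "lam_total < 1.31111"
    using nu_bounds nu_sum unfolding lam_total_nu by simp_all
  have within: "c - 0.0001 < q \<Longrightarrow> q < c + 0.0001 \<Longrightarrow> \<bar>q - c\<bar> < 0.01 / 100" for c q :: real
    unfolding abs_less_iff by simp
  have close: "\<bar>x / lam_total - c\<bar> < 0.01 / 100" if "(c - 0.0001) * lam_total < x" "x < (c + 0.0001) * lam_total" for x c
  proof -
    have "c - 0.0001 < x / lam_total" "x / lam_total < c + 0.0001"
      using that lam_total_pos by (simp_all add: pos_less_divide_eq pos_divide_less_eq)
    then show ?thesis
      by (rule within)
  qed
  show "\<bar>lam $ 3 / lam_total - 34.44 / 100\<bar> < 0.01 / 100"
    "\<bar>(lam $ 1 + lam $ 4) / lam_total - 41.82 / 100\<bar> < 0.01 / 100"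
    "\<bar>lam $ 2 / lam_total - 23.72 / 100\<bar> < 0.01 / 100"
    by (rule close; use L nu_bounds in \<open>simp add: lam_entries\<close>)+
qed

theorem theorem2p2:
  fixes d1 d2 d3 :: real
  assumes d1: "d1 = 1 / (3 * z1) - 1"
    and d2: "d2 = (2 - 3 * z2) / (3 * z2 - 1)"
    and d3: "d3 = (3 - 3 * z3) / (3 * z3 - 2)"
  shows "0 < d1 \<and> 0 < d2 \<and> 0 < d3 \<and>
    \<bar>d1 - 0.213841\<bar> \<le> 0.0000005 \<and>
    \<bar>d2 - 4.036935\<bar> \<le> 0.0000005 \<and>
    \<bar>d3 - 1.428826\<bar> \<le> 0.0000005 \<and>
    (\<forall>d :: 3 \<Rightarrow> 3 \<Rightarrow> real.
       (\<forall>i j. i \<noteq> j \<longrightarrow> 0 < d i j) \<and>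
       d 1 3 / d 1 2 = d1 \<and> d 2 1 / d 2 3 = d2 \<and> d 3 2 / d 3 1 = d3 \<longrightarrow>
       \<not> has_periodic_orbit d \<and>
       (poincare_map d \<in> bd_Delta \<rightarrow> bd_Delta \<and> semiconjugate_to_T (poincare_interval_map d)) \<and>
       (\<forall>x\<in>bd_Delta. cantor_set (omega_limit (poincare_map d) x)) \<and>
       (\<forall>v l. server_trajectory d v l \<longrightarrow>
          has_frequency v l 1 (lam $ 3 / lam_total) \<and>
          has_frequency v l 2 ((lam $ 1 + lam $ 4) / lam_total) \<and>
          has_frequency v l 3 (lam $ 2 / lam_total))) \<and>
    \<bar>lam $ 3 / lam_total - 34.44 / 100\<bar> < 0.01 / 100 \<and>
    \<bar>(lam $ 1 + lam $ 4) / lam_total - 41.82 / 100\<bar> < 0.01 / 100 \<and>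
    \<bar>lam $ 2 / lam_total - 23.72 / 100\<bar> < 0.01 / 100"
proof (intro conjI allI impI)
  show 1: "\<bar>d1 - 0.213841\<bar> \<le> 0.0000005" and 2: "\<bar>d2 - 4.036935\<bar> \<le> 0.0000005"
    and 3: "\<bar>d3 - 1.428826\<bar> \<le> 0.0000005"
    using d_bounds unfolding d1 d2 d3 by blast+
  show "0 < d1" "0 < d2" "0 < d3"
    using 1 2 3 unfolding abs_le_iff by simp_all
next
  fix d :: "3 \<Rightarrow> 3 \<Rightarrow> real"
  assume d: "(\<forall>i j. i \<noteq> j \<longrightarrow> 0 < d i j) \<and> d 1 3 / d 1 2 = d1 \<and> d 2 1 / d 2 3 = d2 \<and> d 3 2 / d 3 1 = d3"
  interpret server_params d
    by (rule server_params.intro) (use d d1 d2 d3 in auto)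
  show "\<not> has_periodic_orbit d" "poincare_map d \<in> bd_Delta \<rightarrow> bd_Delta" "semiconjugate_to_T (poincare_interval_map d)"
    by (rule no_periodic_orbit poincare_maps semiconjugate)+
  show "\<forall>x\<in>bd_Delta. cantor_set (omega_limit (poincare_map d) x)"
    using bd_Delta_phi omega_limit_eq attractor_cantor by metis
  fix v l assume tr: "server_trajectory d v l"
  show "has_frequency v l 1 (lam $ 3 / lam_total)"
    by (rule frequency[OF tr, of _ "{3}"]) (auto simp: T_brk_def)
  show "has_frequency v l 2 ((lam $ 1 + lam $ 4) / lam_total)"
    by (rule frequency[OF tr, of _ "{1, 4}"]) (auto simp: T_brk_def lam_total_def)
  show "has_frequency v l 3 (lam $ 2 / lam_total)"
    by (rule frequency[OF tr, of _ "{2}"]) (auto simp: T_brk_def)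
qed (rule lam_frequencies)+

end
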